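(* Let $n\ge 1$ and let $U\in C^\infty(\mathbb{R}^n)$ satisfy $Z=\int_{\mathbb{R}^n}e^{-U}\,dx<\infty$. For each $i\in\{1,\dots,n\}$ and each $x_{\backslash i}\in\mathbb{R}^{n-1}$ let $\eta_i^{x_{\backslash i}}\in\mathbb{R}$ be a number with $\eta_i^{x_{\backslash i}}\le\lambda_1^{x_{\backslash i}}$. For $x\in\mathbb{R}^n$ define $$s_i(x)=\eta_i^{x_{\backslash i}}-\sum_{j:\,j\neq i}|\partial_{ij}U(x)|,\qquad \underline{s}(x)=\min_{1\le i\le n}s_i(x),$$ $$q_i(x)=\eta_i^{x_{\backslash i}}-\underline{s}(x),\qquad d_i(x)=s_i(x)-\underline{s}(x),$$ and, for $\gamma\ge0$, $$h^{(\gamma)}(x)=\min_{\emptyset\ne A\subset\{1,\dots,n\}}\frac{1}{|A|}\bigg[\sum_{i\in A}\frac{d_i(x)}{q_i(x)^\gamma}+\sum_{i\in A,\,j\notin A}\frac{|\partial_{ij}U(x)|}{[q_i(x)\vee q_j(x)]^\gamma}\bigg].$$ Then $$\lambda_1(U)\ \ge\ \inf_{x\in\mathbb{R}^n}\bigg\{\underline{s}(x)+\frac{h^{(1/2)}(x)^2}{1+\sqrt{1-h^{(1)}(x)^2}}\bigg\}.$$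
   Context: Let $d\mu_U=e^{-U}dx/Z$, a probability measure on $\mathbb{R}^n$. The spectral gap $\lambda_1(U)$ is the largest constant $\kappa$ such that $\kappa\,\mathrm{Var}_{\mu_U}(f)\le\int_{\mathbb{R}^n}|\nabla f|^2\,d\mu_U$ for all $f\in C_0^\infty(\mathbb{R}^n)$ (smooth functions with compact support), where $\mathrm{Var}_{\mu_U}(f)$ is the variance of $f$ under $\mu_U$. For $x=(x_1,\dots,x_n)\in\mathbb{R}^n$, $x_{\backslash i}\in\mathbb{R}^{n-1}$ denotes the vector obtained from $x$ by removing the $i$-th component. The conditional distribution of $x_i$ given $x_{\backslash i}$ is the probability measure on $\mathbb{R}$ $\mu_U^{x_{\backslash i}}(dx_i)=e^{-U(x)}dx_i/Z(x_{\backslash i})$, with $Z(x_{\backslash i})=\int_{\mathbb{R}}e^{-U(x)}dx_i$, assumed finite for all $i$ and all $x_{\backslash i}$. The quantity $\lambda_1^{x_{\backslash i}}$ is the largest constant such that $\lambda_1^{x_{\backslash i}}\,\mathrm{Var}_{\mu_U^{x_{\backslash i}}}(f)\le\int_{\mathbb{R}}(f')^2\,d\mu_U^{x_{\backslash i}}$ for all $f\in C_0^\infty(\mathbb{R})$. $\partial_{ij}U=\partial^2U/\partial x_i\partial x_j$, $a\vee b=\max\{a,b\}$, $|A|$ is the cardinality of $A$. Note that $q_i(x)\ge d_i(x)\ge 0$ and $q_i(x)\ge|\partial_{ij}U(x)|$ for $j\neq i$; fractions of the form $0/0$ are read as $0$. *)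

theory Defs
  imports "HOL-Probability.Probability"
begin

text \<open>
  Smoothness and the spectral gap are defined over an arbitrary Euclidean space, because they
  are needed both on \<open>\<real>\<^sup>n\<close> (as \<open>real ^ 'n\<close>) and on \<open>real\<close> for the one-dimensional
  conditional distributions.
\<close>

primrec Ck :: "nat \<Rightarrow> ('a::euclidean_space \<Rightarrow> real) \<Rightarrow> bool" where
  "Ck 0 f \<longleftrightarrow> continuous_on UNIV f"
| "Ck (Suc k) f \<longleftrightarrow> (\<forall>x. f differentiable (at x)) \<and>
      (\<forall>b\<in>Basis. Ck k (\<lambda>x. frechet_derivative f (at x) b))"

definition smooth :: "('a::euclidean_space \<Rightarrow> real) \<Rightarrow> bool" where
  "smooth f \<longleftrightarrow> (\<forall>k. Ck k f)"

definition test_function :: "('a::euclidean_space \<Rightarrow> real) \<Rightarrow> bool" where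
  "test_function f \<longleftrightarrow> smooth f \<and> compact (closure (support_on UNIV f))"

text \<open>
  On \<open>real\<close>, where \<open>Basis = {1}\<close>, this is the square of the ordinary derivative.
\<close>

definition grad_sq :: "('a::euclidean_space \<Rightarrow> real) \<Rightarrow> 'a \<Rightarrow> real" where
  "grad_sq f x = (\<Sum>b\<in>Basis. (frechet_derivative f (at x) b)\<^sup>2)"

definition gibbs :: "('a::euclidean_space \<Rightarrow> real) \<Rightarrow> 'a measure" where
  "gibbs V = density lborel
     (\<lambda>x. ennreal (exp (- V x) / (\<integral>y. exp (- V y) \<partial>lborel)))"

definition poincare :: "('a::euclidean_space \<Rightarrow> real) \<Rightarrow> real \<Rightarrow> bool" where
  "poincare V \<kappa> \<longleftrightarrow> (\<forall>f. test_function f \<longrightarrow>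
     \<kappa> * prob_space.variance (gibbs V) f \<le> (\<integral>x. grad_sq f x \<partial>gibbs V))"

text \<open>
  The set of admissible constants is closed, so a finite supremum is the largest one. It is
  taken in \<^typ>\<open>ereal\<close> so that no boundedness side condition is hidden in the definition.
\<close>

definition spectral_gap :: "('a::euclidean_space \<Rightarrow> real) \<Rightarrow> ereal" where
  "spectral_gap V = (SUP \<kappa>\<in>{\<kappa>. poincare V \<kappa>}. ereal \<kappa>)"

text \<open>
  The coordinate indices are the elements of the finite type \<open>'n\<close>. Since \<open>\<real>\<^sup>n\<^sup>-\<^sup>1\<close> is not
  available as a type, a vector with the \<open>i\<close>-th component removed is a function in
  \<open>extensional (- {i})\<close>, i.e. a family of reals indexed by the \<open>j \<noteq> i\<close>.
\<close>

definition drop_coord :: "'n::finite \<Rightarrow> real ^ 'n \<Rightarrow> 'n \<Rightarrow> real" where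
  "drop_coord i x = restrict (\<lambda>j. x $ j) (- {i})"

definition insert_coord :: "'n::finite \<Rightarrow> real \<Rightarrow> ('n \<Rightarrow> real) \<Rightarrow> real ^ 'n" where
  "insert_coord i t y = (\<chi> j. if j = i then t else y j)"

definition cond_potential ::
    "(real ^ 'n::finite \<Rightarrow> real) \<Rightarrow> 'n \<Rightarrow> ('n \<Rightarrow> real) \<Rightarrow> real \<Rightarrow> real" where
  "cond_potential U i y = (\<lambda>t. U (insert_coord i t y))"

definition pderiv1 :: "'n::finite \<Rightarrow> (real ^ 'n \<Rightarrow> real) \<Rightarrow> real ^ 'n \<Rightarrow> real" where
  "pderiv1 i f x = frechet_derivative f (at x) (axis i 1)"

definition pderiv2 :: "'n::finite \<Rightarrow> 'n \<Rightarrow> (real ^ 'n \<Rightarrow> real) \<Rightarrow> real ^ 'n \<Rightarrow> real" where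
  "pderiv2 i j f = pderiv1 i (pderiv1 j f)"

context
  fixes U :: "real ^ 'n::finite \<Rightarrow> real"
    and \<eta> :: "'n \<Rightarrow> ('n \<Rightarrow> real) \<Rightarrow> real"
begin

definition s_i :: "'n \<Rightarrow> real ^ 'n \<Rightarrow> real" where
  "s_i i x = \<eta> i (drop_coord i x) - (\<Sum>j\<in>- {i}. \<bar>pderiv2 i j U x\<bar>)"

definition s_min :: "real ^ 'n \<Rightarrow> real" where
  "s_min x = Min (range (\<lambda>i. s_i i x))"

definition q_i :: "'n \<Rightarrow> real ^ 'n \<Rightarrow> real" where
  "q_i i x = \<eta> i (drop_coord i x) - s_min x"

definition d_i :: "'n \<Rightarrow> real ^ 'n \<Rightarrow> real" where
  "d_i i x = s_i i x - s_min x"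

text \<open>
  The convention \<open>0/0 = 0\<close> is that of HOL: if a denominator vanishes then \<open>q_i i x = 0\<close>
  (and \<open>q_i j x = 0\<close> in the second sum), so the corresponding numerator vanishes too.
\<close>

definition h_gam :: "real \<Rightarrow> real ^ 'n \<Rightarrow> real" where
  "h_gam \<gamma> x = Min ((\<lambda>A. 1 / real (card A) *
      ((\<Sum>i\<in>A. d_i i x / q_i i x powr \<gamma>) +
       (\<Sum>i\<in>A. \<Sum>j\<in>- A. \<bar>pderiv2 i j U x\<bar> / max (q_i i x) (q_i j x) powr \<gamma>))) ` {A. A \<noteq> {}})"

end

end

theory Submission
  imports Defs "HOL-Computational_Algebra.Polynomial"
begin

text \<open>
Write \<open>\<theta> = exp (- U / 2)\<close> and substitute \<open>\<phi> = f \<theta>\<close>. The Gibbs measure disappears: with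
\<open>D\<^sub>b \<phi> = \<partial>\<^sub>b \<phi> + (\<partial>\<^sub>b U / 2) \<phi>\<close> and its adjoint \<open>D\<^sub>b\<^sup>*\<close> in plain Lebesgue \<open>L\<^sup>2\<close>, the Poincare
inequality with constant \<open>\<kappa>\<close> says that \<open>H = \<Sum>\<^sub>b D\<^sub>b\<^sup>* D\<^sub>b\<close>, a Schroedinger operator with ground
state \<open>\<theta>\<close>, is at least \<open>\<kappa>\<close> on the orthogonal complement of \<open>\<theta>\<close>. Three facts give the theorem.

(1) \<^emph>\<open>Second order suffices.\<close> If \<open>\<kappa> > 0\<close> and \<open>\<parallel>H u\<parallel>\<^sup>2 \<ge> \<kappa> \<Sum>\<^sub>b \<parallel>D\<^sub>b u\<parallel>\<^sup>2\<close> for all test functions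
\<open>u\<close>, then the Poincare inequality holds with \<open>\<kappa>\<close> (\<open>poincare_from_second_order\<close>). On the range
of \<open>H\<close> this is the Cauchy-Schwarz inequality, so it remains to see that the range of \<open>H\<close> on test
functions is dense in the complement of \<open>\<theta>\<close>. Let \<open>\<psi>\<close> be almost orthogonal to this range. Testing
with \<open>\<rho> * (\<chi>\<^sup>2 (\<rho> * \<psi>))\<close>, where \<open>\<rho>\<close> is a mollifier and \<open>\<chi>\<close> a slowly varying cutoff, makes the gradient
of \<open>(\<rho> * \<psi>) / \<theta>\<close> small on a ball, and a Poincare inequality on that ball makes \<open>\<psi>\<close>
almost orthogonal to every test function that is orthogonal to \<open>\<theta>\<close>
(\<open>almost_orthogonal_to_range\<close>). All estimates are quantitative, uniform over test functions \<open>\<psi>\<close>.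

(2) \<^emph>\<open>Bochner and conditioning.\<close> For \<open>b \<noteq> c\<close> the commutator of \<open>D\<^sub>b\<close> and \<open>D\<^sub>c\<^sup>*\<close> is multiplication by
\<open>\<partial>\<^sub>b\<^sub>c U\<close>, hence \<open>\<langle>D\<^sub>b\<^sup>* D\<^sub>b f, D\<^sub>c\<^sup>* D\<^sub>c f\<rangle> \<ge> \<integral> \<partial>\<^sub>b\<^sub>c U D\<^sub>b f D\<^sub>c f\<close>. For \<open>b = c\<close> the one-dimensional
Poincare inequality on each line parallel to \<open>b\<close> gives \<open>\<parallel>D\<^sub>b\<^sup>* D\<^sub>b f\<parallel>\<^sup>2 \<ge> \<integral> \<eta>\<^sub>b (D\<^sub>b f)\<^sup>2\<close>. So
\<open>\<parallel>H f\<parallel>\<^sup>2\<close> is at least the integral of a quadratic form in the vector \<open>(D\<^sub>b f)\<^sub>b\<close> whose matrix has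
diagonal \<open>\<eta>\<close> and off-diagonal entries \<open>\<partial>\<^sub>b\<^sub>c U\<close> (\<open>second_order_from_lines\<close>).

(3) \<^emph>\<open>Cheeger.\<close> At a fixed point, replacing the off-diagonal entries by \<open>- \<bar>\<partial>\<^sub>b\<^sub>c U\<bar>\<close> and subtracting
the minimal row sum \<open>s_min\<close> leaves the Dirichlet form of a finite weighted graph with killing rates
\<open>d_i\<close> and total rates \<open>q_i\<close>. Its bottom eigenvalue is bounded below by the Cheeger-type expression
in the isoperimetric constants \<open>h_gam\<close> (\<open>matrix_lower_bound\<close>).
\<close>

section \<open>Smooth functions and test functions\<close>

definition pd :: "'a::euclidean_space \<Rightarrow> ('a \<Rightarrow> real) \<Rightarrow> 'a \<Rightarrow> real" where
  "pd b f x = frechet_derivative f (at x) b"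

text \<open>
Vanishing outside a ball. On a Euclidean space this is compactness of the support, in a form whose
stability under pointwise operations is immediate.
\<close>

definition csupp :: "('a::real_normed_vector \<Rightarrow> real) \<Rightarrow> bool" where
  "csupp f \<longleftrightarrow> (\<exists>r. \<forall>x. r < norm x \<longrightarrow> f x = 0)"

lemma Ck_Suc: "Ck (Suc k) f \<longleftrightarrow> (\<forall>x. f differentiable (at x)) \<and> (\<forall>b\<in>Basis. Ck k (pd b f))"
  by (simp add: pd_def[abs_def])

declare Ck.simps(2)[simp del]

lemma Ck_SucD: "Ck (Suc k) f \<Longrightarrow> Ck k f"
proof (induction k arbitrary: f)
  case 0
  then show ?case
    by (auto simp: Ck_Suc intro!: continuous_at_imp_continuous_on differentiable_imp_continuous_within)
next
  case (Suc k)
  then show ?case unfolding Ck_Suc[of "Suc k"] Ck_Suc[of k f] by blast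
qed

lemma smooth_differentiable: "smooth f \<Longrightarrow> f differentiable (at x)"
  unfolding smooth_def by (metis Ck_Suc)

lemma smooth_pd: "smooth f \<Longrightarrow> b \<in> Basis \<Longrightarrow> smooth (pd b f)"
  unfolding smooth_def by (metis Ck_Suc)

lemma smooth_continuous: "smooth f \<Longrightarrow> continuous_on S f"
  by (simp add: continuous_at_imp_continuous_on differentiable_imp_continuous_within
      smooth_differentiable)

lemma smooth_isCont: "smooth f \<Longrightarrow> isCont f x"
  by (simp add: differentiable_imp_continuous_within smooth_differentiable)

lemma smooth_has_derivative:
  "smooth f \<Longrightarrow> (f has_derivative (\<lambda>h. \<Sum>b\<in>Basis. (h \<bullet> b) * pd b f x)) (at x)"
proof -
  assume f: "smooth f"
  then have d: "(f has_derivative frechet_derivative f (at x)) (at x)"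
    using smooth_differentiable frechet_derivative_works by blast
  have lin: "linear (frechet_derivative f (at x))"
    by (simp add: linear_frechet_derivative f smooth_differentiable)
  have "frechet_derivative f (at x) h = (\<Sum>b\<in>Basis. (h \<bullet> b) * pd b f x)" for h
  proof -
    have "frechet_derivative f (at x) h = frechet_derivative f (at x) (\<Sum>b\<in>Basis. (h \<bullet> b) *\<^sub>R b)"
      by (simp add: euclidean_representation)
    also have "\<dots> = (\<Sum>b\<in>Basis. (h \<bullet> b) * pd b f x)"
      unfolding linear_sum[OF lin] by (simp add: linear_scale[OF lin] pd_def)
    finally show ?thesis .
  qed
  with d show ?thesis by (metis (no_types, lifting) ext)
qed

lemma pd_eqI: "(f has_derivative f') (at x) \<Longrightarrow> pd b f x = f' b"
  unfolding pd_def by (metis frechet_derivative_at)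

lemma pd_add: "f differentiable at x \<Longrightarrow> g differentiable at x \<Longrightarrow>
  pd b (\<lambda>x. f x + g x) x = pd b f x + pd b g x"
  by (rule pd_eqI[THEN trans, OF has_derivative_add])
     (auto simp: pd_def frechet_derivative_works[symmetric])

lemma pd_mult: "f differentiable at x \<Longrightarrow> g differentiable at x \<Longrightarrow>
  pd b (\<lambda>x. f x * g x) x = f x * pd b g x + pd b f x * g x"
  by (rule pd_eqI[THEN trans, OF has_derivative_mult])
     (auto simp: pd_def frechet_derivative_works[symmetric])

lemma pd_const [simp]: "pd b (\<lambda>x. c) x = 0"
  by (simp add: pd_def)

lemma pd_compose:
  fixes p :: "real \<Rightarrow> real"
  assumes "p differentiable at (g x)" "g differentiable at x"
  shows "pd b (\<lambda>x. p (g x)) x = pd 1 p (g x) * pd b g x"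
proof -
  have "((\<lambda>x. p (g x)) has_derivative (\<lambda>h. frechet_derivative p (at (g x)) (frechet_derivative g (at x) h))) (at x)"
    using assms unfolding frechet_derivative_works by (rule has_derivative_compose[rotated])
  moreover have "frechet_derivative p (at (g x)) r = r * pd 1 p (g x)" for r
    using linear_scale[OF linear_frechet_derivative[OF assms(1)], of r 1]
    by (simp only: pd_def real_scaleR_def mult_1_right)
  ultimately show ?thesis unfolding pd_def[of b g]
    by (simp only: pd_eqI[of _ _ x b] mult.commute)
qed

lemma Ck_const: "Ck k (\<lambda>x. c)"
proof (induction k arbitrary: c)
  case (Suc k)
  have "pd b (\<lambda>x. c) = (\<lambda>x. 0)" for b :: 'a by auto
  then show ?case using Suc by (simp add: Ck_Suc)
qed auto

lemma Ck_add: "Ck k f \<Longrightarrow> Ck k g \<Longrightarrow> Ck k (\<lambda>x. f x + g x)"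
proof (induction k arbitrary: f g)
  case (Suc k)
  have "pd b (\<lambda>x. f x + g x) = (\<lambda>x. pd b f x + pd b g x)" for b
    using Suc.prems by (auto simp: Ck_Suc pd_add)
  then show ?case using Suc by (auto simp: Ck_Suc)
qed (auto intro: continuous_intros)

lemma Ck_mult: "Ck k f \<Longrightarrow> Ck k g \<Longrightarrow> Ck k (\<lambda>x. f x * g x)"
proof (induction k arbitrary: f g)
  case (Suc k)
  have *: "pd b (\<lambda>x. f x * g x) = (\<lambda>x. f x * pd b g x + pd b f x * g x)" for b
    using Suc.prems by (auto simp: Ck_Suc pd_mult)
  show ?case unfolding Ck_Suc *
    using Suc.prems Suc.IH Ck_SucD[OF Suc.prems(1)] Ck_SucD[OF Suc.prems(2)]
    by (auto simp: Ck_Suc intro!: Ck_add)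
qed (auto intro: continuous_intros)

lemma Ck_compose:
  fixes p :: "real \<Rightarrow> real"
  shows "Ck k p \<Longrightarrow> Ck k g \<Longrightarrow> Ck k (\<lambda>x. p (g x))"
proof (induction k arbitrary: p)
  case 0
  then show ?case by (auto intro: continuous_on_compose2)
next
  case (Suc k)
  have d: "\<And>y. p differentiable at y" "\<And>x. g differentiable at x"
    using Suc.prems by (auto simp: Ck_Suc)
  have *: "pd b (\<lambda>x. p (g x)) = (\<lambda>x. pd 1 p (g x) * pd b g x)" for b
    using pd_compose[OF d] by auto
  have dd: "(\<lambda>x. p (g x)) differentiable at x" for x
    using differentiable_chain_at[of g x p] d by (simp add: o_def)
  have "Ck k (pd 1 p)" using Suc.prems by (auto simp: Ck_Suc)
  then have "Ck k (\<lambda>x. pd 1 p (g x))" using Suc Ck_SucD by blast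
  then show ?case unfolding Ck_Suc * using dd Suc.prems by (auto simp: Ck_Suc intro!: Ck_mult)
qed

lemma smooth_const [intro, simp]: "smooth (\<lambda>x. c)"
  by (simp add: smooth_def Ck_const)
lemma smooth_add [intro]: "smooth f \<Longrightarrow> smooth g \<Longrightarrow> smooth (\<lambda>x. f x + g x)"
  by (simp add: smooth_def Ck_add)
lemma smooth_mult [intro]: "smooth f \<Longrightarrow> smooth g \<Longrightarrow> smooth (\<lambda>x. f x * g x)"
  by (simp add: smooth_def Ck_mult)
lemma smooth_compose:
  fixes p :: "real \<Rightarrow> real"
  shows "smooth p \<Longrightarrow> smooth g \<Longrightarrow> smooth (\<lambda>x. p (g x))"
  by (simp add: smooth_def Ck_compose)
lemma smooth_cmult [intro]: "smooth f \<Longrightarrow> smooth (\<lambda>x. c * f x)"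
  by (intro smooth_mult) auto
lemma smooth_minus [intro]: "smooth f \<Longrightarrow> smooth (\<lambda>x. - f x)"
  using smooth_cmult[of f "-1"] by simp
lemma smooth_diff [intro]: "smooth f \<Longrightarrow> smooth g \<Longrightarrow> smooth (\<lambda>x. f x - g x)"
  using smooth_add[of f "\<lambda>x. - g x"] by auto
lemma smooth_divide [intro]: "smooth f \<Longrightarrow> smooth (\<lambda>x. f x / c)"
  using smooth_cmult[of f "1/c"] by (simp add: field_simps)
lemma smooth_sum [intro]: "(\<And>i. i \<in> I \<Longrightarrow> smooth (f i)) \<Longrightarrow> smooth (\<lambda>x. \<Sum>i\<in>I. f i x)"
  by (induction I rule: infinite_finite_induct) auto
lemma smooth_power2 [intro]: "smooth f \<Longrightarrow> smooth (\<lambda>x. (f x)\<^sup>2)"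
  unfolding power2_eq_square by auto

text \<open>The smoothness of a concrete function is shown by exhibiting a family that contains it and is
  closed under differentiation.\<close>

lemma smooth_coinduct:
  assumes "P f" and "\<And>f x. P f \<Longrightarrow> f differentiable (at x)"
    and "\<And>f b. P f \<Longrightarrow> b \<in> Basis \<Longrightarrow> P (pd b f)"
  shows "smooth f"
proof -
  have "P f \<Longrightarrow> Ck k f" for k f
  proof (induction k arbitrary: f)
    case 0
    then show ?case
      using assms(2) by (auto intro!: continuous_at_imp_continuous_on differentiable_imp_continuous_within)
  qed (use assms in \<open>auto simp: Ck_Suc\<close>)
  then show ?thesis using assms(1) by (auto simp: smooth_def)
qed

lemma smooth_exp: "smooth (exp :: real \<Rightarrow> real)"
proof (rule smooth_coinduct[of "\<lambda>f. f = exp"])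
  have *: "(exp has_derivative (\<lambda>h. h * exp x)) (at x)" for x :: real
    using DERIV_exp[of x] by (simp add: has_field_derivative_def mult.commute[of _ "exp x"])
  fix f :: "real \<Rightarrow> real" and b x :: real assume "f = exp"
  then show "f differentiable at x" using * unfolding differentiable_def by blast
  assume "b \<in> Basis" then have "b = 1" by simp
  then have "pd b f = exp" using pd_eqI[OF *] \<open>f = exp\<close> by auto
  then show "pd b f = exp" .
qed simp

lemma smooth_inner: "smooth (\<lambda>x. x \<bullet> b)"
proof -
  have d: "((\<lambda>x. x \<bullet> b) has_derivative (\<lambda>h. h \<bullet> b)) (at x)" for x
    by (auto intro!: derivative_eq_intros)
  have "pd c (\<lambda>x. x \<bullet> b) = (\<lambda>x. c \<bullet> b)" for c by (rule ext) (rule pd_eqI[OF d])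
  then have "Ck k (\<lambda>x. x \<bullet> b)" for k
    using d by (cases k) (auto simp: Ck_Suc Ck_const differentiable_def intro!: continuous_intros)
  then show ?thesis by (simp add: smooth_def)
qed

lemma smooth_norm_square: "smooth (\<lambda>x. (norm x)\<^sup>2)"
proof -
  have "(\<lambda>x::'a. (norm x)\<^sup>2) = (\<lambda>x. \<Sum>b\<in>Basis. (x \<bullet> b)\<^sup>2)"
    by (rule ext, unfold power2_norm_eq_inner, subst euclidean_inner) (simp add: power2_eq_square)
  then show ?thesis by (auto intro!: smooth_inner)
qed

lemma pd_smooth_add: "smooth f \<Longrightarrow> smooth g \<Longrightarrow> pd b (\<lambda>x. f x + g x) = (\<lambda>x. pd b f x + pd b g x)"
  by (auto simp: pd_add smooth_differentiable)
lemma pd_smooth_mult: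
  "smooth f \<Longrightarrow> smooth g \<Longrightarrow> pd b (\<lambda>x. f x * g x) = (\<lambda>x. f x * pd b g x + pd b f x * g x)"
  by (auto simp: pd_mult smooth_differentiable)
lemma pd_smooth_cmult: "smooth f \<Longrightarrow> pd b (\<lambda>x. c * f x) = (\<lambda>x. c * pd b f x)"
  by (auto simp: pd_smooth_mult)
lemma pd_smooth_minus: "smooth f \<Longrightarrow> pd b (\<lambda>x. - f x) = (\<lambda>x. - pd b f x)"
  using pd_smooth_cmult[of f b "-1"] by simp
lemma pd_smooth_divide: "smooth f \<Longrightarrow> pd b (\<lambda>x. f x / c) = (\<lambda>x. pd b f x / c)"
  using pd_smooth_cmult[of f b "1/c"] by (simp add: field_simps)

lemma pd_smooth_exp: "smooth f \<Longrightarrow> pd b (\<lambda>x. exp (f x)) = (\<lambda>x. exp (f x) * pd b f x)"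
proof
  fix x assume f: "smooth f"
  have "(exp has_derivative (\<lambda>h. h * exp y)) (at y)" for y :: real
    using DERIV_exp[of y] by (simp add: has_field_derivative_def mult.commute[of _ "exp y"])
  from pd_eqI[OF this, of 1 "f x"] have "pd 1 exp (f x) = exp (f x)" by simp
  then show "pd b (\<lambda>x. exp (f x)) x = exp (f x) * pd b f x"
    using pd_compose[of exp f x b] f smooth_exp smooth_differentiable by metis
qed

lemma smooth_exp_compose [intro]: "smooth f \<Longrightarrow> smooth (\<lambda>x. exp (f x))"
  by (rule smooth_compose[OF smooth_exp])

lemma smooth_line_derivative:
  assumes "smooth f"
  shows "((\<lambda>t. f (a + t *\<^sub>R h)) has_real_derivative (\<Sum>b\<in>Basis. (h \<bullet> b) * pd b f (a + t *\<^sub>R h))) (at t)"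
proof -
  have "((\<lambda>t. a + t *\<^sub>R h) has_derivative (\<lambda>r. r *\<^sub>R h)) (at t)"
    by (auto intro!: derivative_eq_intros)
  from has_derivative_compose[OF this smooth_has_derivative[OF assms]]
  have "((\<lambda>t. f (a + t *\<^sub>R h)) has_derivative
      (\<lambda>r. \<Sum>b\<in>Basis. (r *\<^sub>R h \<bullet> b) * pd b f (a + t *\<^sub>R h))) (at t)" by simp
  then show ?thesis unfolding has_field_derivative_def
    by (rule has_derivative_eq_rhs) (auto simp: sum_distrib_left sum_distrib_right mult_ac)
qed

lemma smooth_line_basis_derivative:
  assumes "smooth f" "b \<in> Basis"
  shows "((\<lambda>t. f (a + t *\<^sub>R b)) has_real_derivative pd b f (a + t *\<^sub>R b)) (at t)"
  using smooth_line_derivative[OF assms(1), of a b t] assms(2)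
  by (simp add: inner_Basis if_distrib[of "\<lambda>x. x * _"] cong: if_cong)

lemma pd_line:
  assumes "smooth f" "b \<in> Basis"
  shows "pd 1 (\<lambda>t. f (a + t *\<^sub>R b)) = (\<lambda>t. pd b f (a + t *\<^sub>R b))"
proof
  fix t show "pd 1 (\<lambda>t. f (a + t *\<^sub>R b)) t = pd b f (a + t *\<^sub>R b)"
    using pd_eqI[of _ _ t "1::real", OF smooth_line_basis_derivative[OF assms, of a t, unfolded has_field_derivative_def]]
    by simp
qed

lemma smooth_line:
  assumes "smooth f" "b \<in> Basis"
  shows "smooth (\<lambda>t. f (a + t *\<^sub>R b))"
proof (rule smooth_coinduct[of "\<lambda>g. \<exists>f. smooth f \<and> g = (\<lambda>t. f (a + t *\<^sub>R b))"])
  fix g :: "real \<Rightarrow> real" and x :: real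
  assume "\<exists>f. smooth f \<and> g = (\<lambda>t. f (a + t *\<^sub>R b))"
  then obtain f where f: "smooth f" "g = (\<lambda>t. f (a + t *\<^sub>R b))" by auto
  show "g differentiable at x" unfolding f(2)
    using smooth_line_basis_derivative[OF f(1) assms(2), of a x]
    by (auto simp: differentiable_def has_field_derivative_def)
next
  fix g :: "real \<Rightarrow> real" and c :: real
  assume "\<exists>f. smooth f \<and> g = (\<lambda>t. f (a + t *\<^sub>R b))" "c \<in> Basis"
  then show "\<exists>f. smooth f \<and> pd c g = (\<lambda>t. f (a + t *\<^sub>R b))"
    using pd_line[OF _ assms(2)] smooth_pd[OF _ assms(2)] by auto
qed (use assms in auto)

lemma pd_zero_open:
  assumes "open S" "\<And>y. y \<in> S \<Longrightarrow> f y = 0" "x \<in> S"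
  shows "pd b f x = 0"
proof -
  have "((\<lambda>x. 0) has_derivative (\<lambda>h. 0)) (at x)" by simp
  from has_derivative_transform_within_open[OF this assms(1,3), of f] assms(2)
  have "(f has_derivative (\<lambda>h. 0)) (at x)" by simp
  then show ?thesis by (rule pd_eqI)
qed

lemma pd_outside_cball: "(\<And>x. r < norm x \<Longrightarrow> f x = 0) \<Longrightarrow> r < norm x \<Longrightarrow> pd b f x = 0"
  by (rule pd_zero_open[of "{x. r < norm x}"]) (auto intro!: open_Collect_less continuous_intros)

lemma csupp_pd: "csupp f \<Longrightarrow> csupp (pd b f)"
  unfolding csupp_def using pd_outside_cball by metis

lemma csupp_mult1 [intro]: "csupp f \<Longrightarrow> csupp (\<lambda>x. f x * g x)"
  and csupp_mult2 [intro]: "csupp g \<Longrightarrow> csupp (\<lambda>x. f x * g x)"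
  and csupp_minus [intro]: "csupp f \<Longrightarrow> csupp (\<lambda>x. - f x)"
  and csupp_power2 [intro]: "csupp f \<Longrightarrow> csupp (\<lambda>x. (f x)\<^sup>2)"
  and csupp_abs [intro]: "csupp f \<Longrightarrow> csupp (\<lambda>x. \<bar>f x\<bar>)"
  and csupp_zero [intro]: "csupp (\<lambda>x. 0)"
  unfolding csupp_def by (metis mult_zero_left mult_zero_right neg_0_equal_iff_equal zero_power2 abs_zero)+

lemma csupp_add [intro]:
  assumes "csupp f" "csupp g" shows "csupp (\<lambda>x. f x + g x)"
proof -
  obtain r s where "\<And>x. r < norm x \<Longrightarrow> f x = 0" "\<And>x. s < norm x \<Longrightarrow> g x = 0"
    using assms by (auto simp: csupp_def)
  then show ?thesis unfolding csupp_def by (intro exI[of _ "max r s"]) auto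
qed

lemma csupp_diff [intro]: "csupp f \<Longrightarrow> csupp g \<Longrightarrow> csupp (\<lambda>x. f x - g x)"
  using csupp_add[of f "\<lambda>x. - g x"] by auto

lemma csupp_sum [intro]: "(\<And>i. i \<in> I \<Longrightarrow> csupp (f i)) \<Longrightarrow> csupp (\<lambda>x. \<Sum>i\<in>I. f i x)"
  by (induction I rule: infinite_finite_induct) auto

lemma test_function_iff: "test_function f \<longleftrightarrow> smooth f \<and> csupp f"
proof -
  have "compact (closure {x. f x \<noteq> 0}) \<longleftrightarrow> csupp f"
    unfolding compact_closure bounded_iff csupp_def by (metis (mono_tags, lifting) mem_Collect_eq not_le)
  then show ?thesis by (simp add: test_function_def support_on_def)
qed

lemma tf_smooth: "test_function f \<Longrightarrow> smooth f" and tf_csupp: "test_function f \<Longrightarrow> csupp f"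
  by (auto simp: test_function_iff)
lemma tf_cont: "test_function f \<Longrightarrow> continuous_on S f"
  by (simp add: tf_smooth smooth_continuous)
lemma tf_add: "test_function f \<Longrightarrow> test_function g \<Longrightarrow> test_function (\<lambda>x. f x + g x)"
  and tf_diff: "test_function f \<Longrightarrow> test_function g \<Longrightarrow> test_function (\<lambda>x. f x - g x)"
  and tf_mult1: "test_function f \<Longrightarrow> smooth g \<Longrightarrow> test_function (\<lambda>x. f x * g x)"
  and tf_mult2: "smooth f \<Longrightarrow> test_function g \<Longrightarrow> test_function (\<lambda>x. f x * g x)"
  and tf_minus: "test_function f \<Longrightarrow> test_function (\<lambda>x. - f x)"
  and tf_cmult: "test_function f \<Longrightarrow> test_function (\<lambda>x. c * f x)"
  and tf_zero: "test_function (\<lambda>x. 0)"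
  by (auto simp: test_function_iff)
lemma tf_pd: "test_function f \<Longrightarrow> b \<in> Basis \<Longrightarrow> test_function (pd b f)"
  by (simp add: test_function_iff smooth_pd csupp_pd)
lemma tf_sum: "(\<And>i. i \<in> I \<Longrightarrow> test_function (f i)) \<Longrightarrow> test_function (\<lambda>x. \<Sum>i\<in>I. f i x)"
  by (simp add: test_function_iff smooth_sum csupp_sum)

section \<open>Integration over Euclidean space\<close>

lemma cc_integrable:
  fixes f :: "'a::euclidean_space \<Rightarrow> real"
  assumes "continuous_on UNIV f" "csupp f"
  shows "integrable lborel f"
proof -
  obtain r where r: "\<And>x. r < norm x \<Longrightarrow> f x = 0" using assms by (auto simp: csupp_def)
  have "integrable lborel (\<lambda>x. indicator (cball 0 r) x *\<^sub>R f x)"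
    using assms by (intro borel_integrable_compact) (auto intro: continuous_on_subset)
  also have "(\<lambda>x. indicator (cball 0 r) x *\<^sub>R f x) = f"
    using r by (auto simp: indicator_def fun_eq_iff not_le)
  finally show ?thesis .
qed

lemma tf_integrable: "test_function f \<Longrightarrow> integrable lborel f"
  by (auto intro!: cc_integrable tf_cont tf_csupp)

lemma continuous_borel: "continuous_on UNIV f \<Longrightarrow> f \<in> borel_measurable borel"
  by (rule borel_measurable_continuous_onI)

lemma integral_translate:
  fixes f :: "'a::euclidean_space \<Rightarrow> real"
  assumes "f \<in> borel_measurable borel"
  shows "(LBINT y. f (x + y)) = (LBINT y. f y)"
    and "(LBINT y. f (y + x)) = (LBINT y. f y)"
proof -
  have "(LBINT y. f y) = (\<integral>y. f y \<partial>distr lborel borel ((+) x))"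
    by (simp add: lborel_distr_plus)
  also have "\<dots> = (LBINT y. f (x + y))"
    by (rule integral_distr) (auto intro!: assms)
  finally show "(LBINT y. f (x + y)) = (LBINT y. f y)" ..
  then show "(LBINT y. f (y + x)) = (LBINT y. f y)"
    by (simp add: add.commute)
qed

lemma nn_integral_translate:
  fixes f :: "'a::euclidean_space \<Rightarrow> ennreal"
  assumes "f \<in> borel_measurable borel"
  shows "(\<integral>\<^sup>+y. f (x + y) \<partial>lborel) = (\<integral>\<^sup>+y. f y \<partial>lborel)"
proof -
  have "(\<integral>\<^sup>+y. f y \<partial>lborel) = (\<integral>\<^sup>+y. f y \<partial>distr lborel borel ((+) x))"
    by (simp add: lborel_distr_plus)
  also have "\<dots> = (\<integral>\<^sup>+y. f (x + y) \<partial>lborel)"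
    by (rule nn_integral_distr) (auto intro!: assms)
  finally show ?thesis ..
qed

lemma integral_reflect:
  fixes f :: "'a::euclidean_space \<Rightarrow> real"
  assumes "f \<in> borel_measurable borel"
  shows "(LBINT y. f (- y)) = (LBINT y. f y)"
proof -
  have "(lborel :: 'a measure) = distr lborel borel uminus"
    using lborel_affine[of "-1" "0::'a"] by (simp add: density_1)
  then have "(LBINT y. f y) = (\<integral>y. f y \<partial>distr lborel borel uminus)" by simp
  also have "\<dots> = (LBINT y. f (- y))"
    by (rule integral_distr) (auto intro!: assms)
  finally show ?thesis ..
qed

text \<open>
Cross-correlation. For an even kernel it is convolution; the correlation form keeps translations on
one side only: derivatives of the correlation are correlations of the derivatives of \<open>F\<close>. The
constant kernel \<open>1\<close> gives integration by parts.
\<close>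

definition correlate :: "('a::euclidean_space \<Rightarrow> real) \<Rightarrow> ('a \<Rightarrow> real) \<Rightarrow> 'a \<Rightarrow> real" where
  "correlate a F x = (LBINT y. a y * F (x + y))"

lemma csupp_translate: "csupp F \<Longrightarrow> csupp (\<lambda>y. F (x + y))"
proof -
  assume "csupp F"
  then obtain r where r: "\<And>x. r < norm x \<Longrightarrow> F x = 0" by (auto simp: csupp_def)
  have "norm y \<le> norm (x + y) + norm x" for y using norm_triangle_ineq4[of "x + y" x] by simp
  then have "r + norm x < norm y \<Longrightarrow> F (x + y) = 0" for y using r[of "x + y"] by (smt (verit))
  then show ?thesis unfolding csupp_def by blast
qed

lemma cont_shift:
  fixes F :: "'a::real_normed_vector \<Rightarrow> real"
  assumes "continuous_on UNIV F"
  shows "continuous_on UNIV (\<lambda>y. F (x + y))"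
  by (rule continuous_on_compose2[OF assms]) (auto intro: continuous_intros)

lemma correlate_integrable:
  "continuous_on UNIV a \<Longrightarrow> continuous_on UNIV F \<Longrightarrow> csupp F \<Longrightarrow> integrable lborel (\<lambda>y. a y * F (x + y))"
  by (intro cc_integrable csupp_mult2 csupp_translate continuous_on_mult cont_shift)

lemma shift_has_derivative:
  assumes "smooth F"
  shows "((\<lambda>y. F (x + y)) has_derivative (\<lambda>h. \<Sum>b\<in>Basis. (h \<bullet> b) * pd b F (x + y))) (at y)"
proof -
  have "((\<lambda>y. x + y) has_derivative (\<lambda>h. h)) (at y)"
    by (auto intro!: derivative_eq_intros)
  from has_derivative_compose[OF this smooth_has_derivative[OF assms]] show ?thesis .
qed

lemma pd_shift: "smooth F \<Longrightarrow> b \<in> Basis \<Longrightarrow> pd b (\<lambda>y. F (x + y)) = (\<lambda>y. pd b F (x + y))"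
  by (rule ext) (subst pd_eqI[OF shift_has_derivative],
    auto simp: inner_Basis if_distrib[of "\<lambda>x. x * _"] cong: if_cong)

lemma smooth_shift:
  assumes "smooth F" shows "smooth (\<lambda>y. F (x + y))"
proof (rule smooth_coinduct[of "\<lambda>f. \<exists>F. smooth F \<and> f = (\<lambda>y. F (x + y))"])
  show "\<And>f y. \<exists>F. smooth F \<and> f = (\<lambda>y. F (x + y)) \<Longrightarrow> f differentiable at y"
    using shift_has_derivative unfolding differentiable_def by blast
  show "\<And>f b. \<exists>F. smooth F \<and> f = (\<lambda>y. F (x + y)) \<Longrightarrow> b \<in> Basis \<Longrightarrow>
      \<exists>F. smooth F \<and> pd b f = (\<lambda>y. F (x + y))"
    using pd_shift smooth_pd by metis
qed (use assms in auto)

text \<open>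
Near \<open>x0\<close> the integrand vanishes outside one fixed box, because \<open>F\<close> has bounded support. So the
Lebesgue integral is a Henstock-Kurzweil integral over that box and may be differentiated under the
integral sign.
\<close>

lemma correlate_has_derivative:
  fixes F :: "'a::euclidean_space \<Rightarrow> real"
  assumes a: "continuous_on UNIV a" and F: "test_function F"
  shows "(correlate a F has_derivative (\<lambda>h. \<Sum>b\<in>Basis. (h \<bullet> b) * correlate a (pd b F) x0)) (at x0)"
proof -
  obtain r where r: "\<And>x. r < norm x \<Longrightarrow> F x = 0" using F by (auto simp: csupp_def test_function_iff)
  then have rp: "\<And>x b. r < norm x \<Longrightarrow> pd b F x = 0" using pd_outside_cball by blast
  obtain c :: 'a where c: "cball 0 (r + norm x0 + 1) \<subseteq> cbox (-c) c"
    using bounded_subset_cbox_symmetric bounded_cball by blast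
  let ?S = "cbox (-c) c"
  have out: "r < norm (x + y)" if "x \<in> ball x0 1" "y \<notin> ?S" for x y
  proof -
    have "r + norm x0 + 1 < norm y" using that c by (auto simp: subset_iff not_le)
    moreover have "norm y \<le> norm (x + y) + norm x" using norm_triangle_ineq4[of "x + y" x] by simp
    moreover have "norm x \<le> norm x0 + 1"
      using that(1) norm_triangle_ineq2[of x x0] by (simp add: dist_norm norm_minus_commute)
    ultimately show ?thesis by linarith
  qed
  have eq: "correlate a G x = integral ?S (\<lambda>y. a y * G (x + y))"
    if "x \<in> ball x0 1" "continuous_on UNIV G" "\<And>x. r < norm x \<Longrightarrow> G x = 0" for G x
  proof -
    have "integrable lborel (\<lambda>y. a y * G (x + y))"
      using that a by (intro correlate_integrable) (auto simp: csupp_def)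
    then have "correlate a G x = integral UNIV (\<lambda>y. a y * G (x + y))"
      by (simp add: correlate_def integral_lborel)
    also have "\<dots> = integral UNIV (\<lambda>y. if y \<in> ?S then a y * G (x + y) else 0)"
      using that out by (auto intro!: integral_cong)
    finally show ?thesis by (simp add: integral_restrict_UNIV)
  qed
  define fx where "fx x t = (\<Sum>b\<in>Basis. (a t * pd b F (x + t)) *\<^sub>R blinfun_inner_left b)" for x t
  have cF: "continuous_on X F" "b \<in> Basis \<Longrightarrow> continuous_on X (pd b F)" for X b
    using F by (auto simp: tf_cont tf_pd)
  have fxc: "continuous_on (ball x0 1 \<times> ?S) (\<lambda>(x, t). fx x t)"
    unfolding fx_def split_beta
    by (intro continuous_intros continuous_on_compose2[OF a] continuous_on_compose2[OF cF(2)]) auto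
  have "((\<lambda>x. integral ?S (\<lambda>y. a y * F (x + y))) has_derivative
      blinfun_apply (integral ?S (fx x0))) (at x0 within ball x0 1)"
  proof (rule leibniz_rule[OF _ _ fxc])
    fix x t
    have "((\<lambda>x. F (x + t)) has_derivative (\<lambda>h. \<Sum>b\<in>Basis. (h \<bullet> b) * pd b F (x + t))) (at x within ball x0 1)"
      using shift_has_derivative[OF tf_smooth[OF F], of t x]
      by (auto simp: add.commute intro: has_derivative_at_withinI)
    then have "((\<lambda>x. a t * F (x + t)) has_derivative (\<lambda>h. a t * (\<Sum>b\<in>Basis. (h \<bullet> b) * pd b F (x + t)))) (at x within ball x0 1)"
      by (rule has_derivative_mult_right)
    then show "((\<lambda>x. a t * F (x + t)) has_derivative fx x t) (at x within ball x0 1)"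
      by (rule has_derivative_eq_rhs)
        (auto simp: fx_def blinfun.sum_left blinfun.scaleR_left sum_distrib_left mult_ac fun_eq_iff)
  next
    show "(\<lambda>y. a y * F (x + y)) integrable_on ?S" for x
      by (intro integrable_continuous continuous_intros continuous_on_compose2[OF cF(1)]
          continuous_on_subset[OF a]) auto
  qed auto
  then have 1: "((\<lambda>x. integral ?S (\<lambda>y. a y * F (x + y))) has_derivative
      blinfun_apply (integral ?S (fx x0))) (at x0)"
    by (simp add: at_within_open[of x0 "ball x0 1"])
  have 2: "blinfun_apply (integral ?S (fx x0)) h = (\<Sum>b\<in>Basis. (h \<bullet> b) * correlate a (pd b F) x0)" for h
  proof -
    have "fx x0 integrable_on ?S"
      by (rule integrable_continuous, unfold fx_def)
        (intro continuous_intros continuous_on_subset[OF a] continuous_on_compose2[OF cF(2)], auto)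
    from integral_linear[OF this blinfun.bounded_linear_left[of h]]
    have "blinfun_apply (integral ?S (fx x0)) h = integral ?S (\<lambda>t. fx x0 t h)" by (simp add: o_def)
    also have "\<dots> = integral ?S (\<lambda>t. \<Sum>b\<in>Basis. (h \<bullet> b) * (a t * pd b F (x0 + t)))"
      by (simp add: fx_def blinfun.sum_left blinfun.scaleR_left mult_ac)
    also have "\<dots> = (\<Sum>b\<in>Basis. integral ?S (\<lambda>t. (h \<bullet> b) * (a t * pd b F (x0 + t))))"
      by (rule integral_sum) (auto intro!: integrable_continuous continuous_intros
          continuous_on_subset[OF a] continuous_on_compose2[OF cF(2)])
    also have "\<dots> = (\<Sum>b\<in>Basis. (h \<bullet> b) * correlate a (pd b F) x0)"
      by (intro sum.cong) (auto simp: eq cF rp)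
    finally show ?thesis .
  qed
  have 3: "\<And>y. y \<in> ball x0 1 \<Longrightarrow> integral ?S (\<lambda>t. a t * F (y + t)) = correlate a F y"
    using eq cF r by auto
  have "(correlate a F has_derivative blinfun_apply (integral ?S (fx x0))) (at x0)"
    using has_derivative_transform_within_open[OF 1, of "ball x0 1"] 3 by auto
  then show ?thesis
    by (rule has_derivative_eq_rhs) (rule ext, rule 2)
qed

lemma pd_correlate: "continuous_on UNIV a \<Longrightarrow> test_function F \<Longrightarrow> b \<in> Basis \<Longrightarrow> pd b (correlate a F) = correlate a (pd b F)"
  by (rule ext) (subst pd_eqI[OF correlate_has_derivative], auto simp: inner_Basis if_distrib[of "\<lambda>x. x * _"] cong: if_cong)

lemma smooth_correlate:
  assumes "continuous_on UNIV a" "test_function F"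
  shows "smooth (correlate a F)"
proof (rule smooth_coinduct[of "\<lambda>f. \<exists>F. test_function F \<and> f = correlate a F"])
  show "\<And>f x. \<exists>F. test_function F \<and> f = correlate a F \<Longrightarrow> f differentiable at x"
    using correlate_has_derivative[OF assms(1)] unfolding differentiable_def by blast
  show "\<And>f b. \<exists>F. test_function F \<and> f = correlate a F \<Longrightarrow> b \<in> Basis \<Longrightarrow>
     \<exists>F. test_function F \<and> pd b f = correlate a F"
    using pd_correlate[OF assms(1)] tf_pd by metis
qed (use assms in auto)

lemma correlate_outside:
  assumes "\<And>x. r < norm x \<Longrightarrow> a x = 0" "\<And>x. s < norm x \<Longrightarrow> F x = 0" "r + s < norm x"
  shows "correlate a F x = 0"
proof -
  have "a y * F (x + y) = 0" for y
  proof (cases "r < norm y")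
    case False
    have "norm x \<le> norm (x + y) + norm y" using norm_triangle_ineq4[of "x + y" y] by simp
    then show ?thesis using assms(2)[of "x + y"] assms(3) False by auto
  qed (use assms in auto)
  then show ?thesis unfolding correlate_def by (simp only: integral_zero)
qed

lemma csupp_correlate: "csupp a \<Longrightarrow> csupp F \<Longrightarrow> csupp (correlate a F)"
  unfolding csupp_def using correlate_outside by metis

lemma tf_correlate: "continuous_on UNIV a \<Longrightarrow> csupp a \<Longrightarrow> test_function F \<Longrightarrow> test_function (correlate a F)"
  by (simp add: test_function_iff csupp_correlate smooth_correlate)

text \<open>
The correlation with the constant kernel \<open>1\<close> is constant, by translation invariance of Lebesgue
measure; its derivative is the integral of the derivative.
\<close>

lemma integral_pd_eq_0:
  assumes "test_function F" "b \<in> Basis"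
  shows "(LBINT x. pd b F x) = 0"
proof -
  have "correlate (\<lambda>_. 1) F = (\<lambda>x. LBINT y. F y)"
    by (simp add: correlate_def fun_eq_iff integral_translate continuous_borel tf_cont assms)
  then have "pd b (correlate (\<lambda>_. 1) F) 0 = 0" by simp
  then show ?thesis using assms by (simp add: pd_correlate) (simp add: correlate_def)
qed

lemma integration_by_parts:
  assumes "test_function f" "smooth g" "b \<in> Basis"
  shows "(LBINT x. pd b f x * g x) = - (LBINT x. f x * pd b g x)"
proof -
  have "0 = (LBINT x. pd b (\<lambda>x. f x * g x) x)"
    using assms by (simp add: integral_pd_eq_0 tf_mult1)
  also have "\<dots> = (LBINT x. f x * pd b g x + pd b f x * g x)"
    by (simp add: pd_smooth_mult assms tf_smooth)
  also have "\<dots> = (LBINT x. f x * pd b g x) + (LBINT x. pd b f x * g x)"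
    using assms by (intro Bochner_Integration.integral_add tf_integrable tf_mult1 tf_pd smooth_pd)
  finally show ?thesis by simp
qed

text \<open>
Moving the derivative to the kernel is what makes second derivatives of a mollified function
bounded by its \<open>L\<^sup>2\<close> norm, with a constant that depends on the kernel.
\<close>

lemma pd_correlate_kernel:
  assumes a: "test_function a" and F: "test_function F" and b: "b \<in> Basis"
  shows "correlate a (pd b F) x = - correlate (pd b a) F x"
proof -
  show ?thesis unfolding correlate_def
    using integration_by_parts[OF a smooth_shift[OF tf_smooth[OF F]] b, of x]
    by (simp add: pd_shift[OF tf_smooth[OF F] b])
qed

lemma corr_integrable:
  fixes a F c :: "'a::euclidean_space \<Rightarrow> real"
  assumes a: "continuous_on UNIV a" "csupp a" and F: "continuous_on UNIV F" "csupp F"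
    and c: "continuous_on UNIV c"
  shows "integrable (lborel \<Otimes>\<^sub>M lborel) (\<lambda>(x, y). c x * (a y * F (x + y)))"
proof -
  obtain r where r: "\<And>x. r < norm x \<Longrightarrow> a x = 0" using a by (auto simp: csupp_def)
  obtain s where s: "\<And>x. s < norm x \<Longrightarrow> F x = 0" using F by (auto simp: csupp_def)
  have "csupp (\<lambda>(x, y). c x * (a y * F (x + y)))"
    unfolding csupp_def
  proof (intro exI[of _ "2 * r + s"] allI impI)
    fix z :: "'a \<times> 'a" assume z: "2 * r + s < norm z"
    obtain x y where xy: "z = (x, y)" by (cases z)
    have "F (x + y) = 0" if "a y \<noteq> 0"
    proof -
    have "norm (x, y) \<le> norm x + norm y" by (rule norm_Pair_le)
    moreover have "norm y \<le> r" using r[of y] that by (meson not_le)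
    moreover have "norm x \<le> norm (x + y) + norm y" using norm_triangle_ineq4[of "x + y" y] by simp
    ultimately show "F (x + y) = 0" using s[of "x + y"] z xy by auto
    qed
    then show "(case z of (x, y) \<Rightarrow> c x * (a y * F (x + y))) = 0" unfolding xy by auto
  qed
  moreover have "continuous_on UNIV (\<lambda>(x, y). c x * (a y * F (x + y)))"
    unfolding split_beta
    by (intro continuous_intros continuous_on_compose2[OF a(1)] continuous_on_compose2[OF F(1)]
        continuous_on_compose2[OF c]) auto
  ultimately show ?thesis unfolding lborel_prod by (rule cc_integrable[rotated])
qed

lemma correlate_measurable:
  "continuous_on UNIV a \<Longrightarrow> continuous_on UNIV F \<Longrightarrow> correlate a F \<in> borel_measurable borel"
proof -
  assume a: "continuous_on UNIV a" "continuous_on UNIV F"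
  have "(\<lambda>(x, y). a y * F (x + y)) \<in> borel_measurable borel"
    unfolding split_beta
    by (intro continuous_borel continuous_intros continuous_on_compose2[OF a(1)]
        continuous_on_compose2[OF a(2)]) auto
  then have "(\<lambda>(x, y). a y * F (x + y)) \<in> borel_measurable (borel \<Otimes>\<^sub>M lborel)"
    by (simp add: borel_prod[symmetric] cong: measurable_cong_sets sets_pair_measure_cong)
  then show ?thesis unfolding correlate_def by (intro lborel.borel_measurable_lebesgue_integral)
qed

lemma correlate_pair:
  assumes a: "continuous_on UNIV a" "csupp a" and F: "continuous_on UNIV F" "csupp F"
    and c: "continuous_on UNIV c"
  shows "integrable lborel (\<lambda>x. c x * correlate a F x)"
    and "(LBINT x. c x * correlate a F x) = (LBINT y. a y * (LBINT x. c x * F (x + y)))"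
proof -
  note i = corr_integrable[OF a F c]
  have "integrable lborel (\<lambda>x. LBINT y. c x * (a y * F (x + y)))"
    using lborel_pair.integrable_fst'[OF i] by simp
  then show "integrable lborel (\<lambda>x. c x * correlate a F x)" by (simp add: correlate_def)
  have "(LBINT x. c x * correlate a F x) = (LBINT x. (LBINT y. c x * (a y * F (x + y))))"
    by (simp add: correlate_def)
  also have "\<dots> = (LBINT y. (LBINT x. c x * (a y * F (x + y))))"
    using lborel_pair.Fubini_integral[OF i] by simp
  also have "\<dots> = (LBINT y. a y * (LBINT x. c x * F (x + y)))"
    by (simp add: mult.left_commute)
  finally show "(LBINT x. c x * correlate a F x) = (LBINT y. a y * (LBINT x. c x * F (x + y)))" .
qed

lemma correlate_selfadjoint:
  assumes a: "continuous_on UNIV a" "csupp a" and even: "\<And>y. a (- y) = a y"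
    and F: "continuous_on UNIV F" "csupp F" and c: "continuous_on UNIV c" "csupp c"
  shows "(LBINT x. c x * correlate a F x) = (LBINT x. correlate a c x * F x)"
proof -
  have t: "(LBINT x. c x * F (x + y)) = (LBINT x. F x * c (x + - y))" for y
  proof -
    have "continuous_on UNIV (\<lambda>x. c (x - y) * F x)"
      using F c by (auto intro!: continuous_intros intro: continuous_on_compose2)
    then show ?thesis
      using integral_translate(2)[of "\<lambda>x. c (x - y) * F x" y] by (simp add: continuous_borel mult.commute)
  qed
  let ?K = "\<lambda>y. a y * (LBINT x. F x * c (x + y))"
  have m: "?K \<in> borel_measurable borel"
  proof -
    have "(\<lambda>y. LBINT x. F x * c (y + x)) \<in> borel_measurable borel"
      using correlate_measurable[OF F(1) c(1)] by (simp add: correlate_def[abs_def])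
    then show ?thesis using continuous_borel[OF a(1)] by (simp add: add.commute)
  qed
  have "(LBINT x. c x * correlate a F x) = (LBINT y. ?K (- y))"
    by (simp add: correlate_pair(2)[OF a F c(1)] t even)
  also have "\<dots> = (LBINT y. ?K y)" by (rule integral_reflect[OF m])
  also have "\<dots> = (LBINT x. F x * correlate a c x)" by (simp add: correlate_pair(2)[OF a c F(1)])
  finally show ?thesis by (simp add: mult.commute)
qed

text \<open>
Cauchy-Schwarz, from the discriminant of the nonnegative quadratic polynomial
\<open>t \<mapsto> \<integral> (t f + g)\<^sup>2\<close>.
\<close>

lemma integral_square_le:
  fixes f g :: "'b \<Rightarrow> real"
  assumes "integrable M (\<lambda>x. (f x)\<^sup>2)" "integrable M (\<lambda>x. (g x)\<^sup>2)" "integrable M (\<lambda>x. f x * g x)"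
  shows "(\<integral>x. f x * g x \<partial>M)\<^sup>2 \<le> (\<integral>x. (f x)\<^sup>2 \<partial>M) * (\<integral>x. (g x)\<^sup>2 \<partial>M)"
proof -
  let ?A = "\<integral>x. (f x)\<^sup>2 \<partial>M" and ?B = "\<integral>x. f x * g x \<partial>M" and ?C = "\<integral>x. (g x)\<^sup>2 \<partial>M"
  have "0 \<le> ?A * t\<^sup>2 + 2 * ?B * t + ?C" for t
  proof -
    have "0 \<le> (\<integral>x. (t * f x + g x)\<^sup>2 \<partial>M)" by simp
    also have "\<dots> = (\<integral>x. t\<^sup>2 * (f x)\<^sup>2 + 2 * t * (f x * g x) + (g x)\<^sup>2 \<partial>M)"
      by (simp add: power2_sum power_mult_distrib algebra_simps)
    also have "\<dots> = t\<^sup>2 * ?A + 2 * t * ?B + ?C" using assms by simp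
    finally show ?thesis by (simp add: mult_ac)
  qed
  note q = this
  show ?thesis
  proof (cases "?A = 0")
    case True
    have "?B = 0"
    proof (rule ccontr)
      assume "?B \<noteq> 0"
      then show False using q[of "- (?C + 1) / (2 * ?B)"] True by (simp add: field_simps)
    qed
    then show ?thesis using True by simp
  next
    case False
    then have A: "?A > 0" by (simp add: order_less_le)
    have "0 \<le> ?A * (?A * (- ?B / ?A)\<^sup>2 + 2 * ?B * (- ?B / ?A) + ?C)"
      using q[of "- ?B / ?A"] A by (intro mult_nonneg_nonneg) auto
    also have "\<dots> = ?A * ?C - ?B\<^sup>2" using A by (simp add: field_simps power2_eq_square)
    finally show ?thesis by simp
  qed
qed

text \<open>
Young's inequality. Cauchy-Schwarz with respect to the measure \<open>\<bar>a y\<bar> dy\<close> bounds the square of the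
correlation by a correlation of \<open>F\<^sup>2\<close>, which is then integrated with Fubini.
\<close>

lemma correlate_L2:
  fixes a F :: "'a::euclidean_space \<Rightarrow> real"
  assumes a: "continuous_on UNIV a" "csupp a" and F: "continuous_on UNIV F" "csupp F"
  shows "integrable lborel (\<lambda>x. (correlate a F x)\<^sup>2)"
    and "(LBINT x. (correlate a F x)\<^sup>2) \<le> (LBINT y. \<bar>a y\<bar>)\<^sup>2 * (LBINT x. (F x)\<^sup>2)"
proof -
  let ?A = "LBINT y. \<bar>a y\<bar>"
  have ca: "continuous_on UNIV (\<lambda>y. \<bar>a y\<bar>)" "csupp (\<lambda>y. \<bar>a y\<bar>)" using a by (auto intro!: continuous_intros)
  have cF: "continuous_on UNIV (\<lambda>y. (F y)\<^sup>2)" "csupp (\<lambda>y. (F y)\<^sup>2)" using F by (auto intro!: continuous_intros)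
  have *: "(correlate a F x)\<^sup>2 \<le> ?A * correlate (\<lambda>y. \<bar>a y\<bar>) (\<lambda>y. (F y)\<^sup>2) x" for x
  proof -
    have cFx: "continuous_on UNIV (\<lambda>y. F (x + y))" by (intro continuous_on_compose2[OF F(1)] continuous_intros) auto
    let ?f = "\<lambda>y. sqrt \<bar>a y\<bar>" and ?g = "\<lambda>y. sqrt \<bar>a y\<bar> * \<bar>F (x + y)\<bar>"
    have e: "(?f y)\<^sup>2 = \<bar>a y\<bar>" "(?g y)\<^sup>2 = \<bar>a y\<bar> * (F (x + y))\<^sup>2" "?f y * ?g y = \<bar>a y * F (x + y)\<bar>" for y
      by (auto simp: power_mult_distrib abs_mult)
    have i: "integrable lborel (\<lambda>y. \<bar>a y\<bar>)" "integrable lborel (\<lambda>y. \<bar>a y\<bar> * (F (x + y))\<^sup>2)"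
       "integrable lborel (\<lambda>y. \<bar>a y * F (x + y)\<bar>)"
      using a cFx by (auto intro!: cc_integrable continuous_intros)
    have "\<bar>correlate a F x\<bar> \<le> (LBINT y. \<bar>a y * F (x + y)\<bar>)" unfolding correlate_def
      by (rule integral_abs_bound)
    then have "(correlate a F x)\<^sup>2 \<le> (LBINT y. \<bar>a y * F (x + y)\<bar>)\<^sup>2"
      by (metis abs_le_square_iff abs_ge_zero abs_of_nonneg order_trans)
    also have "\<dots> \<le> ?A * correlate (\<lambda>y. \<bar>a y\<bar>) (\<lambda>y. (F y)\<^sup>2) x"
      using integral_square_le[of lborel ?f ?g] unfolding e correlate_def using i by simp
    finally show ?thesis .
  qed
  have i: "integrable lborel (correlate (\<lambda>y. \<bar>a y\<bar>) (\<lambda>y. (F y)\<^sup>2))"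
    using correlate_pair(1)[OF ca cF, of "\<lambda>_. 1"] by simp
  show i2: "integrable lborel (\<lambda>x. (correlate a F x)\<^sup>2)"
  proof (rule Bochner_Integration.integrable_bound)
    show "integrable lborel (\<lambda>x. ?A * correlate (\<lambda>y. \<bar>a y\<bar>) (\<lambda>y. (F y)\<^sup>2) x)" using i by simp
    show "(\<lambda>x. (correlate a F x)\<^sup>2) \<in> borel_measurable lborel"
      using correlate_measurable[OF a(1) F(1)] by simp
    show "AE x in lborel. norm ((correlate a F x)\<^sup>2) \<le> norm (?A * correlate (\<lambda>y. \<bar>a y\<bar>) (\<lambda>y. (F y)\<^sup>2) x)"
      using * order_trans[OF * abs_ge_self] by (intro AE_I2) (simp only: real_norm_def abs_power2)
  qed
  have "(LBINT x. (correlate a F x)\<^sup>2) \<le> (LBINT x. ?A * correlate (\<lambda>y. \<bar>a y\<bar>) (\<lambda>y. (F y)\<^sup>2) x)"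
    using i i2 * by (intro integral_mono) auto
  also have "\<dots> = ?A * (LBINT y. \<bar>a y\<bar> * (LBINT x. (F (x + y))\<^sup>2))"
    using correlate_pair(2)[OF ca cF, of "\<lambda>_. 1"] by simp
  also have "\<dots> = ?A\<^sup>2 * (LBINT x. (F x)\<^sup>2)"
    using integral_translate(2)[OF continuous_borel[OF cF(1)]] by (simp add: power2_eq_square)
  finally show "(LBINT x. (correlate a F x)\<^sup>2) \<le> ?A\<^sup>2 * (LBINT x. (F x)\<^sup>2)" .
qed

section \<open>Symmetry of second derivatives\<close>

text \<open>
Two applications of the mean value theorem. The left-hand side is symmetric in \<open>b\<close> and \<open>c\<close>, which
forces the two mixed derivatives to agree at points arbitrarily close to \<open>x\<close>.
\<close>

lemma second_difference:
  fixes f :: "'a::euclidean_space \<Rightarrow> real"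
  assumes f: "smooth f" and b: "b \<in> Basis" "c \<in> Basis" and h: "h > 0"
  obtains s t where "0 < s" "s < h" "0 < t" "t < h"
    "f (x + h *\<^sub>R b + h *\<^sub>R c) - f (x + h *\<^sub>R b) - f (x + h *\<^sub>R c) + f x
      = h * h * pd c (pd b f) (x + s *\<^sub>R b + t *\<^sub>R c)"
proof -
  let ?p = "\<lambda>s. f ((x + h *\<^sub>R c) + s *\<^sub>R b) - f (x + s *\<^sub>R b)"
  have "(?p has_real_derivative (pd b f ((x + h *\<^sub>R c) + s *\<^sub>R b) - pd b f (x + s *\<^sub>R b))) (at s)" for s
    by (intro DERIV_diff smooth_line_basis_derivative f b)
  from MVT2[OF h this] obtain s where s: "0 < s" "s < h"
    "?p h - ?p 0 = h * (pd b f ((x + h *\<^sub>R c) + s *\<^sub>R b) - pd b f (x + s *\<^sub>R b))" by auto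
  from MVT2[OF h smooth_line_basis_derivative[OF smooth_pd[OF f b(1)] b(2), of "x + s *\<^sub>R b"]]
  obtain t where t: "0 < t" "t < h"
    "pd b f ((x + s *\<^sub>R b) + h *\<^sub>R c) - pd b f (x + s *\<^sub>R b) = h * pd c (pd b f) (x + s *\<^sub>R b + t *\<^sub>R c)"
    by auto
  have "?p h - ?p 0 = h * h * pd c (pd b f) (x + s *\<^sub>R b + t *\<^sub>R c)"
    unfolding s(3) using t(3) by (simp add: add_ac)
  then show ?thesis using that[OF s(1,2) t(1,2)] by (simp add: algebra_simps)
qed

lemma pd_commute:
  fixes f :: "'a::euclidean_space \<Rightarrow> real"
  assumes f: "smooth f" and b: "b \<in> Basis" "c \<in> Basis"
  shows "pd b (pd c f) = pd c (pd b f)"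
proof
  fix x
  show "pd b (pd c f) x = pd c (pd b f) x"
  proof (rule ccontr)
    let ?P = "pd b (pd c f)" and ?Q = "pd c (pd b f)"
    assume ne: "?P x \<noteq> ?Q x"
    define e where "e = \<bar>?P x - ?Q x\<bar> / 2"
    have e: "e > 0" using ne by (simp add: e_def)
    have "isCont ?P x" "isCont ?Q x"
      by (auto intro!: smooth_isCont smooth_pd f b)
    then obtain d1 d2 where d: "d1 > 0" "\<And>y. dist y x < d1 \<Longrightarrow> dist (?P y) (?P x) < e"
      "d2 > 0" "\<And>y. dist y x < d2 \<Longrightarrow> dist (?Q y) (?Q x) < e"
      using e unfolding continuous_at_eps_delta by metis
    define h where "h = min d1 d2 / 3"
    have h: "h > 0" "2 * h < d1" "2 * h < d2" using d by (auto simp: h_def min_def)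
    have near: "dist (x + s *\<^sub>R u + t *\<^sub>R v) x < 2 * h" if "0 < s" "s < h" "0 < t" "t < h" "u \<in> Basis" "v \<in> Basis" for s t u v
    proof -
      have "norm (s *\<^sub>R u + t *\<^sub>R v) \<le> s + t"
        using norm_triangle_ineq[of "s *\<^sub>R u" "t *\<^sub>R v"] that by simp
      then show ?thesis using that by (simp add: dist_norm add.assoc)
    qed
    obtain s t where st: "0 < s" "s < h" "0 < t" "t < h"
      "f (x + h *\<^sub>R b + h *\<^sub>R c) - f (x + h *\<^sub>R b) - f (x + h *\<^sub>R c) + f x = h * h * ?Q (x + s *\<^sub>R b + t *\<^sub>R c)"
      using second_difference[OF f b h(1)] by metis
    obtain s' t' where st': "0 < s'" "s' < h" "0 < t'" "t' < h"
      "f (x + h *\<^sub>R c + h *\<^sub>R b) - f (x + h *\<^sub>R c) - f (x + h *\<^sub>R b) + f x = h * h * ?P (x + s' *\<^sub>R c + t' *\<^sub>R b)"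
      using second_difference[OF f b(2,1) h(1)] by metis
    have "h * h * ?P (x + s' *\<^sub>R c + t' *\<^sub>R b) = h * h * ?Q (x + s *\<^sub>R b + t *\<^sub>R c)"
      unfolding st(5)[symmetric] st'(5)[symmetric] by (simp add: add_ac)
    then have "?P (x + s' *\<^sub>R c + t' *\<^sub>R b) = ?Q (x + s *\<^sub>R b + t *\<^sub>R c)" using h by simp
    moreover have "dist (?P (x + s' *\<^sub>R c + t' *\<^sub>R b)) (?P x) < e"
      using d(2) near[OF st'(1-4) b(2,1)] h by force
    moreover have "dist (?Q (x + s *\<^sub>R b + t *\<^sub>R c)) (?Q x) < e"
      using d(4) near[OF st(1-4) b] h by force
    ultimately show False
      using dist_triangle_half_l[of "?P x" "?P (x + s' *\<^sub>R c + t' *\<^sub>R b)" "2 * e" "?Q x"]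
      by (simp add: e_def dist_real_def abs_minus_commute)
  qed
qed

section \<open>Bump functions\<close>

text \<open>
The functions \<open>q(1/t) exp(-1/t)\<close>, extended by \<open>0\<close> to \<open>t \<le> 0\<close>: with an arbitrary polynomial \<open>q\<close>
the family is closed under differentiation, so each member is smooth by coinduction.
\<close>

definition flat :: "real poly \<Rightarrow> real \<Rightarrow> real" where
  "flat q t = (if t > 0 then poly q (1 / t) * exp (- (1 / t)) else 0)"

lemma poly_exp_tendsto_0: "((\<lambda>u::real. poly q u * exp (- u)) \<longlongrightarrow> 0) at_top"
proof -
  have "((\<lambda>u::real. \<Sum>i\<le>degree q. coeff q i * (u ^ i / exp u)) \<longlongrightarrow> (\<Sum>i\<le>degree q. coeff q i * 0)) at_top"
    by (intro tendsto_intros tendsto_power_div_exp_0)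
  then show ?thesis
    by (simp add: poly_altdef exp_minus field_simps sum_divide_distrib)
qed

lemma flat_tendsto_0: "(flat q \<longlongrightarrow> 0) (at_right 0)"
proof -
  have "((\<lambda>t. poly q (inverse t) * exp (- inverse t)) \<longlongrightarrow> 0) (at_right (0::real))"
    by (rule filterlim_compose[OF poly_exp_tendsto_0 filterlim_inverse_at_top_right])
  then show ?thesis
    by (rule Lim_transform_eventually)
       (auto simp: flat_def eventually_at_right_less inverse_eq_divide eventually_at_filter)
qed

lemma flat_has_derivative:
  "(flat q has_real_derivative flat (monom 1 2 * (q - pderiv q)) t) (at t)"
proof -
  consider "t > 0" | "t < 0" | "t = 0" by linarith
  then show ?thesis
  proof cases
    case 1
    have "((\<lambda>t. poly q (1 / t) * exp (- (1 / t))) has_real_derivative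
        flat (monom 1 2 * (q - pderiv q)) t) (at t)"
      using 1 by (auto intro!: derivative_eq_intros DERIV_chain2[OF poly_DERIV]
          simp: flat_def poly_monom field_simps power2_eq_square)
    then show ?thesis
      by (rule has_field_derivative_transform_within_open[of _ _ _ "{0<..}"]) (use 1 in \<open>auto simp: flat_def\<close>)
  next
    case 2
    have "((\<lambda>t. 0) has_real_derivative flat (monom 1 2 * (q - pderiv q)) t) (at t)"
      using 2 by (auto simp: flat_def)
    then show ?thesis
      by (rule has_field_derivative_transform_within_open[of _ _ _ "{..<0}"]) (use 2 in \<open>auto simp: flat_def\<close>)
  next
    case 3
    have "((\<lambda>h. flat q h / h) \<longlongrightarrow> 0) (at_left 0)"
      by (rule tendsto_eventually) (auto simp: flat_def eventually_at_filter)
    moreover have "((\<lambda>h. flat q h / h) \<longlongrightarrow> 0) (at_right 0)"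
      by (rule Lim_transform_eventually[OF flat_tendsto_0[of "monom 1 1 * q"]])
        (auto simp: flat_def eventually_at_filter poly_monom)
    ultimately have "((\<lambda>h. flat q h / h) \<longlongrightarrow> 0) (at 0)"
      by (simp add: filterlim_split_at)
    then show ?thesis using 3 by (simp add: DERIV_def flat_def)
  qed
qed

lemma smooth_flat: "smooth (flat q)"
proof (rule smooth_coinduct[of "\<lambda>f. \<exists>q. f = flat q"])
  show "\<And>f x. \<exists>q. f = flat q \<Longrightarrow> f differentiable at x"
    using flat_has_derivative unfolding differentiable_def has_field_derivative_def by blast
  have "pd b (flat q) = flat (monom 1 2 * (q - pderiv q))" if "b \<in> Basis" for b q
    using that by (intro ext) (simp add: pd_eqI[OF flat_has_derivative[unfolded has_field_derivative_def]])
  then show "\<And>f b. \<exists>q. f = flat q \<Longrightarrow> b \<in> Basis \<Longrightarrow> \<exists>q. pd b f = flat q" by blast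
qed auto

text \<open>
The factor \<open>exp(1/2)\<close> normalises the maximum, at the origin, to \<open>1\<close>; this makes \<open>bump R\<close> tend
to \<open>1\<close> as \<open>R\<close> grows. It is supported in the ball of radius \<open>\<surd>2 R\<close> and bounded below by a constant
on the ball of radius \<open>R\<close>, which is all that is asked of a cutoff here.
\<close>

definition bump :: "real \<Rightarrow> 'a::euclidean_space \<Rightarrow> real" where
  "bump R x = exp (1 / 2) * flat 1 (2 - (norm x)\<^sup>2 / R\<^sup>2)"

lemma bump_smooth: "smooth (bump R)"
  unfolding bump_def[abs_def]
  by (intro smooth_cmult smooth_compose[OF smooth_flat] smooth_diff smooth_divide smooth_norm_square smooth_const)

lemma bump_even: "bump R (- x) = bump R x"
  by (simp add: bump_def)

lemma bump_bounds: "0 \<le> bump R x" "bump R x \<le> 1"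
proof -
  show "0 \<le> bump R x" by (simp add: bump_def flat_def)
  let ?t = "2 - (norm x)\<^sup>2 / R\<^sup>2"
  have "1/2 \<le> 1 / ?t" if "?t > 0" using that by (simp add: field_simps)
  then have "flat 1 ?t \<le> exp (- (1/2))" by (auto simp: flat_def)
  then have "bump R x \<le> exp (1/2) * exp (- (1/2))" unfolding bump_def by (intro mult_left_mono) auto
  then show "bump R x \<le> 1" by (simp add: exp_minus)
qed

lemma bump_ge:
  assumes "R > 0" "norm x \<le> R" shows "exp (- 1/2) \<le> bump R x"
proof -
  let ?t = "2 - (norm x)\<^sup>2 / R\<^sup>2"
  have "(norm x)\<^sup>2 \<le> R\<^sup>2" using assms by (intro power_mono) auto
  then have "1 \<le> ?t" using assms by (simp add: field_simps)
  then have "exp (-1) \<le> flat 1 ?t" by (auto simp: flat_def field_simps)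
  then have "exp (1/2) * exp (- 1) \<le> bump R x" unfolding bump_def by (intro mult_left_mono) auto
  then show ?thesis by (simp add: exp_add[symmetric])
qed

lemma bump_outside:
  assumes "R > 0" "2 * R < norm x" shows "bump R x = 0"
proof -
  have "(2 * R)\<^sup>2 \<le> (norm x)\<^sup>2" using assms by (intro power_mono) auto
  moreover have "2 * R\<^sup>2 \<le> (2 * R)\<^sup>2" by (simp add: power_mult_distrib)
  ultimately have "2 * R\<^sup>2 \<le> (norm x)\<^sup>2" by linarith
  then have "2 - (norm x)\<^sup>2 / R\<^sup>2 \<le> 0" using assms by (simp add: field_simps power2_eq_square)
  then show ?thesis by (simp add: bump_def flat_def)
qed

lemma tf_bump: "R > 0 \<Longrightarrow> test_function (bump R)"
  unfolding test_function_iff csupp_def using bump_smooth bump_outside by metis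

lemma cc_bounded:
  assumes "continuous_on UNIV f" "csupp f"
  obtains C where "C \<ge> 0" "\<And>x::'a::euclidean_space. \<bar>f x\<bar> \<le> C"
proof -
  obtain r where r: "\<And>x. r < norm x \<Longrightarrow> f x = 0" using assms by (auto simp: csupp_def)
  have "compact (f ` cball 0 r)"
    by (intro compact_continuous_image continuous_on_subset[OF assms(1)]) auto
  then obtain C where C: "\<forall>y\<in>f ` cball 0 r. norm y \<le> C"
    using compact_imp_bounded bounded_iff by metis
  have "\<bar>f x\<bar> \<le> max C 0" for x
  proof (cases "r < norm x")
    case False
    then have "norm (f x) \<le> C" using C by auto
    then show ?thesis by simp
  qed (use r in auto)
  then show ?thesis using that[of "max C 0"] by auto
qed

text \<open>
The gradient decays like \<open>1 / R\<close> because \<open>bump R\<close> is a dilate of \<open>bump 1\<close>. It is through this decay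
that cutoffs become harmless in the energy estimate.
\<close>

lemma bump_pd_bound:
  obtains C where "C \<ge> 0" "\<And>R x b. R > 0 \<Longrightarrow> b \<in> Basis \<Longrightarrow> \<bar>pd b (bump R) (x::'a::euclidean_space)\<bar> \<le> C / R"
proof -
  have "\<exists>C\<ge>0. \<forall>x. \<bar>pd b (bump 1) x\<bar> \<le> C" if "b \<in> Basis" for b :: 'a
  proof -
    have t: "test_function (pd b (bump 1))" using that by (intro tf_pd tf_bump) auto
    show ?thesis using cc_bounded[OF tf_cont[OF t] tf_csupp[OF t]] by metis
  qed
  then obtain C where C: "\<And>b x. b \<in> Basis \<Longrightarrow> C b \<ge> 0" "\<And>b x. b \<in> Basis \<Longrightarrow> \<bar>pd b (bump 1) (x::'a)\<bar> \<le> C b"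
    by metis
  have "\<bar>pd b (bump R) x\<bar> \<le> sum C Basis / R" if R: "R > 0" and b: "b \<in> Basis" for R b and x :: 'a
  proof -
    have e: "bump R = (\<lambda>x::'a. bump 1 ((1/R) *\<^sub>R x))"
      using R by (auto simp: bump_def power_divide)
    have "((\<lambda>x. (1/R) *\<^sub>R x) has_derivative (\<lambda>h. (1/R) *\<^sub>R h)) (at x)"
      by (auto intro!: derivative_eq_intros)
    from has_derivative_compose[OF this smooth_has_derivative[OF bump_smooth[of 1]]]
    have "pd b (bump R) x = (\<Sum>c\<in>Basis. ((1/R) *\<^sub>R b \<bullet> c) * pd c (bump 1) ((1/R) *\<^sub>R x))"
      unfolding e by (rule pd_eqI)
    also have "\<dots> = (\<Sum>c\<in>Basis. if c = b then pd c (bump 1) ((1/R) *\<^sub>R x) / R else 0)"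
      using b by (intro sum.cong) (auto simp: inner_Basis)
    also have "\<dots> = pd b (bump 1) ((1/R) *\<^sub>R x) / R" using b by simp
    finally have "\<bar>pd b (bump R) x\<bar> = \<bar>pd b (bump 1) ((1/R) *\<^sub>R x)\<bar> / R" using R by (simp add: abs_divide)
    also have "\<dots> \<le> sum C Basis / R"
      using C b R member_le_sum[of b Basis C] by (intro divide_right_mono) (auto intro: order_trans)
    finally show ?thesis .
  qed
  moreover have "sum C Basis \<ge> 0" using C by (intro sum_nonneg) auto
  ultimately show ?thesis using that by blast
qed

lemma bump_tendsto_1: "(\<lambda>n. bump (real n) x) \<longlonglongrightarrow> 1"
proof -
  have "(\<lambda>n. (norm x)\<^sup>2 * (inverse (real n))\<^sup>2) \<longlonglongrightarrow> (norm x)\<^sup>2 * 0\<^sup>2"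
    by (intro tendsto_intros filterlim_compose[OF tendsto_inverse_0_at_top filterlim_real_sequentially] filterlim_ident)
  then have "(\<lambda>n. 2 - (norm x)\<^sup>2 / (real n)\<^sup>2) \<longlonglongrightarrow> 2 - 0"
    by (intro tendsto_intros) (simp add: inverse_eq_divide power_divide)
  moreover have "isCont (flat 1) 2"
    using smooth_continuous[OF smooth_flat, of UNIV] by (auto simp: continuous_on_eq_continuous_at)
  ultimately have "(\<lambda>n. flat 1 (2 - (norm x)\<^sup>2 / (real n)\<^sup>2)) \<longlonglongrightarrow> flat 1 2"
    by (auto intro: isCont_tendsto_compose)
  then have "(\<lambda>n. bump (real n) x) \<longlonglongrightarrow> exp (1/2) * flat 1 2"
    unfolding bump_def by (intro tendsto_intros)
  also have "exp (1/2) * flat 1 2 = 1" by (simp add: flat_def exp_minus)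
  finally show ?thesis .
qed

lemma mollifier_exists:
  assumes "\<epsilon> > 0"
  obtains \<rho> :: "'a::euclidean_space \<Rightarrow> real" where "test_function \<rho>" "\<And>y. 0 \<le> \<rho> y" "\<And>y. \<rho> (- y) = \<rho> y"
    "(LBINT y. \<rho> y) = 1" "\<And>y. \<epsilon> < norm y \<Longrightarrow> \<rho> y = 0"
proof -
  define b :: "'a \<Rightarrow> real" where "b = bump (\<epsilon>/2)"
  define I where "I = (LBINT y. b y)"
  have tb: "test_function b" unfolding b_def by (rule tf_bump) (use assms in simp)
  have "0 < exp (- 1/2) * measure lborel (ball (0::'a) (\<epsilon>/2))"
    using assms content_ball_pos[of "\<epsilon>/2" "0::'a"] by (intro mult_pos_pos) auto
  also have "\<dots> = (LBINT y. exp (- 1/2) * indicator (ball (0::'a) (\<epsilon>/2)) y)" by simp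
  also have "\<dots> \<le> I" unfolding I_def
  proof (rule integral_mono[OF _ tf_integrable[OF tb]])
    show "integrable lborel (\<lambda>y::'a. exp (- 1/2) * indicator (ball (0::'a) (\<epsilon>/2)) y :: real)"
      by (intro integrable_mult_right integrable_real_indicator emeasure_lborel_ball_finite) simp
    show "exp (- 1/2) * indicator (ball (0::'a) (\<epsilon>/2)) y \<le> b y" for y
      using bump_ge[of "\<epsilon>/2" y] bump_bounds[of "\<epsilon>/2" y] assms by (auto simp: indicator_def b_def)
  qed
  finally have I: "I > 0" .
  show ?thesis
  proof
    show "test_function (\<lambda>y. 1 / I * b y)" by (rule tf_cmult[OF tb])
    show "(LBINT y. 1 / I * b y) = 1" using I by (simp add: I_def)
  qed (use I assms in \<open>auto simp: b_def bump_bounds bump_even bump_outside\<close>)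
qed

section \<open>The ground state representation\<close>

definition ip :: "('a::euclidean_space \<Rightarrow> real) \<Rightarrow> ('a \<Rightarrow> real) \<Rightarrow> real" where
  "ip f g = (LBINT x. f x * g x)"

text \<open>
\<open>Dw U b f\<close> is \<open>\<theta> \<partial>\<^sub>b (f / \<theta>)\<close> for \<open>\<theta> = exp (- U / 2)\<close>, the partial derivative conjugated by the ground
state; \<open>Ds\<close> is its formal adjoint for Lebesgue measure. \<open>Hw\<close> is conjugate to the negative of the
diffusion generator \<open>\<Delta> - \<nabla>U \<cdot> \<nabla>\<close>.
\<close>

definition Dw :: "('a::euclidean_space \<Rightarrow> real) \<Rightarrow> 'a \<Rightarrow> ('a \<Rightarrow> real) \<Rightarrow> 'a \<Rightarrow> real" where
  "Dw U b f x = pd b f x + pd b U x / 2 * f x"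

definition Ds :: "('a::euclidean_space \<Rightarrow> real) \<Rightarrow> 'a \<Rightarrow> ('a \<Rightarrow> real) \<Rightarrow> 'a \<Rightarrow> real" where
  "Ds U b f x = - pd b f x + pd b U x / 2 * f x"

definition Hw :: "('a::euclidean_space \<Rightarrow> real) \<Rightarrow> ('a \<Rightarrow> real) \<Rightarrow> 'a \<Rightarrow> real" where
  "Hw U f x = (\<Sum>b\<in>Basis. Ds U b (Dw U b f) x)"

definition ground :: "('a::euclidean_space \<Rightarrow> real) \<Rightarrow> 'a \<Rightarrow> real" where
  "ground U x = exp (- U x / 2)"

text \<open>
The Schroedinger potential \<open>\<bar>\<nabla>U\<bar>\<^sup>2 / 4 - \<Delta>U / 2\<close>, so that \<open>Hw U = - \<Delta> + Vw U\<close>. This form is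
convenient for mollifiers, which commute with \<open>\<Delta>\<close> and almost commute with a continuous potential.
\<close>

definition Vw :: "('a::euclidean_space \<Rightarrow> real) \<Rightarrow> 'a \<Rightarrow> real" where
  "Vw U x = (\<Sum>b\<in>Basis. (pd b U x)\<^sup>2 / 4 - pd b (pd b U) x / 2)"

abbreviation energy :: "('a::euclidean_space \<Rightarrow> real) \<Rightarrow> ('a \<Rightarrow> real) \<Rightarrow> real" where
  "energy U f \<equiv> (\<Sum>b\<in>Basis. ip (Dw U b f) (Dw U b f))"

lemma ip_commute: "ip f g = ip g f"
  by (simp add: ip_def mult.commute)

lemma ip_self: "ip f f = (LBINT x. (f x)\<^sup>2)"
  by (simp add: ip_def power2_eq_square)

lemma ip_self_nonneg: "0 \<le> ip f f"
  by (simp add: ip_self)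

lemma ip_integrable:
  "test_function f \<Longrightarrow> smooth g \<Longrightarrow> integrable lborel (\<lambda>x. f x * g x)"
  "smooth f \<Longrightarrow> test_function g \<Longrightarrow> integrable lborel (\<lambda>x. f x * g x)"
  by (simp_all add: tf_integrable tf_mult1 tf_mult2)

lemma square_integrable: "test_function f \<Longrightarrow> integrable lborel (\<lambda>x. (f x)\<^sup>2)"
  using ip_integrable(1)[of f f] by (simp add: power2_eq_square tf_smooth)

lemma ip_diff_left: "test_function f \<Longrightarrow> test_function g \<Longrightarrow> smooth h \<Longrightarrow>
    ip (\<lambda>x. f x - g x) h = ip f h - ip g h"
  and ip_add_left: "test_function f \<Longrightarrow> test_function g \<Longrightarrow> smooth h \<Longrightarrow>
    ip (\<lambda>x. f x + g x) h = ip f h + ip g h"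
  and ip_cmult_left: "ip (\<lambda>x. c * f x) h = c * ip f h"
  by (simp_all add: ip_def ip_integrable algebra_simps)

lemma ip_diff_right: "test_function f \<Longrightarrow> test_function g \<Longrightarrow> smooth h \<Longrightarrow>
    ip h (\<lambda>x. f x - g x) = ip h f - ip h g"
  using ip_diff_left ip_commute by metis

lemma ip_self_expand:
  assumes "test_function f" "test_function g"
  shows "ip (\<lambda>x. f x - t * g x) (\<lambda>x. f x - t * g x) = ip f f - 2 * t * ip f g + t\<^sup>2 * ip g g"
proof -
  have "ip (\<lambda>x. f x - t * g x) (\<lambda>x. f x - t * g x)
      = (LBINT x. f x * f x - 2 * t * (f x * g x) + t\<^sup>2 * (g x * g x))"
    unfolding ip_def by (rule Bochner_Integration.integral_cong) (auto simp: algebra_simps power2_eq_square)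
  also have "\<dots> = ip f f - 2 * t * ip f g + t\<^sup>2 * ip g g"
    unfolding ip_def using assms by (simp add: ip_integrable tf_smooth)
  finally show ?thesis .
qed

lemma ip_Cauchy_Schwarz:
  assumes "test_function f" "test_function g"
  shows "(ip f g)\<^sup>2 \<le> ip f f * ip g g"
  using integral_square_le[of lborel f g] assms
  by (simp add: ip_self square_integrable ip_integrable tf_smooth) (simp add: ip_def)

lemma smooth_ground: "smooth U \<Longrightarrow> smooth (ground U)"
  unfolding ground_def[abs_def] by (intro smooth_exp_compose smooth_divide smooth_minus)

lemma ground_pos: "ground U x > 0"
  by (simp add: ground_def)

lemma ground_square: "(ground U x)\<^sup>2 = exp (- U x)"
  by (simp add: ground_def power2_eq_square exp_add[symmetric])

context
  fixes U :: "'a::euclidean_space \<Rightarrow> real"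
  assumes U: "smooth U"
begin

lemma smooth_Dw: "smooth f \<Longrightarrow> b \<in> Basis \<Longrightarrow> smooth (Dw U b f)"
  unfolding Dw_def[abs_def] using U by (intro smooth_add smooth_mult smooth_divide smooth_pd)

lemma smooth_Ds: "smooth f \<Longrightarrow> b \<in> Basis \<Longrightarrow> smooth (Ds U b f)"
  unfolding Ds_def[abs_def] using U by (intro smooth_add smooth_mult smooth_divide smooth_minus smooth_pd)

lemma tf_Dw: "test_function f \<Longrightarrow> b \<in> Basis \<Longrightarrow> test_function (Dw U b f)"
  unfolding Dw_def[abs_def] using U by (intro tf_add tf_mult2 smooth_divide smooth_pd tf_pd)

lemma tf_Ds: "test_function f \<Longrightarrow> b \<in> Basis \<Longrightarrow> test_function (Ds U b f)"
  unfolding Ds_def[abs_def] using U by (intro tf_add tf_minus tf_mult2 smooth_divide smooth_pd tf_pd)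

lemma tf_Hw: "test_function f \<Longrightarrow> test_function (Hw U f)"
  unfolding Hw_def[abs_def] by (intro tf_sum tf_Ds tf_Dw)

lemma Dw_adjoint_aux:
  assumes "integrable lborel (\<lambda>x. f x * pd b g x)" "integrable lborel (\<lambda>x. pd b U x / 2 * f x * g x)"
     "integrable lborel (\<lambda>x. pd b f x * g x)"
    and "(LBINT x. pd b f x * g x) = - (LBINT x. f x * pd b g x)"
  shows "ip (Dw U b f) g = ip f (Ds U b g)"
proof -
  have "ip (Dw U b f) g = (LBINT x. pd b f x * g x + pd b U x / 2 * f x * g x)"
    by (simp add: ip_def Dw_def algebra_simps)
  also have "\<dots> = - (LBINT x. f x * pd b g x) + (LBINT x. pd b U x / 2 * f x * g x)"
    using assms by (subst Bochner_Integration.integral_add) auto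
  also have "\<dots> = (LBINT x. - (f x * pd b g x) + pd b U x / 2 * f x * g x)"
    using assms by (subst Bochner_Integration.integral_add) auto
  also have "\<dots> = ip f (Ds U b g)" by (simp add: ip_def Ds_def algebra_simps)
  finally show ?thesis .
qed

lemma Dw_adjoint1:
  assumes f: "test_function f" and g: "smooth g" and b: "b \<in> Basis"
  shows "ip (Dw U b f) g = ip f (Ds U b g)"
proof (rule Dw_adjoint_aux)
  show "integrable lborel (\<lambda>x. f x * pd b g x)" by (intro ip_integrable(1) f smooth_pd g b)
  show "integrable lborel (\<lambda>x. pd b U x / 2 * f x * g x)"
    by (intro ip_integrable(1) tf_mult2 smooth_divide smooth_pd f g b U)
  show "integrable lborel (\<lambda>x. pd b f x * g x)" by (intro ip_integrable(1) tf_pd f g b)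
  show "(LBINT x. pd b f x * g x) = - (LBINT x. f x * pd b g x)"
    by (rule integration_by_parts[OF f g b])
qed

lemma Dw_adjoint2:
  assumes f: "smooth f" and g: "test_function g" and b: "b \<in> Basis"
  shows "ip (Dw U b f) g = ip f (Ds U b g)"
proof (rule Dw_adjoint_aux)
  show "integrable lborel (\<lambda>x. f x * pd b g x)" by (intro ip_integrable(2) f tf_pd g b)
  show "integrable lborel (\<lambda>x. pd b U x / 2 * f x * g x)"
    by (intro ip_integrable(2) smooth_mult smooth_divide smooth_pd f g b U)
  show "integrable lborel (\<lambda>x. pd b f x * g x)" by (intro ip_integrable(2) smooth_pd f g b)
  have "(LBINT x. pd b g x * f x) = - (LBINT x. g x * pd b f x)"
    by (rule integration_by_parts[OF g f b])
  then show "(LBINT x. pd b f x * g x) = - (LBINT x. f x * pd b g x)"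
    by (simp only: mult.commute[of "f _"] mult.commute[of "g _"])
qed

lemma Dw_ground: "Dw U b (ground U) x = 0"
proof -
  have "pd b (ground U) = (\<lambda>x. ground U x * (- pd b U x / 2))"
    unfolding ground_def[abs_def] pd_smooth_exp[OF smooth_divide[OF smooth_minus[OF U]]]
      pd_smooth_divide[OF smooth_minus[OF U]] pd_smooth_minus[OF U] ..
  then show ?thesis by (simp add: Dw_def)
qed

lemma Dw_mult: "smooth f \<Longrightarrow> smooth g \<Longrightarrow> Dw U b (\<lambda>x. f x * g x) x = f x * Dw U b g x + pd b f x * g x"
  by (simp add: Dw_def pd_smooth_mult algebra_simps)

lemma Dw_ground_mult: "smooth f \<Longrightarrow> Dw U b (\<lambda>x. f x * ground U x) x = pd b f x * ground U x"
  by (simp add: Dw_mult smooth_ground U Dw_ground)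

lemma ip_Hw1:
  assumes "test_function f" "smooth g"
  shows "ip f (Hw U g) = (\<Sum>b\<in>Basis. ip (Dw U b f) (Dw U b g))"
proof -
  have "ip f (Hw U g) = (\<Sum>b\<in>Basis. ip f (Ds U b (Dw U b g)))"
    unfolding ip_def Hw_def sum_distrib_left
    using assms by (intro Bochner_Integration.integral_sum ip_integrable smooth_Ds smooth_Dw)
  then show ?thesis using assms by (simp add: Dw_adjoint1 smooth_Dw)
qed

lemma ip_Hw2:
  assumes "smooth f" "test_function g"
  shows "ip f (Hw U g) = (\<Sum>b\<in>Basis. ip (Dw U b f) (Dw U b g))"
proof -
  have "ip f (Hw U g) = (\<Sum>b\<in>Basis. ip f (Ds U b (Dw U b g)))"
    unfolding ip_def Hw_def sum_distrib_left
    using assms by (intro Bochner_Integration.integral_sum ip_integrable(2) tf_Ds tf_Dw)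
  then show ?thesis using assms by (simp add: Dw_adjoint2 tf_Dw)
qed

lemma ip_ground_Hw: "test_function f \<Longrightarrow> ip (ground U) (Hw U f) = 0"
  by (simp add: ip_Hw2 smooth_ground U) (simp add: ip_def Dw_ground)

lemma Hw_Schroedinger:
  assumes "smooth f"
  shows "Hw U f x = - (\<Sum>b\<in>Basis. pd b (pd b f) x) + Vw U x * f x"
proof -
  have "Ds U b (Dw U b f) x = - pd b (pd b f) x + ((pd b U x)\<^sup>2 / 4 - pd b (pd b U) x / 2) * f x"
    if b: "b \<in> Basis" for b
  proof -
    have s2: "smooth (\<lambda>x. pd b U x / 2)" by (intro smooth_divide smooth_pd U b)
    have "pd b (Dw U b f) x = pd b (pd b f) x + (pd b U x / 2 * pd b f x + pd b (pd b U) x / 2 * f x)"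
      unfolding Dw_def[abs_def] pd_smooth_add[OF smooth_pd[OF assms b] smooth_mult[OF s2 assms]]
        pd_smooth_mult[OF s2 assms] pd_smooth_divide[OF smooth_pd[OF U b]] ..
    then show ?thesis by (simp add: Ds_def Dw_def algebra_simps power2_eq_square)
  qed
  then show ?thesis
    unfolding Hw_def Vw_def sum_distrib_right sum_negf[symmetric] sum.distrib[symmetric]
    by (rule sum.cong[OF refl])
qed

lemma smooth_Vw: "smooth (Vw U)"
  unfolding Vw_def[abs_def] using U
  by (intro smooth_sum smooth_diff smooth_divide smooth_power2 smooth_pd)

lemma Dw_lincomb: "smooth f \<Longrightarrow> smooth g \<Longrightarrow>
    Dw U b (\<lambda>x. f x + c * g x) = (\<lambda>x. Dw U b f x + c * Dw U b g x)"
  by (auto simp: Dw_def pd_smooth_add smooth_cmult pd_smooth_cmult algebra_simps)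
lemma Ds_lincomb: "smooth f \<Longrightarrow> smooth g \<Longrightarrow>
    Ds U b (\<lambda>x. f x + c * g x) = (\<lambda>x. Ds U b f x + c * Ds U b g x)"
  by (auto simp: Ds_def pd_smooth_add smooth_cmult pd_smooth_cmult algebra_simps)
lemma Hw_lincomb: "smooth f \<Longrightarrow> smooth g \<Longrightarrow>
    Hw U (\<lambda>x. f x + c * g x) x = Hw U f x + c * Hw U g x"
  by (simp add: Hw_def Dw_lincomb Ds_lincomb smooth_Dw sum.distrib sum_distrib_left)

text \<open>
An approximate orthogonal projection onto the range of \<open>Hw U\<close> that stays within test functions: if
\<open>u\<close> almost minimises \<open>\<parallel>f - H u\<parallel>\<close>, then the quadratic polynomial \<open>t \<mapsto> \<parallel>f - H (u + t v)\<parallel>\<^sup>2\<close> cannot fall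
much below its value at \<open>0\<close>, and its discriminant bounds the inner product with \<open>H v\<close>.
\<close>

lemma near_minimiser:
  assumes f: "test_function f" and d: "\<delta> > 0"
  obtains u where "test_function u"
    "ip (\<lambda>x. f x - Hw U u x) (\<lambda>x. f x - Hw U u x) \<le> ip f f + \<delta>\<^sup>2"
    "\<And>v. test_function v \<Longrightarrow>
       (ip (\<lambda>x. f x - Hw U u x) (Hw U v))\<^sup>2 \<le> \<delta>\<^sup>2 * ip (Hw U v) (Hw U v)"
proof -
  define N where "N u = ip (\<lambda>x. f x - Hw U u x) (\<lambda>x. f x - Hw U u x)" for u
  define I where "I = Inf (N ` {u. test_function u})"
  have bdd: "bdd_below (N ` {u. test_function u})"
    by (rule bdd_belowI[of _ 0]) (auto simp: N_def ip_self_nonneg)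
  have ne: "N ` {u. test_function u} \<noteq> {}" using tf_zero by blast
  have low: "I \<le> N u" if "test_function u" for u
    unfolding I_def using that bdd by (auto intro: cInf_lower)
  obtain u where u: "test_function u" "N u < I + \<delta>\<^sup>2"
    using cInf_lessD[OF ne, of "I + \<delta>\<^sup>2"] d by (auto simp: I_def)
  have "Hw U (\<lambda>x. 0) = (\<lambda>x. 0)"
    using Hw_lincomb[of "\<lambda>x. 0" "\<lambda>x. 0" "-1"] by (auto simp: fun_eq_iff)
  then have "N (\<lambda>x. 0) = ip f f" by (simp add: N_def)
  then have 1: "N u \<le> ip f f + \<delta>\<^sup>2" using u low[OF tf_zero] by simp
  have 2: "(ip (\<lambda>x. f x - Hw U u x) (Hw U v))\<^sup>2 \<le> \<delta>\<^sup>2 * ip (Hw U v) (Hw U v)"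
    if v: "test_function v" for v
  proof -
    let ?p = "\<lambda>x. f x - Hw U u x" and ?h = "Hw U v"
    let ?a = "ip ?p ?h" and ?n = "ip ?h ?h"
    have tp: "test_function ?p" and th: "test_function ?h"
      using f u v by (auto intro: tf_diff tf_Hw)
    have q: "2 * t * ?a \<le> \<delta>\<^sup>2 + t\<^sup>2 * ?n" for t
    proof -
      have "test_function (\<lambda>x. u x + t * v x)" using u v by (intro tf_add tf_cmult)
      from low[OF this] have "I \<le> ip (\<lambda>x. ?p x - t * ?h x) (\<lambda>x. ?p x - t * ?h x)"
        using u v by (simp only: N_def Hw_lincomb tf_smooth diff_diff_eq)
      also have "\<dots> = N u - 2 * t * ?a + t\<^sup>2 * ?n"
        unfolding N_def by (rule ip_self_expand[OF tp th])
      finally show ?thesis using u(2) by simp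
    qed
    show ?thesis
    proof (cases "?n = 0")
      case True
      have "?a = 0"
      proof (rule ccontr)
        assume "?a \<noteq> 0"
        then show False using q[of "(\<delta>\<^sup>2 + 1) / (2 * ?a)"] True by simp
      qed
      then show ?thesis using True by simp
    next
      case False
      then have n: "?n > 0" using ip_self_nonneg[of ?h] by simp
      \<comment> \<open>the vertex of the quadratic polynomial\<close>
      have "2 * (?a / ?n) * ?a \<le> \<delta>\<^sup>2 + (?a / ?n)\<^sup>2 * ?n" by (rule q)
      then have "?a\<^sup>2 / ?n \<le> \<delta>\<^sup>2" using n by (simp add: field_simps power2_eq_square)
      then show ?thesis using n by (simp add: field_simps)
    qed
  qed
  show ?thesis using that[OF u(1)] 1 2 by (simp add: N_def)
qed

end

section \<open>A Poincare inequality on balls\<close>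

lemma nn_integral_dilate:
  fixes f :: "'a::euclidean_space \<Rightarrow> ennreal"
  assumes f: "f \<in> borel_measurable borel" and c: "1/2 \<le> c"
  shows "(\<integral>\<^sup>+x. f (a + c *\<^sub>R x) \<partial>lborel) \<le> ennreal (2 ^ DIM('a)) * (\<integral>\<^sup>+x. f x \<partial>lborel)"
proof -
  have "lborel = density (distr lborel borel (\<lambda>x::'a. a + c *\<^sub>R x)) (\<lambda>_. \<bar>c\<bar> ^ DIM('a))"
    using c by (intro lborel_affine) auto
  then have "(\<integral>\<^sup>+x. f x \<partial>lborel) =
      (\<integral>\<^sup>+x. f x \<partial>density (distr lborel borel (\<lambda>x::'a. a + c *\<^sub>R x)) (\<lambda>_. ennreal (\<bar>c\<bar> ^ DIM('a))))" by simp
  also have "\<dots> = ennreal (c ^ DIM('a)) * (\<integral>\<^sup>+x. f (a + c *\<^sub>R x) \<partial>lborel)"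
    using f c by (simp add: nn_integral_density nn_integral_cmult nn_integral_distr)
  finally have e: "(\<integral>\<^sup>+x. f x \<partial>lborel) = ennreal (c ^ DIM('a)) * (\<integral>\<^sup>+x. f (a + c *\<^sub>R x) \<partial>lborel)" .
  have "1 \<le> (2 * c) ^ DIM('a)" using c by (intro one_le_power) simp
  then have "1 \<le> ennreal (2 ^ DIM('a) * c ^ DIM('a))" by (simp add: power_mult_distrib)
  then have "1 * (\<integral>\<^sup>+x. f (a + c *\<^sub>R x) \<partial>lborel) \<le>
      ennreal (2 ^ DIM('a) * c ^ DIM('a)) * (\<integral>\<^sup>+x. f (a + c *\<^sub>R x) \<partial>lborel)"
    by (rule mult_right_mono) simp
  also have "\<dots> = ennreal (2 ^ DIM('a)) * (\<integral>\<^sup>+x. f x \<partial>lborel)"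
    unfolding e using c by (simp add: ennreal_mult mult.assoc)
  finally show ?thesis by simp
qed

lemma increment_le_integral:
  fixes g :: "'a::euclidean_space \<Rightarrow> real"
  assumes g: "smooth g" and r: "norm x \<le> r" "norm y \<le> r"
  defines "G \<equiv> \<lambda>z. indicator (cball 0 r) z * (\<Sum>b\<in>Basis. \<bar>pd b g z\<bar>)"
  shows "ennreal \<bar>g x - g y\<bar> \<le>
    (\<integral>\<^sup>+t. indicator {0..1} t * ennreal (2 * r * G (y + t *\<^sub>R (x - y))) \<partial>lborel)"
proof -
  let ?z = "\<lambda>t. y + t *\<^sub>R (x - y)"
  define h where "h t = (\<Sum>b\<in>Basis. ((x - y) \<bullet> b) * pd b g (?z t))" for t
  have pc: "continuous_on UNIV (\<lambda>t. pd b g (?z t))" if "b \<in> Basis" for b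
    by (rule continuous_on_compose2[OF smooth_continuous[OF smooth_pd[OF g that], of UNIV]])
      (auto intro!: continuous_intros)
  then have hc: "continuous_on UNIV h" unfolding h_def
    by (intro continuous_on_sum continuous_on_mult continuous_on_const)
  have hF: "has_bochner_integral lborel (\<lambda>t. h t * indicator {0..1} t) (g (?z 1) - g (?z 0))"
    using hc smooth_line_derivative[OF g]
    by (intro has_bochner_integral_FTC_Icc_real)
      (auto simp: h_def continuous_on_eq_continuous_at)
  have hle: "\<bar>h t\<bar> \<le> 2 * r * G (?z t)" if t: "t \<in> {0..1}" for t
  proof -
    have "?z t = (1 - t) *\<^sub>R y + t *\<^sub>R x" by (simp add: algebra_simps)
    then have "?z t \<in> cball 0 r"
      using convexD[OF convex_cball[of "0::'a" r], of y x "1 - t" t] t r by auto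
    then have G: "G (?z t) = (\<Sum>b\<in>Basis. \<bar>pd b g (?z t)\<bar>)" by (simp add: G_def)
    have n: "norm (x - y) \<le> 2 * r" using norm_triangle_ineq4[of x y] r by linarith
    have "\<bar>h t\<bar> \<le> (\<Sum>b\<in>Basis. \<bar>((x - y) \<bullet> b) * pd b g (?z t)\<bar>)"
      unfolding h_def by (rule sum_abs)
    also have "\<dots> \<le> (\<Sum>b\<in>Basis. 2 * r * \<bar>pd b g (?z t)\<bar>)"
      unfolding abs_mult using n
      by (intro sum_mono mult_right_mono) (auto intro: order_trans[OF Basis_le_norm])
    finally show ?thesis by (simp add: G sum_distrib_left)
  qed
  have i: "integrable lborel (\<lambda>t. h t * indicator {0..1} t)"
    and e: "(LBINT t. h t * indicator {0..1} t) = g x - g y"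
    using hF by (auto simp: has_bochner_integral_iff)
  have "ennreal \<bar>g x - g y\<bar> \<le> (\<integral>\<^sup>+t. ennreal (norm (h t * indicator {0..1} t)) \<partial>lborel)"
    using integral_norm_bound_ennreal[OF i] unfolding e by simp
  also have "\<dots> \<le> (\<integral>\<^sup>+t. indicator {0..1} t * ennreal (2 * r * G (?z t)) \<partial>lborel)"
    using hle by (intro nn_integral_mono) (auto simp: indicator_def abs_mult intro!: ennreal_leI)
  finally show ?thesis .
qed

text \<open>
Integrate \<open>\<bar>g x - g y\<bar> \<le> 2 r \<integral> G (y + t (x - y)) dt\<close> over pairs of points of the ball. For each \<open>t\<close>,
one of the maps \<open>x \<mapsto> y + t (x - y)\<close> (if \<open>t \<ge> 1/2\<close>) and \<open>y \<mapsto> y + t (x - y)\<close> (if \<open>t < 1/2\<close>) is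
a dilation by a factor of at least \<open>1/2\<close>, so that the inner integral is at most \<open>2\<^sup>n\<close> times the
integral of \<open>G\<close>.
\<close>

lemma double_difference_le:
  fixes g :: "'a::euclidean_space \<Rightarrow> real"
  assumes g: "smooth g" and r: "r \<ge> 0"
  defines "G \<equiv> \<lambda>z. indicator (cball 0 r) z * (\<Sum>b\<in>Basis. \<bar>pd b g z\<bar>)"
  defines "B \<equiv> indicator (cball (0::'a) r) :: 'a \<Rightarrow> ennreal"
  shows "(\<integral>\<^sup>+x. \<integral>\<^sup>+y. B x * B y * ennreal \<bar>g x - g y\<bar> \<partial>lborel \<partial>lborel)
    \<le> ennreal (2 * r * 2 ^ DIM('a)) * emeasure lborel (cball (0::'a) r) * (\<integral>\<^sup>+z. ennreal (G z) \<partial>lborel)"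
proof -
  have "continuous_on UNIV (\<lambda>z. \<Sum>b\<in>Basis. \<bar>pd b g z\<bar>)"
    by (intro continuous_intros smooth_continuous smooth_pd g)
  note [measurable] = continuous_borel[OF this]
  have Gm: "(\<lambda>z. ennreal (G z)) \<in> borel_measurable borel"
    unfolding G_def
    by (intro measurable_compose[OF _ measurable_ennreal] borel_measurable_times
        borel_measurable_indicator) auto
  have Bm: "B \<in> borel_measurable borel" unfolding B_def by (intro borel_measurable_indicator) simp
  let ?K = "ennreal (2 ^ DIM('a)) * (\<integral>\<^sup>+z. ennreal (G z) \<partial>lborel)"
  let ?V = "emeasure lborel (cball (0::'a) r)"
  have m1[measurable]: "(\<lambda>(x, t, y). ennreal (G (y + t *\<^sub>R (x - y)))) \<in> borel_measurable (borel \<Otimes>\<^sub>M borel \<Otimes>\<^sub>M borel)"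
  proof -
    have "(\<lambda>(x::'a, t::real, y). y + t *\<^sub>R (x - y)) \<in> borel_measurable borel"
      unfolding split_beta by (intro borel_measurable_continuous_onI continuous_intros)
    from measurable_compose[OF this Gm] show ?thesis by (simp add: borel_prod split_beta)
  qed
  note [measurable] = Bm
  have sp: "(\<lambda>(x, y). B x * B y * ennreal (G (y + t *\<^sub>R (x - y)))) \<in> borel_measurable (lborel \<Otimes>\<^sub>M lborel)" for t
  proof -
    have "(\<lambda>(x::'a, y). y + t *\<^sub>R (x - y)) \<in> borel_measurable borel"
      unfolding split_beta by (intro borel_measurable_continuous_onI continuous_intros)
    from measurable_compose[OF this Gm]
    have "(\<lambda>(x, y). ennreal (G (y + t *\<^sub>R (x - y)))) \<in> borel_measurable (borel \<Otimes>\<^sub>M borel)"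
      by (simp add: borel_prod split_beta)
    then have "(\<lambda>(x, y). B x * B y * ennreal (G (y + t *\<^sub>R (x - y)))) \<in> borel_measurable (borel \<Otimes>\<^sub>M borel)"
      unfolding split_beta by (intro borel_measurable_times_ennreal measurable_compose[OF measurable_fst Bm]
          measurable_compose[OF measurable_snd Bm])
    then show ?thesis by (simp cong: measurable_cong_sets sets_pair_measure_cong)
  qed
  have J: "(\<integral>\<^sup>+x. \<integral>\<^sup>+y. B x * B y * ennreal (G (y + t *\<^sub>R (x - y))) \<partial>lborel \<partial>lborel) \<le> ?K * ?V" for t
  proof -
    have "(\<integral>\<^sup>+x. B x * ?K \<partial>lborel) = (\<integral>\<^sup>+x. B x \<partial>lborel) * ?K"
      by (rule nn_integral_multc) (use Bm in simp)
    then have V: "(\<integral>\<^sup>+x. B x * ?K \<partial>lborel) = ?K * ?V"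
      unfolding B_def by (simp add: mult.commute)
    show ?thesis
    proof (cases "1/2 \<le> t")
      case True
      have "(\<integral>\<^sup>+x. \<integral>\<^sup>+y. B x * B y * ennreal (G (y + t *\<^sub>R (x - y))) \<partial>lborel \<partial>lborel)
          = (\<integral>\<^sup>+y. \<integral>\<^sup>+x. B x * B y * ennreal (G (y + t *\<^sub>R (x - y))) \<partial>lborel \<partial>lborel)"
        using lborel_pair.Fubini[OF sp] by simp
      also have "\<dots> \<le> (\<integral>\<^sup>+y. B y * ?K \<partial>lborel)"
      proof (rule nn_integral_mono)
        fix y :: 'a
        have "(\<integral>\<^sup>+x. B x * B y * ennreal (G (y + t *\<^sub>R (x - y))) \<partial>lborel)
           \<le> (\<integral>\<^sup>+x. B y * ennreal (G ((y - t *\<^sub>R y) + t *\<^sub>R x)) \<partial>lborel)"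
          by (rule nn_integral_mono) (auto simp: B_def indicator_def algebra_simps)
        also have "\<dots> = B y * (\<integral>\<^sup>+x. ennreal (G ((y - t *\<^sub>R y) + t *\<^sub>R x)) \<partial>lborel)"
          by (rule nn_integral_cmult)
            (use measurable_compose[OF _ Gm, of "\<lambda>x. (y - t *\<^sub>R y) + t *\<^sub>R x" lborel] in simp)
        also have "\<dots> \<le> B y * ?K"
          by (intro mult_left_mono nn_integral_dilate Gm True) auto
        finally show "(\<integral>\<^sup>+x. B x * B y * ennreal (G (y + t *\<^sub>R (x - y))) \<partial>lborel) \<le> B y * ?K" .
      qed
      finally show ?thesis unfolding V .
    next
      case False
      have "(\<integral>\<^sup>+x. \<integral>\<^sup>+y. B x * B y * ennreal (G (y + t *\<^sub>R (x - y))) \<partial>lborel \<partial>lborel)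
          \<le> (\<integral>\<^sup>+x. B x * ?K \<partial>lborel)"
      proof (rule nn_integral_mono)
        fix x :: 'a
        have "(\<integral>\<^sup>+y. B x * B y * ennreal (G (y + t *\<^sub>R (x - y))) \<partial>lborel)
           \<le> (\<integral>\<^sup>+y. B x * ennreal (G (t *\<^sub>R x + (1 - t) *\<^sub>R y)) \<partial>lborel)"
          by (rule nn_integral_mono) (auto simp: B_def indicator_def algebra_simps)
        also have "\<dots> = B x * (\<integral>\<^sup>+y. ennreal (G (t *\<^sub>R x + (1 - t) *\<^sub>R y)) \<partial>lborel)"
          by (rule nn_integral_cmult)
            (use measurable_compose[OF _ Gm, of "\<lambda>y. t *\<^sub>R x + (1 - t) *\<^sub>R y" lborel] in simp)
        also have "\<dots> \<le> B x * ?K"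
          using False by (intro mult_left_mono nn_integral_dilate Gm) auto
        finally show "(\<integral>\<^sup>+y. B x * B y * ennreal (G (y + t *\<^sub>R (x - y))) \<partial>lborel) \<le> B x * ?K" .
      qed
      then show ?thesis unfolding V .
    qed
  qed
  have "(\<integral>\<^sup>+x. \<integral>\<^sup>+y. B x * B y * ennreal \<bar>g x - g y\<bar> \<partial>lborel \<partial>lborel)
    \<le> (\<integral>\<^sup>+x. \<integral>\<^sup>+y. \<integral>\<^sup>+t. indicator {0..1} t * ennreal (2 * r) * (B x * B y * ennreal (G (y + t *\<^sub>R (x - y)))) \<partial>lborel \<partial>lborel \<partial>lborel)"
  proof (intro nn_integral_mono)
    fix x y :: 'a
    show "B x * B y * ennreal \<bar>g x - g y\<bar> \<le>
      (\<integral>\<^sup>+t. indicator {0..1} t * ennreal (2 * r) * (B x * B y * ennreal (G (y + t *\<^sub>R (x - y)))) \<partial>lborel)"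
    proof (cases "x \<in> cball 0 r \<and> y \<in> cball 0 r")
      case True
      then have "B x = 1" "B y = 1" by (auto simp: B_def)
      then show ?thesis
        using increment_le_integral[OF g, of x r y] True r
        by (simp add: G_def ennreal_mult sum_nonneg mult.assoc)
    qed (auto simp: B_def)
  qed
  also have "\<dots> = (\<integral>\<^sup>+x. \<integral>\<^sup>+t. \<integral>\<^sup>+y. indicator {0..1} t * ennreal (2 * r) * (B x * B y * ennreal (G (y + t *\<^sub>R (x - y)))) \<partial>lborel \<partial>lborel \<partial>lborel)"
    by (intro nn_integral_cong lborel_pair.Fubini') (simp cong: measurable_cong_sets sets_pair_measure_cong)
  also have "\<dots> = (\<integral>\<^sup>+t. \<integral>\<^sup>+x. \<integral>\<^sup>+y. indicator {0..1} t * ennreal (2 * r) * (B x * B y * ennreal (G (y + t *\<^sub>R (x - y)))) \<partial>lborel \<partial>lborel \<partial>lborel)"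
  proof (intro lborel_pair.Fubini')
    have z: "(\<lambda>p::(real \<times> 'a) \<times> 'a. snd p + fst (fst p) *\<^sub>R (snd (fst p) - snd p)) \<in> borel_measurable borel"
      by (intro borel_measurable_continuous_onI continuous_intros)
    have "(\<lambda>p::(real \<times> 'a) \<times> 'a. indicator {0..1} (fst (fst p)) * ennreal (2 * r) *
        (B (snd (fst p)) * B (snd p) * ennreal (G (snd p + fst (fst p) *\<^sub>R (snd (fst p) - snd p)))))
        \<in> borel_measurable borel"
      using measurable_compose[OF z Gm] by (simp add: borel_prod[symmetric])
    then have "(\<lambda>p. \<integral>\<^sup>+y. indicator {0..1} (fst p) * ennreal (2 * r) *
        (B (snd p) * B y * ennreal (G (y + fst p *\<^sub>R (snd p - y)))) \<partial>lborel)
        \<in> borel_measurable (borel \<Otimes>\<^sub>M borel)"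
      by (intro lborel.borel_measurable_nn_integral)
        (simp add: split_beta' borel_prod[symmetric] cong: measurable_cong_sets sets_pair_measure_cong)
    then show "(\<lambda>(t, x). \<integral>\<^sup>+y. indicator {0..1} t * ennreal (2 * r) *
        (B x * B y * ennreal (G (y + t *\<^sub>R (x - y)))) \<partial>lborel) \<in> borel_measurable (lborel \<Otimes>\<^sub>M lborel)"
      by (simp add: split_beta' cong: measurable_cong_sets sets_pair_measure_cong)
  qed
  also have "\<dots> = (\<integral>\<^sup>+t. indicator {0..1} t * ennreal (2 * r) * (\<integral>\<^sup>+x. \<integral>\<^sup>+y. (B x * B y * ennreal (G (y + t *\<^sub>R (x - y)))) \<partial>lborel \<partial>lborel) \<partial>lborel)"
    using lborel.borel_measurable_nn_integral_fst[OF sp]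
    by (intro nn_integral_cong) (simp add: nn_integral_cmult)
  also have "\<dots> \<le> (\<integral>\<^sup>+t. indicator {0..1::real} t * ennreal (2 * r) * (?K * ?V) \<partial>lborel)"
  proof (rule nn_integral_mono)
    fix t :: real
    show "indicator {0..1} t * ennreal (2 * r) * (\<integral>\<^sup>+x. \<integral>\<^sup>+y. (B x * B y * ennreal (G (y + t *\<^sub>R (x - y)))) \<partial>lborel \<partial>lborel)
      \<le> indicator {0..1} t * ennreal (2 * r) * (?K * ?V)"
      using J[of t] by (intro mult_left_mono) auto
  qed
  also have "\<dots> = ennreal (2 * r) * (?K * ?V)"
    by (simp add: nn_integral_multc mult.assoc)
  also have "\<dots> = ennreal (2 * r * 2 ^ DIM('a)) * emeasure lborel (cball (0::'a) r) * (\<integral>\<^sup>+z. ennreal (G z) \<partial>lborel)"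
    using r by (simp add: ennreal_mult mult_ac)
  finally show ?thesis .
qed

lemma ball_integrable:
  fixes f :: "'a::euclidean_space \<Rightarrow> real"
  assumes "continuous_on UNIV f"
  shows "integrable lborel (\<lambda>x. indicator (cball 0 r) x * f x)"
  using borel_integrable_compact[of "cball (0::'a) r" f] continuous_on_subset[OF assms]
  by auto

text \<open>
For \<open>k\<close> of mean zero, \<open>vol(B) \<integral> k g\<close> is the double integral of \<open>k(x) (g(x) - g(y))\<close> over \<open>B \<times> B\<close>.
\<close>

lemma mean_zero_pairing_L1:
  fixes g k :: "'a::euclidean_space \<Rightarrow> real"
  assumes g: "smooth g" and r: "r > 0" and k: "continuous_on UNIV k"
    and supp: "\<And>x. r < norm x \<Longrightarrow> k x = 0" and m: "\<And>x. \<bar>k x\<bar> \<le> m"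
    and mean: "(LBINT x. k x) = 0"
  shows "\<bar>LBINT x. k x * g x\<bar> \<le>
    m * (2 * r * 2 ^ DIM('a)) * (LBINT x. indicator (cball 0 r) x * (\<Sum>b\<in>Basis. \<bar>pd b g x\<bar>))"
proof -
  let ?B = "cball (0::'a) r"
  define V where "V = measure lborel ?B"
  have V: "V > 0" unfolding V_def using r by (simp add: content_cball_pos)
  have eV: "emeasure lborel ?B = ennreal V" unfolding V_def
    by (rule emeasure_eq_ennreal_measure) (use emeasure_lborel_cball_finite[of "0::'a" r] in \<open>simp add: less_top\<close>)
  have gc: "continuous_on UNIV g" by (rule smooth_continuous[OF g])
  define I where "I = (LBINT y. indicator ?B y * g y)"
  define T where "T x = (LBINT y. k x * (indicator ?B y * (g x - g y)))" for x
  have csk: "csupp k" using supp by (auto simp: csupp_def)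
  have T: "T x = V * (k x * g x) - I * k x" for x
  proof -
    have i1: "integrable lborel (\<lambda>y. indicator ?B y * g x)" by (rule ball_integrable) auto
    have i2: "integrable lborel (\<lambda>y. indicator ?B y * g y)" by (rule ball_integrable[OF gc])
    have "T x = k x * (LBINT y. indicator ?B y * g x - indicator ?B y * g y)"
      by (simp add: T_def right_diff_distrib[symmetric])
    also have "\<dots> = k x * (V * g x - I)"
      using i1 i2 by (subst Bochner_Integration.integral_diff) (auto simp: I_def V_def)
    finally show ?thesis by (simp add: algebra_simps)
  qed
  have ikg: "integrable lborel (\<lambda>x. k x * g x)" "integrable lborel k"
    using k gc csk by (auto intro!: cc_integrable continuous_intros)
  then have Ti: "integrable lborel T" "(LBINT x. T x) = V * (LBINT x. k x * g x)"
    unfolding T[abs_def] using mean by auto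
  have m0: "0 \<le> m" using m[of 0] by linarith
  define G where "G z = indicator ?B z * (\<Sum>b\<in>Basis. \<bar>pd b g z\<bar>)" for z
  have "continuous_on UNIV (\<lambda>z. \<Sum>b\<in>Basis. \<bar>pd b g z\<bar>)"
    by (intro continuous_intros smooth_continuous smooth_pd g)
  then have Gi: "integrable lborel G" unfolding G_def[abs_def] by (rule ball_integrable)
  have G0: "G z \<ge> 0" for z by (simp add: G_def sum_nonneg)
  have "ennreal \<bar>LBINT x. T x\<bar> \<le> (\<integral>\<^sup>+x. ennreal \<bar>T x\<bar> \<partial>lborel)"
    using integral_norm_bound_ennreal[OF Ti(1)] by simp
  also have "\<dots> \<le> (\<integral>\<^sup>+x. \<integral>\<^sup>+y. ennreal m * (indicator ?B x * indicator ?B y * ennreal \<bar>g x - g y\<bar>) \<partial>lborel \<partial>lborel)"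
  proof (rule nn_integral_mono)
    fix x
    have i: "integrable lborel (\<lambda>y. k x * (indicator ?B y * (g x - g y)))"
      using gc by (intro integrable_mult_right ball_integrable continuous_intros)
    have "ennreal \<bar>T x\<bar> \<le> (\<integral>\<^sup>+y. ennreal \<bar>k x * (indicator ?B y * (g x - g y))\<bar> \<partial>lborel)"
      using integral_norm_bound_ennreal[OF i] by (simp add: T_def)
    also have "\<dots> \<le> (\<integral>\<^sup>+y. ennreal m * (indicator ?B x * indicator ?B y * ennreal \<bar>g x - g y\<bar>) \<partial>lborel)"
    proof (rule nn_integral_mono)
      fix y
      show "ennreal \<bar>k x * (indicator ?B y * (g x - g y))\<bar> \<le>
         ennreal m * (indicator ?B x * indicator ?B y * ennreal \<bar>g x - g y\<bar>)"
      proof (cases "x \<in> ?B \<and> y \<in> ?B")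
        case True
        then have "\<bar>k x * (indicator ?B y * (g x - g y))\<bar> \<le> m * \<bar>g x - g y\<bar>"
          using m[of x] by (simp add: abs_mult mult_right_mono)
        then show ?thesis using True m0 by (simp add: ennreal_mult[symmetric] ennreal_leI)
      next
        case False
        then have "k x * (indicator ?B y * (g x - g y)) = 0"
          using supp[of x] by (auto simp: not_le)
        then show ?thesis by (simp only: abs_zero ennreal_0 zero_le)
      qed
    qed
    finally show "ennreal \<bar>T x\<bar> \<le> (\<integral>\<^sup>+y. ennreal m * (indicator ?B x * indicator ?B y * ennreal \<bar>g x - g y\<bar>) \<partial>lborel)" .
  qed
  also have "\<dots> = ennreal m * (\<integral>\<^sup>+x. \<integral>\<^sup>+y. indicator ?B x * indicator ?B y * ennreal \<bar>g x - g y\<bar> \<partial>lborel \<partial>lborel)"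
  proof -
    have c: "(\<lambda>p. \<bar>g (fst p) - g (snd p)\<bar>) \<in> borel_measurable borel"
      by (intro continuous_borel continuous_intros continuous_on_compose2[OF gc]) auto
    have "(\<lambda>p. indicator ?B (fst p) * indicator ?B (snd p) * ennreal \<bar>g (fst p) - g (snd p)\<bar>) \<in> borel_measurable (borel \<Otimes>\<^sub>M borel)"
      using c unfolding borel_prod[symmetric]
      by (intro borel_measurable_times_ennreal measurable_compose[OF _ measurable_ennreal]
          measurable_compose[OF measurable_fst borel_measurable_indicator]
          measurable_compose[OF measurable_snd borel_measurable_indicator]) auto
    then have p: "(\<lambda>p. indicator ?B (fst p) * indicator ?B (snd p) * ennreal \<bar>g (fst p) - g (snd p)\<bar>) \<in> borel_measurable (lborel \<Otimes>\<^sub>M lborel)"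
      by (simp cong: measurable_cong_sets sets_pair_measure_cong)
    have q: "(\<lambda>y. indicator ?B x * indicator ?B y * ennreal \<bar>g x - g y\<bar>) \<in> borel_measurable lborel" for x
      using measurable_compose[OF measurable_Pair1'[of x] p] by simp
    show ?thesis
      using lborel.borel_measurable_nn_integral_fst[OF p] q by (simp add: nn_integral_cmult)
  qed
  also have "\<dots> \<le> ennreal m * (ennreal (2 * r * 2 ^ DIM('a)) * ennreal V * (\<integral>\<^sup>+z. ennreal (G z) \<partial>lborel))"
    using double_difference_le[OF g, of r] r unfolding eV G_def[symmetric] by (intro mult_left_mono) auto
  also have "\<dots> = ennreal (m * (2 * r * 2 ^ DIM('a) * V * (LBINT z. G z)))"
    using m0 r V G0 by (simp add: nn_integral_eq_integral[OF Gi] ennreal_mult integral_nonneg)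
  finally have "V * \<bar>LBINT x. k x * g x\<bar> \<le> m * (2 * r * 2 ^ DIM('a) * V * (LBINT z. G z))"
    using m0 r V G0 by (subst (asm) ennreal_le_iff) (auto simp: Ti abs_mult intro!: mult_nonneg_nonneg integral_nonneg)
  also have "\<dots> = V * (m * (2 * r * 2 ^ DIM('a)) * (LBINT z. G z))" by (simp add: mult_ac)
  finally show ?thesis using V unfolding G_def by simp
qed

lemma ball_bounded:
  fixes f :: "'a::euclidean_space \<Rightarrow> real"
  assumes "continuous_on UNIV f"
  obtains L where "L \<ge> 0" "\<And>x. norm x \<le> r \<Longrightarrow> \<bar>f x\<bar> \<le> L"
proof -
  have "compact (f ` cball 0 r)"
    by (intro compact_continuous_image continuous_on_subset[OF assms]) auto
  then obtain C where C: "\<forall>y\<in>f ` cball 0 r. norm y \<le> C"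
    using compact_imp_bounded bounded_iff by metis
  then have "norm x \<le> r \<Longrightarrow> \<bar>f x\<bar> \<le> max C 0" for x by force
  then show ?thesis using that[of "max C 0"] by auto
qed

lemma ball_uniformly_continuous:
  fixes f :: "'a::euclidean_space \<Rightarrow> real"
  assumes "continuous_on UNIV f" "w > 0"
  obtains \<epsilon> where "0 < \<epsilon>" "\<epsilon> \<le> 1" "\<And>x y. norm y \<le> s \<Longrightarrow> norm (x - y) \<le> \<epsilon> \<Longrightarrow> \<bar>f x - f y\<bar> \<le> w"
proof -
  have "uniformly_continuous_on (cball 0 (s + 1)) f"
    by (intro compact_uniformly_continuous continuous_on_subset[OF assms(1)]) auto
  then obtain d where d: "d > 0" "\<And>x y. x \<in> cball 0 (s+1) \<Longrightarrow> y \<in> cball 0 (s+1) \<Longrightarrow> dist x y < d \<Longrightarrow> dist (f x) (f y) < w"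
    using assms(2) unfolding uniformly_continuous_on_def by metis
  define e where "e = min 1 (d / 2)"
  have "\<bar>f x - f y\<bar> \<le> w" if "norm y \<le> s" "norm (x - y) \<le> e" for x y
  proof -
    have "norm x \<le> norm y + norm (x - y)" using norm_triangle_ineq[of y "x - y"] by simp
    then show ?thesis
      using d(2)[of x y] that d(1) by (auto simp: dist_norm dist_real_def e_def min_def split: if_splits)
  qed
  then show ?thesis using that[of e] d by (auto simp: e_def)
qed

context
  fixes U :: "'a::euclidean_space \<Rightarrow> real"
  assumes U: "smooth U"
begin

text \<open>
The previous bound for \<open>g = \<phi> / \<theta>\<close> and \<open>k \<theta>\<close> in the place of \<open>k\<close>; orthogonality to the ground state
is the mean zero condition, and \<open>\<theta> \<partial>\<^sub>b g = D\<^sub>b \<phi>\<close>. The constant depends on the ball, but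
it is fixed before any of the other parameters.
\<close>

lemma mean_zero_pairing:
  assumes k: "test_function k" and r: "r > 0" and supp: "\<And>x. r < norm x \<Longrightarrow> k x = 0"
    and mean: "ip k (ground U) = 0"
  obtains C where "C \<ge> 0" "\<And>\<phi>. smooth \<phi> \<Longrightarrow>
    (ip k \<phi>)\<^sup>2 \<le> C * (\<Sum>b\<in>Basis. (LBINT x. indicator (cball 0 r) x * (Dw U b \<phi> x)\<^sup>2))"
proof -
  let ?k = "\<lambda>x. k x * ground U x"
  have tk: "test_function ?k" by (intro tf_mult1 k smooth_ground U)
  obtain m where m: "m \<ge> 0" "\<And>x. \<bar>?k x\<bar> \<le> m"
    using cc_bounded[OF tf_cont[OF tk] tf_csupp[OF tk]] by metis
  have sE: "smooth (\<lambda>x. exp (U x / 2))" using U by (intro smooth_exp_compose smooth_divide)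
  obtain L where L: "L \<ge> 0" "\<And>x. norm x \<le> r \<Longrightarrow> \<bar>exp (U x / 2)\<bar> \<le> L"
    using ball_bounded[OF smooth_continuous[OF sE], of r] by metis
  define V where "V = measure lborel (cball (0::'a) r)"
  define c where "c = m * (2 * r * 2 ^ DIM('a))"
  show ?thesis
  proof
    show "0 \<le> c\<^sup>2 * (DIM('a) * (V * L\<^sup>2))" by (simp add: V_def)
    fix \<phi> :: "'a \<Rightarrow> real" assume \<phi>: "smooth \<phi>"
    define g where "g x = exp (U x / 2) * \<phi> x" for x
    have g: "smooth g" unfolding g_def[abs_def] by (intro smooth_mult sE \<phi>)
    have pg: "pd b g x = exp (U x / 2) * Dw U b \<phi> x" for b x
      unfolding g_def[abs_def] pd_smooth_mult[OF sE \<phi>] pd_smooth_exp[OF smooth_divide[OF U]]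
        pd_smooth_divide[OF U] by (simp add: Dw_def algebra_simps)
    have "(\<lambda>x. ?k x * g x) = (\<lambda>x. k x * \<phi> x)"
      by (simp add: fun_eq_iff g_def ground_def exp_minus field_simps)
    then have "\<bar>ip k \<phi>\<bar> \<le> c * (LBINT x. indicator (cball 0 r) x * (\<Sum>b\<in>Basis. \<bar>pd b g x\<bar>))"
      using mean_zero_pairing_L1[OF g r tf_cont[OF tk] _ m(2)] supp mean
      by (simp only: ip_def c_def)
    moreover
    let ?J = "\<lambda>b. (LBINT x. indicator (cball 0 r) x * \<bar>pd b g x\<bar>)"
    let ?D = "\<lambda>b. (LBINT x. indicator (cball 0 r) x * (Dw U b \<phi> x)\<^sup>2)"
    have "(LBINT x. indicator (cball 0 r) x * (\<Sum>b\<in>Basis. \<bar>pd b g x\<bar>)) = (\<Sum>b\<in>Basis. ?J b)"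
      unfolding sum_distrib_left
      by (intro Bochner_Integration.integral_sum ball_integrable continuous_intros smooth_continuous smooth_pd g)
    ultimately have "\<bar>ip k \<phi>\<bar> \<le> c * (\<Sum>b\<in>Basis. ?J b)" by simp
    then have "(ip k \<phi>)\<^sup>2 \<le> (c * (\<Sum>b\<in>Basis. ?J b))\<^sup>2"
      unfolding abs_le_square_iff[symmetric] by (rule order_trans[OF _ abs_ge_self])
    also have "\<dots> \<le> c\<^sup>2 * ((\<Sum>b\<in>Basis. (?J b)\<^sup>2) * DIM('a))"
      unfolding power_mult_distrib by (intro mult_left_mono sum_squared_le_sum_of_squares) auto
    also have "\<dots> \<le> c\<^sup>2 * ((\<Sum>b\<in>Basis. V * L\<^sup>2 * ?D b) * DIM('a))"
    proof (intro mult_left_mono mult_right_mono sum_mono)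
      fix b :: 'a assume b: "b \<in> Basis"
      let ?i = "indicator (cball (0::'a) r) :: 'a \<Rightarrow> real"
      have cg: "continuous_on UNIV (pd b g)" and cD: "continuous_on UNIV (Dw U b \<phi>)"
        using b by (auto intro!: smooth_continuous smooth_pd g smooth_Dw U \<phi>)
      have e: "(?i x)\<^sup>2 = ?i x * 1" "(?i x * \<bar>pd b g x\<bar>)\<^sup>2 = ?i x * (pd b g x)\<^sup>2"
         "?i x * (?i x * \<bar>pd b g x\<bar>) = ?i x * \<bar>pd b g x\<bar>" for x
        by (auto simp: indicator_def)
      have "(?J b)\<^sup>2 \<le> (LBINT x. ?i x * 1) * (LBINT x. ?i x * (pd b g x)\<^sup>2)"
        by (rule integral_square_le[of lborel ?i "\<lambda>x. ?i x * \<bar>pd b g x\<bar>", unfolded e])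
          (intro ball_integrable continuous_intros cg)+
      also have "\<dots> \<le> V * (LBINT x. L\<^sup>2 * (?i x * (Dw U b \<phi> x)\<^sup>2))"
      proof (rule mult_mono[OF _ integral_mono])
        fix x
        show "?i x * (pd b g x)\<^sup>2 \<le> L\<^sup>2 * (?i x * (Dw U b \<phi> x)\<^sup>2)"
        proof (cases "norm x \<le> r")
          case True
          then have "(exp (U x / 2))\<^sup>2 \<le> L\<^sup>2" using L(2)[of x] by (intro power_mono) auto
          then show ?thesis using True by (simp add: pg power_mult_distrib mult_right_mono)
        qed (auto simp: indicator_def)
      qed (use cg cD in \<open>auto simp: V_def intro!: ball_integrable integrable_mult_right continuous_intros\<close>)
      also have "\<dots> = V * L\<^sup>2 * ?D b" by simp
      finally show "(?J b)\<^sup>2 \<le> V * L\<^sup>2 * ?D b" .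
    qed auto
    also have "\<dots> = c\<^sup>2 * (DIM('a) * (V * L\<^sup>2)) * (\<Sum>b\<in>Basis. ?D b)"
      by (simp add: sum_distrib_left[symmetric] mult_ac)
    finally show "(ip k \<phi>)\<^sup>2 \<le> c\<^sup>2 * (DIM('a) * (V * L\<^sup>2)) * (\<Sum>b\<in>Basis. ?D b)" .
  qed
qed

end

section \<open>Mollification and the energy estimate\<close>

lemma correlate_nonneg_abs_bound:
  assumes \<rho>: "continuous_on UNIV \<rho>" "\<And>y. 0 \<le> \<rho> y" and F: "continuous_on UNIV F" "csupp F"
    and G: "continuous_on UNIV G" "csupp G" and le: "\<And>y. \<rho> y \<noteq> 0 \<Longrightarrow> \<bar>G (x + y)\<bar> \<le> F (x + y)"
  shows "\<bar>correlate \<rho> G x\<bar> \<le> correlate \<rho> F x"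
proof -
  have "\<bar>correlate \<rho> G x\<bar> \<le> (LBINT y. \<bar>\<rho> y * G (x + y)\<bar>)" unfolding correlate_def
    by (rule integral_abs_bound)
  also have "\<dots> \<le> correlate \<rho> F x" unfolding correlate_def
  proof (rule integral_mono)
    show "\<bar>\<rho> y * G (x + y)\<bar> \<le> \<rho> y * F (x + y)" for y
      using \<rho>(2)[of y] le[of y] by (cases "\<rho> y = 0") (auto simp: abs_mult mult_left_mono)
  qed (auto intro!: correlate_integrable integrable_abs \<rho> F G)
  finally show ?thesis .
qed

context
  fixes U :: "'a::euclidean_space \<Rightarrow> real"
  assumes U: "smooth U"
begin

text \<open>
Correlation commutes with the Laplacian, so the error comes from the potential alone.
\<close>

lemma Hw_correlate_commutator:
  assumes \<rho>: "continuous_on UNIV \<rho>" "csupp \<rho>" and F: "test_function F"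
  shows "Hw U (correlate \<rho> F) x = correlate \<rho> (Hw U F) x + correlate \<rho> (\<lambda>z. (Vw U x - Vw U z) * F z) x"
proof -
  have tF: "test_function (pd b (pd b F))" if "b \<in> Basis" for b using that F by (intro tf_pd)
  then have tG: "test_function (\<lambda>z. - (\<Sum>b\<in>Basis. pd b (pd b F) z))" by (intro tf_minus tf_sum)
  note c = tf_cont[OF F] tf_csupp[OF F]
  have i1: "integrable lborel (\<lambda>y. \<rho> y * (- (\<Sum>b\<in>Basis. pd b (pd b F) (x + y))))"
    by (rule correlate_integrable[OF \<rho>(1) tf_cont[OF tG] tf_csupp[OF tG]])
  have i2: "integrable lborel (\<lambda>y. \<rho> y * (Vw U (x + y) * F (x + y)))"
    using tf_mult2[OF smooth_Vw[OF U] F]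
    by (intro correlate_integrable[OF \<rho>(1), of "\<lambda>z. Vw U z * F z" x] tf_cont tf_csupp)
  have i3: "integrable lborel (\<lambda>y. \<rho> y * ((Vw U x - Vw U (x + y)) * F (x + y)))"
    using tf_mult2[OF smooth_diff[OF smooth_const smooth_Vw[OF U]] F]
    by (intro correlate_integrable[OF \<rho>(1), of "\<lambda>z. (Vw U x - Vw U z) * F z" x] tf_cont tf_csupp)
  have "correlate \<rho> (Hw U F) x + correlate \<rho> (\<lambda>z. (Vw U x - Vw U z) * F z) x =
     (LBINT y. \<rho> y * (- (\<Sum>b\<in>Basis. pd b (pd b F) (x + y))) + \<rho> y * (Vw U (x + y) * F (x + y)))
      + (LBINT y. \<rho> y * ((Vw U x - Vw U (x + y)) * F (x + y)))"
    unfolding correlate_def by (simp only: Hw_Schroedinger[OF U tf_smooth[OF F]] distrib_left)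
  also have "\<dots> = (LBINT y. \<rho> y * (- (\<Sum>b\<in>Basis. pd b (pd b F) (x + y))) + \<rho> y * (Vw U (x + y) * F (x + y))
      + \<rho> y * ((Vw U x - Vw U (x + y)) * F (x + y)))"
    by (rule Bochner_Integration.integral_add[symmetric]) (intro Bochner_Integration.integrable_add i1 i2, rule i3)
  also have "\<dots> = (LBINT y. (- (\<Sum>b\<in>Basis. \<rho> y * pd b (pd b F) (x + y))) + Vw U x * (\<rho> y * F (x + y)))"
    by (rule Bochner_Integration.integral_cong[OF refl]) (simp add: algebra_simps sum_distrib_left)
  also have "\<dots> = - (\<Sum>b\<in>Basis. correlate \<rho> (pd b (pd b F)) x) + Vw U x * correlate \<rho> F x"
    using correlate_integrable[OF \<rho>(1) tf_cont[OF tF] tf_csupp[OF tF], of _ x]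
      correlate_integrable[OF \<rho>(1) c, of x]
    unfolding correlate_def by (simp add: Bochner_Integration.integral_sum)
  also have "\<dots> = Hw U (correlate \<rho> F) x"
    using F by (simp add: Hw_Schroedinger[OF U smooth_correlate[OF \<rho>(1) F]] pd_correlate[OF \<rho>(1)] tf_pd)
  finally show ?thesis ..
qed

text \<open>
Caccioppoli estimate for a mollified function. With \<open>p = \<rho> * \<psi>\<close>, test \<open>\<psi>\<close> against \<open>H v\<close> for
\<open>v = \<rho> * (\<chi>\<^sup>2 p)\<close>. Moving the outer mollifier to \<open>\<psi>\<close> turns \<open>\<langle>\<psi>, H v\<rangle>\<close> into
\<open>\<Sum>\<^sub>b \<langle>D\<^sub>b p, D\<^sub>b (\<chi>\<^sup>2 p)\<rangle>\<close> up to the commutator with the potential, and the latter sum controls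
\<open>\<integral> \<chi>\<^sup>2 \<bar>D p\<bar>\<^sup>2\<close> up to \<open>\<integral> \<bar>\<nabla>\<chi>\<bar>\<^sup>2 p\<^sup>2\<close>. The commutator is bounded by the oscillation \<open>w\<close> of the potential
at the scale of the mollifier. All errors are multiples of \<open>\<parallel>\<psi>\<parallel>\<^sup>2\<close>, uniformly over test functions \<open>\<psi>\<close>.
\<close>

lemma mollified_energy:
  fixes R c :: real
  assumes \<rho>: "test_function \<rho>" "\<And>y. 0 \<le> \<rho> y" "\<And>y. \<rho> (- y) = \<rho> y" "(LBINT y. \<rho> y) = 1"
    and \<epsilon>: "\<And>y. \<epsilon> < norm y \<Longrightarrow> \<rho> y = 0"
    and R: "R > 0" and w: "w \<ge> 0" "\<And>x y. norm y \<le> 2 * R \<Longrightarrow> norm (x - y) \<le> \<epsilon> \<Longrightarrow> \<bar>Vw U x - Vw U y\<bar> \<le> w"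
    and c: "\<And>b x. b \<in> Basis \<Longrightarrow> \<bar>pd b (bump R) (x::'a)\<bar> \<le> c"
    and \<psi>: "test_function \<psi>"
  defines "p \<equiv> correlate \<rho> \<psi>"
  defines "v \<equiv> correlate \<rho> (\<lambda>x. (bump R x)\<^sup>2 * p x)"
  shows "(\<Sum>b\<in>Basis. (LBINT x. (bump R x * Dw U b p x)\<^sup>2))
    \<le> 2 * ip \<psi> (Hw U v) + 2 * w * ip \<psi> \<psi> + 4 * DIM('a) * c\<^sup>2 * ip \<psi> \<psi>"
proof -
  define F where "F x = (bump R x)\<^sup>2 * p x" for x
  note \<rho>c = tf_cont[OF \<rho>(1)] tf_csupp[OF \<rho>(1)]
  note \<psi>c = tf_cont[OF \<psi>] tf_csupp[OF \<psi>]
  have p: "test_function p" unfolding p_def by (intro tf_correlate \<rho>c \<psi>)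
  have B2: "smooth (\<lambda>x::'a. (bump R x)\<^sup>2)" by (intro smooth_power2 bump_smooth)
  have F: "test_function F" unfolding F_def[abs_def] by (intro tf_mult2 B2 p)
  have v: "test_function v" unfolding v_def F_def[symmetric] by (intro tf_correlate \<rho>c F)
  note Fc = tf_cont[OF F] tf_csupp[OF F]
  have V: "continuous_on UNIV (Vw U)" by (intro smooth_continuous smooth_Vw U)
  define E where "E x = correlate \<rho> (\<lambda>z. (Vw U x - Vw U z) * F z) x" for x
  have Hv: "Hw U v x = correlate \<rho> (Hw U F) x + E x" for x
    unfolding v_def F_def[symmetric] E_def by (rule Hw_correlate_commutator[OF \<rho>c F])
  let ?Y = "correlate \<rho> (\<lambda>z. \<bar>F z\<bar>)"
  have Fa: "continuous_on UNIV (\<lambda>z. \<bar>F z\<bar>)" "csupp (\<lambda>z. \<bar>F z\<bar>)" using Fc by (auto intro: continuous_intros)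
  have Eb: "\<bar>E x\<bar> \<le> w * ?Y x" for x
  proof -
    have "\<bar>E x\<bar> \<le> correlate \<rho> (\<lambda>z. w * \<bar>F z\<bar>) x" unfolding E_def
    proof (rule correlate_nonneg_abs_bound)
      fix y assume y: "\<rho> y \<noteq> 0"
      then have y: "norm y \<le> \<epsilon>" using \<epsilon>[of y] by (meson not_le)
      show "\<bar>(Vw U x - Vw U (x + y)) * F (x + y)\<bar> \<le> w * \<bar>F (x + y)\<bar>"
      proof (cases "norm (x + y) \<le> 2 * R")
        case True
        then show ?thesis using w(2)[of "x + y" x] y by (simp add: abs_mult mult_right_mono)
      qed (simp add: F_def bump_outside[OF R])
    qed (use \<rho> \<rho>c Fc V in \<open>auto intro!: continuous_intros\<close>)
    then show ?thesis by (simp add: correlate_def mult.left_commute)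
  qed
  have rho1: "(LBINT y. \<bar>\<rho> y\<bar>) = 1" using \<rho> by simp
  have pp: "ip p p \<le> ip \<psi> \<psi>"
    using correlate_L2(2)[OF \<rho>c \<psi>c] by (simp add: ip_self p_def rho1)
  have FF: "ip F F \<le> ip \<psi> \<psi>"
  proof -
    have "(F x)\<^sup>2 \<le> (p x)\<^sup>2" for x
    proof -
      
      have "((bump R x)\<^sup>2)\<^sup>2 \<le> 1" by (intro power_le_one zero_le_power2 bump_bounds)
      then have "((bump R x)\<^sup>2)\<^sup>2 * (p x)\<^sup>2 \<le> 1 * (p x)\<^sup>2" by (intro mult_right_mono) auto
      then show ?thesis by (simp add: F_def power_mult_distrib)
    qed
    then have "ip F F \<le> ip p p" unfolding ip_self
      by (intro integral_mono square_integrable F p)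
    then show ?thesis using pp by simp
  qed
  have YY: "(LBINT x. (?Y x)\<^sup>2) \<le> ip \<psi> \<psi>"
    using correlate_L2(2)[OF \<rho>c Fa] FF by (simp add: rho1 ip_self)
  have Y2i: "integrable lborel (\<lambda>x. (?Y x)\<^sup>2)" by (rule correlate_L2(1)[OF \<rho>c Fa])
  have HFc: "test_function (Hw U F)" by (rule tf_Hw[OF U F])
  have i1: "integrable lborel (\<lambda>x. \<psi> x * correlate \<rho> (Hw U F) x)"
    by (rule correlate_pair(1)[OF \<rho>c tf_cont[OF HFc] tf_csupp[OF HFc] \<psi>c(1)])
  have i2: "integrable lborel (\<lambda>x. \<psi> x * Hw U v x)"
    by (intro ip_integrable(1) \<psi> tf_smooth tf_Hw U v)
  have i3: "integrable lborel (\<lambda>x. \<psi> x * E x)"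
    using Bochner_Integration.integrable_diff[OF i2 i1] by (simp add: Hv distrib_left)
  have "ip \<psi> (Hw U v) = ip \<psi> (correlate \<rho> (Hw U F)) + ip \<psi> E"
    unfolding ip_def using i1 i3 by (simp add: Hv distrib_left)
  moreover have "\<bar>ip \<psi> E\<bar> \<le> w * ip \<psi> \<psi>"
  proof -
    have "\<bar>ip \<psi> E\<bar> \<le> (LBINT x. \<bar>\<psi> x * E x\<bar>)" unfolding ip_def by (rule integral_abs_bound)
    also have "\<dots> \<le> (LBINT x. w * (1/2 * (\<psi> x)\<^sup>2 + 1/2 * (?Y x)\<^sup>2))"
    proof (rule integral_mono)
      fix x
      have "2 * (\<bar>\<psi> x\<bar> * ?Y x) \<le> (\<psi> x)\<^sup>2 + (?Y x)\<^sup>2"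
        using sum_squares_bound[of "\<bar>\<psi> x\<bar>" "?Y x"] by simp
      then have "w * (\<bar>\<psi> x\<bar> * ?Y x) \<le> w * (1/2 * (\<psi> x)\<^sup>2 + 1/2 * (?Y x)\<^sup>2)"
        using w by (intro mult_left_mono) auto
      moreover have "\<bar>\<psi> x * E x\<bar> \<le> \<bar>\<psi> x\<bar> * (w * ?Y x)"
        unfolding abs_mult using Eb by (intro mult_left_mono) auto
      ultimately show "\<bar>\<psi> x * E x\<bar> \<le> w * (1/2 * (\<psi> x)\<^sup>2 + 1/2 * (?Y x)\<^sup>2)" by (simp add: mult_ac)
    qed (use i3 Y2i square_integrable[OF \<psi>] in auto)
    also have "\<dots> = w * (1/2 * ip \<psi> \<psi> + 1/2 * (LBINT x. (?Y x)\<^sup>2))"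
      using Y2i square_integrable[OF \<psi>] by (simp add: ip_self)
    also have "\<dots> \<le> w * ip \<psi> \<psi>" using YY w by (intro mult_left_mono) auto
    finally show ?thesis .
  qed
  moreover have "ip \<psi> (correlate \<rho> (Hw U F)) = ip p (Hw U F)"
    unfolding ip_def p_def by (rule correlate_selfadjoint[OF \<rho>c \<rho>(3) tf_cont[OF HFc] tf_csupp[OF HFc] \<psi>c])
  moreover have "ip p (Hw U F) = (\<Sum>b\<in>Basis. ip (Dw U b p) (Dw U b F))"
    by (rule ip_Hw1[OF U p tf_smooth[OF F]])
  moreover have "1/2 * (LBINT x. (bump R x * Dw U b p x)\<^sup>2) - 2 * c\<^sup>2 * ip \<psi> \<psi> \<le> ip (Dw U b p) (Dw U b F)"
    if b: "b \<in> Basis" for b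
  proof -
    have DF: "Dw U b F x = (bump R x)\<^sup>2 * Dw U b p x + 2 * bump R x * pd b (bump R) x * p x" for x
    proof -
      have "pd b (\<lambda>x. (bump R x)\<^sup>2) x = 2 * bump R x * pd b (bump R) x"
        unfolding power2_eq_square pd_smooth_mult[OF bump_smooth bump_smooth] by simp
      then show ?thesis unfolding F_def[abs_def] Dw_mult[OF U B2 tf_smooth[OF p]] by simp
    qed
    have t: "test_function (\<lambda>x. bump R x * Dw U b p x)"
      by (intro tf_mult2 bump_smooth tf_Dw U p b)
    have "1/2 * (LBINT x. (bump R x * Dw U b p x)\<^sup>2) - 2 * c\<^sup>2 * ip \<psi> \<psi>
      \<le> 1/2 * (LBINT x. (bump R x * Dw U b p x)\<^sup>2) - 2 * c\<^sup>2 * ip p p"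
      using pp by (simp add: mult_left_mono)
    also have "\<dots> = (LBINT x. 1/2 * (bump R x * Dw U b p x)\<^sup>2 - 2 * c\<^sup>2 * (p x)\<^sup>2)"
      unfolding ip_self using square_integrable[OF t] square_integrable[OF p] by simp
    also have "\<dots> \<le> ip (Dw U b p) (Dw U b F)" unfolding ip_def
    proof (rule integral_mono)
      fix x
      let ?s = "bump R x * Dw U b p x" and ?t = "pd b (bump R) x * p x"
      have "0 \<le> (?s + 2 * ?t)\<^sup>2" by simp
      then have 1: "1/2 * ?s\<^sup>2 - 2 * ?t\<^sup>2 \<le> ?s\<^sup>2 + 2 * ?s * ?t" by (simp add: power2_eq_square algebra_simps)
      have "(pd b (bump R) x)\<^sup>2 \<le> c\<^sup>2" using c[OF b, of x] abs_le_square_iff[of "pd b (bump R) x" c] by linarith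
      then have "?t\<^sup>2 \<le> c\<^sup>2 * (p x)\<^sup>2" by (simp add: power_mult_distrib mult_right_mono)
      with 1 have "1/2 * ?s\<^sup>2 - 2 * c\<^sup>2 * (p x)\<^sup>2 \<le> ?s\<^sup>2 + 2 * ?s * ?t" by linarith
      also have "\<dots> = Dw U b p x * Dw U b F x" by (simp add: DF power2_eq_square algebra_simps)
      finally show "1/2 * ?s\<^sup>2 - 2 * c\<^sup>2 * (p x)\<^sup>2 \<le> Dw U b p x * Dw U b F x" .
    qed (use square_integrable[OF t] square_integrable[OF p] b in
        \<open>auto intro!: ip_integrable(1) tf_Dw U p tf_smooth F\<close>)
    finally show ?thesis .
  qed
  then have "(\<Sum>b\<in>Basis. 1/2 * (LBINT x. (bump R x * Dw U b p x)\<^sup>2) - 2 * c\<^sup>2 * ip \<psi> \<psi>)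
     \<le> (\<Sum>b\<in>Basis. ip (Dw U b p) (Dw U b F))" by (rule sum_mono)
  then have "1/2 * (\<Sum>b\<in>Basis. (LBINT x. (bump R x * Dw U b p x)\<^sup>2)) - DIM('a) * (2 * c\<^sup>2 * ip \<psi> \<psi>)
     \<le> (\<Sum>b\<in>Basis. ip (Dw U b p) (Dw U b F))" by (simp add: sum_subtractf sum_distrib_left)
  ultimately show ?thesis by (simp add: algebra_simps)
qed

text \<open>
The constant may be enormous, as it involves second derivatives of \<open>\<rho>\<close>. What counts is that it does
not depend on \<open>\<psi>\<close>: the orthogonality defect of \<open>\<psi>\<close> can be chosen after \<open>\<rho>\<close> and \<open>R\<close>.
\<close>

lemma Hw_mollified_bound:
  assumes \<rho>: "test_function \<rho>" and R: "R > 0"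
  obtains K where "K \<ge> 0" "\<And>\<psi>. test_function \<psi> \<Longrightarrow>
     (let v = correlate \<rho> (\<lambda>x. (bump R x)\<^sup>2 * correlate \<rho> \<psi> x) in ip (Hw U v) (Hw U v) \<le> K * ip \<psi> \<psi>)"
proof -
  note \<rho>c = tf_cont[OF \<rho>] tf_csupp[OF \<rho>]
  obtain s where s: "\<And>x. s < norm x \<Longrightarrow> \<rho> x = 0" using \<rho>c by (auto simp: csupp_def)
  obtain m where m: "m \<ge> 0" "\<And>x. norm x \<le> s + 2 * R \<Longrightarrow> \<bar>Vw U x\<bar> \<le> m"
    using ball_bounded[OF smooth_continuous[OF smooth_Vw[OF U]]] by metis
  define a where "a b = pd b (pd b \<rho>)" for b
  define A where "A b = (LBINT y. \<bar>a b y\<bar>)\<^sup>2" for b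
  define N where "N = (LBINT y. \<bar>\<rho> y\<bar>)\<^sup>2"
  define K where "K = 2 * DIM('a) * (\<Sum>b\<in>Basis. A b) + 2 * m\<^sup>2 * N"
  have K: "K \<ge> 0" by (auto simp: K_def A_def N_def intro!: sum_nonneg add_nonneg_nonneg mult_nonneg_nonneg)
  have "ip (Hw U v) (Hw U v) \<le> (K * N) * ip \<psi> \<psi>"
    if \<psi>: "test_function \<psi>" and v: "v = correlate \<rho> (\<lambda>x. (bump R x)\<^sup>2 * correlate \<rho> \<psi> x)" for \<psi> v
  proof -
    define F where "F x = (bump R x)\<^sup>2 * correlate \<rho> \<psi> x" for x
    have p: "test_function (correlate \<rho> \<psi>)" by (intro tf_correlate \<rho>c \<psi>)
    have F: "test_function F" unfolding F_def[abs_def] by (intro tf_mult2 smooth_power2 bump_smooth p)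
    note Fc = tf_cont[OF F] tf_csupp[OF F]
    have v: "v = correlate \<rho> F" by (simp add: v F_def[abs_def])
    have tv: "test_function v" unfolding v by (intro tf_correlate \<rho>c F)
    have ta: "test_function (a b)" if "b \<in> Basis" for b using that \<rho> unfolding a_def by (intro tf_pd)
    have Hv: "Hw U v x = - (\<Sum>b\<in>Basis. correlate (a b) F x) + Vw U x * correlate \<rho> F x" for x
    proof -
      have "pd b (pd b v) x = correlate (a b) F x" if b: "b \<in> Basis" for b
        unfolding v pd_correlate[OF \<rho>c(1) F b] pd_correlate[OF \<rho>c(1) tf_pd[OF F b] b]
          pd_correlate_kernel[OF \<rho> tf_pd[OF F b] b] pd_correlate_kernel[OF tf_pd[OF \<rho> b] F b] a_def by simp
      then show ?thesis by (simp add: Hw_Schroedinger[OF U tf_smooth[OF tv]]) (simp add: v)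
    qed
    have FF: "ip F F \<le> N * ip \<psi> \<psi>"
    proof -
      have "(F x)\<^sup>2 \<le> (correlate \<rho> \<psi> x)\<^sup>2" for x
      proof -
        
        have "((bump R x)\<^sup>2)\<^sup>2 \<le> 1" by (intro power_le_one zero_le_power2 bump_bounds)
        then have "((bump R x)\<^sup>2)\<^sup>2 * (correlate \<rho> \<psi> x)\<^sup>2 \<le> 1 * (correlate \<rho> \<psi> x)\<^sup>2" by (intro mult_right_mono) auto
        then show ?thesis by (simp add: F_def power_mult_distrib)
      qed
      then have "ip F F \<le> ip (correlate \<rho> \<psi>) (correlate \<rho> \<psi>)" unfolding ip_self
        by (intro integral_mono square_integrable F p)
      also have "\<dots> \<le> N * ip \<psi> \<psi>" unfolding ip_self N_def
        by (rule correlate_L2(2)[OF \<rho>c tf_cont[OF \<psi>] tf_csupp[OF \<psi>]])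
      finally show ?thesis .
    qed
    have ai: "integrable lborel (\<lambda>x. (correlate (a b) F x)\<^sup>2)" if "b \<in> Basis" for b
      by (rule correlate_L2(1)[OF tf_cont[OF ta[OF that]] tf_csupp[OF ta[OF that]] Fc])
    have ri: "integrable lborel (\<lambda>x. (correlate \<rho> F x)\<^sup>2)" by (rule correlate_L2(1)[OF \<rho>c Fc])
    have "ip (Hw U v) (Hw U v) \<le>
       (LBINT x. 2 * DIM('a) * (\<Sum>b\<in>Basis. (correlate (a b) F x)\<^sup>2) + 2 * m\<^sup>2 * (correlate \<rho> F x)\<^sup>2)"
      unfolding ip_self
    proof (rule integral_mono)
      fix x
      have 1: "(\<Sum>b\<in>Basis. correlate (a b) F x)\<^sup>2 \<le> (\<Sum>b\<in>Basis. (correlate (a b) F x)\<^sup>2) * DIM('a)"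
        by (rule sum_squared_le_sum_of_squares)
      have 2: "(Vw U x * correlate \<rho> F x)\<^sup>2 \<le> m\<^sup>2 * (correlate \<rho> F x)\<^sup>2"
      proof (cases "norm x \<le> s + 2 * R")
        case True
        then have "(Vw U x)\<^sup>2 \<le> m\<^sup>2" using m(2)[of x] abs_le_square_iff[of "Vw U x" m] m(1) by simp
        then show ?thesis by (simp add: power_mult_distrib mult_right_mono)
      next
        case False
        then have "correlate \<rho> F x = 0" by (intro correlate_outside[OF s, where s = "2 * R"]) (auto simp: F_def bump_outside[OF R])
        then show ?thesis by simp
      qed
      have "(Hw U v x)\<^sup>2 \<le> 2 * (\<Sum>b\<in>Basis. correlate (a b) F x)\<^sup>2 + 2 * (Vw U x * correlate \<rho> F x)\<^sup>2"
        using zero_le_power2[of "(\<Sum>b\<in>Basis. correlate (a b) F x) + Vw U x * correlate \<rho> F x"]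
        by (simp add: Hv power2_eq_square algebra_simps)
      also have "\<dots> \<le> 2 * DIM('a) * (\<Sum>b\<in>Basis. (correlate (a b) F x)\<^sup>2) + 2 * m\<^sup>2 * (correlate \<rho> F x)\<^sup>2"
        using 1 2 by (simp add: mult_ac)
      finally show "(Hw U v x)\<^sup>2 \<le> 2 * DIM('a) * (\<Sum>b\<in>Basis. (correlate (a b) F x)\<^sup>2) + 2 * m\<^sup>2 * (correlate \<rho> F x)\<^sup>2" .
    qed (use ai ri in \<open>auto intro!: square_integrable tf_Hw U tv\<close>)
    also have "\<dots> = 2 * DIM('a) * (\<Sum>b\<in>Basis. (LBINT x. (correlate (a b) F x)\<^sup>2)) + 2 * m\<^sup>2 * (LBINT x. (correlate \<rho> F x)\<^sup>2)"
      using ai ri by (simp add: Bochner_Integration.integral_sum)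
    also have "\<dots> \<le> 2 * DIM('a) * (\<Sum>b\<in>Basis. A b * ip F F) + 2 * m\<^sup>2 * (N * ip F F)"
      unfolding A_def N_def ip_self
      by (intro add_mono mult_left_mono sum_mono correlate_L2(2) Fc \<rho>c tf_cont tf_csupp ta) auto
    also have "\<dots> = K * ip F F" by (simp add: K_def sum_distrib_right[symmetric] algebra_simps)
    also have "\<dots> \<le> K * (N * ip \<psi> \<psi>)" by (intro mult_left_mono FF K)
    finally show ?thesis by (simp add: mult_ac)
  qed
  then show ?thesis using that[of "K * N"] K by (auto simp: Let_def N_def)
qed

end

section \<open>Density of the range\<close>

lemma correlate_close:
  assumes \<rho>: "test_function \<rho>" "\<And>y. 0 \<le> \<rho> y" "(LBINT y. \<rho> y) = 1"
    and k: "test_function k" and le: "\<And>y. \<rho> y \<noteq> 0 \<Longrightarrow> \<bar>k x - k (x + y)\<bar> \<le> t"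
  shows "\<bar>k x - correlate \<rho> k x\<bar> \<le> t"
proof -
  have i1: "integrable lborel (\<lambda>y. \<rho> y * k (x + y))"
    by (rule correlate_integrable[OF tf_cont[OF \<rho>(1)] tf_cont[OF k] tf_csupp[OF k]])
  have i2: "integrable lborel (\<lambda>y. \<rho> y * c)" for c
    using tf_integrable[OF \<rho>(1)] by simp
  have i3: "integrable lborel (\<lambda>y. \<rho> y * (k x - k (x + y)))"
    using Bochner_Integration.integrable_diff[OF i2[of "k x"] i1] by (simp add: right_diff_distrib)
  have "k x - correlate \<rho> k x = (LBINT y. \<rho> y * k x - \<rho> y * k (x + y))"
    using i1 i2[of "k x"] \<rho>(3) by (simp add: correlate_def)
  then have "\<bar>k x - correlate \<rho> k x\<bar> \<le> (LBINT y. \<bar>\<rho> y * (k x - k (x + y))\<bar>)"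
    by (simp add: right_diff_distrib[symmetric])
  also have "\<dots> \<le> (LBINT y. \<rho> y * t)"
  proof (rule integral_mono)
    show "\<bar>\<rho> y * (k x - k (x + y))\<bar> \<le> \<rho> y * t" for y
      using \<rho>(2)[of y] le[of y] by (cases "\<rho> y = 0") (auto simp: abs_mult mult_left_mono)
  qed (use i2 i3 in auto)
  also have "\<dots> = t" using \<rho>(3) by simp
  finally show ?thesis .
qed

context
  fixes U :: "'a::euclidean_space \<Rightarrow> real"
  assumes U: "smooth U"
begin

text \<open>
The quantitative Liouville property: a function that is orthogonal to the range of \<open>Hw U\<close> is a
multiple of the ground state. The parameters are chosen in the order ball radius \<open>r\<close>, cutoff radius
\<open>R\<close>, mollification scale \<open>\<epsilon>\<close>, defect \<open>\<delta>\<close>. Each of the last three contributes at most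
\<open>q = e\<^sup>2 / 12\<close> to \<open>(ip k p)\<^sup>2\<close>; replacing \<open>\<psi>\<close> by its mollification \<open>p\<close> costs another \<open>e / 2\<close>.
\<close>

lemma almost_orthogonal_to_range:
  assumes k: "test_function k" and mean: "ip k (ground U) = 0" and M: "M > 0" and e: "e > 0"
  obtains \<delta> where "\<delta> > 0"
    "\<And>\<psi>. test_function \<psi> \<Longrightarrow> ip \<psi> \<psi> \<le> M \<Longrightarrow>
      (\<And>v. test_function v \<Longrightarrow> (ip \<psi> (Hw U v))\<^sup>2 \<le> \<delta>\<^sup>2 * ip (Hw U v) (Hw U v)) \<Longrightarrow> \<bar>ip k \<psi>\<bar> \<le> e"
proof -
  obtain r0 where "\<And>x. r0 < norm x \<Longrightarrow> k x = 0" using tf_csupp[OF k] by (auto simp: csupp_def)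
  then obtain r where r: "r > 0" "\<And>x. r < norm x \<Longrightarrow> k x = 0"
    by (metis max.strict_boundedE zero_less_one max.strict_coboundedI2)
  obtain C0 where C0: "C0 \<ge> 0" "\<And>\<phi>. smooth \<phi> \<Longrightarrow>
    (ip k \<phi>)\<^sup>2 \<le> C0 * (\<Sum>b\<in>Basis. (LBINT x. indicator (cball 0 r) x * (Dw U b \<phi> x)\<^sup>2))"
    using mean_zero_pairing[OF U k r mean] by blast
  obtain c0 where c0: "c0 \<ge> 0" "\<And>R x b. R > 0 \<Longrightarrow> b \<in> Basis \<Longrightarrow> \<bar>pd b (bump R) (x::'a)\<bar> \<le> c0 / R"
    using bump_pd_bound by blast
  define C where "C = C0 * exp 1"
  have C: "C \<ge> 0" using C0 by (simp add: C_def)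
  define q where "q = e\<^sup>2 / 12"
  have q: "q > 0" using e by (simp add: q_def)
  \<comment> \<open>\<open>R\<close> is so large that the gradient of the cutoff contributes at most \<open>P / R\<^sup>2 \<le> q\<close>\<close>
  define P where "P = C * 4 * DIM('a) * c0\<^sup>2 * M"
  have P: "P \<ge> 0" using C M by (simp add: P_def)
  define R where "R = r + 1 + P / q"
  have R: "R > 0" "r \<le> R" "P \<le> q * R\<^sup>2"
  proof -
    have pq: "P / q \<ge> 0" using P q by simp
    show "R > 0" "r \<le> R" using r pq by (auto simp: R_def)
    have "1 \<le> R" "P / q \<le> R" using r pq by (auto simp: R_def)
    then have "P / q \<le> R * R" using mult_left_mono[of 1 R R] by linarith
    then show "P \<le> q * R\<^sup>2" using q by (simp add: field_simps power2_eq_square)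
  qed
  \<comment> \<open>oscillations tolerated at the mollification scale: \<open>w\<close> for the potential, \<open>t\<close> for \<open>k\<close>\<close>
  define w where "w = q / (2 * (C * M + 1))"
  have CM: "C * M \<ge> 0" using C M by simp
  have w: "w > 0" "C * (2 * w * M) \<le> q"
  proof -
    show "w > 0" using q CM by (simp add: w_def)
    have "C * (2 * w * M) = q * ((C * M) / (C * M + 1))" using CM by (simp add: w_def field_simps)
    also have "\<dots> \<le> q * 1" using q CM by (intro mult_left_mono) auto
    finally show "C * (2 * w * M) \<le> q" by simp
  qed
  obtain e1 where e1: "0 < e1" "e1 \<le> 1" "\<And>x y. norm y \<le> 2 * R \<Longrightarrow> norm (x - y) \<le> e1 \<Longrightarrow> \<bar>Vw U x - Vw U y\<bar> \<le> w"
    using ball_uniformly_continuous[OF smooth_continuous[OF smooth_Vw[OF U]] w(1)] by blast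
  define vol where "vol = measure lborel (cball (0::'a) (r + 1))"
  define t where "t = sqrt (q / (vol * M + 1))"
  have vM: "vol * M \<ge> 0" using M by (simp add: vol_def)
  have t: "t > 0" "t\<^sup>2 * vol * M \<le> q"
  proof -
    show "t > 0" using q vM by (simp add: t_def)
    have "t\<^sup>2 * vol * M = q * ((vol * M) / (vol * M + 1))" using q vM by (simp add: t_def field_simps)
    also have "\<dots> \<le> q * 1" using q vM by (intro mult_left_mono) auto
    finally show "t\<^sup>2 * vol * M \<le> q" by simp
  qed
  obtain e2 where e2: "0 < e2" "e2 \<le> 1" "\<And>x y. norm y \<le> r + 1 \<Longrightarrow> norm (x - y) \<le> e2 \<Longrightarrow> \<bar>k x - k y\<bar> \<le> t"
    using ball_uniformly_continuous[OF tf_cont[OF k] t(1)] by blast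
  define \<epsilon> where "\<epsilon> = min e1 e2"
  have \<epsilon>: "\<epsilon> > 0" "\<epsilon> \<le> e1" "\<epsilon> \<le> e2" "\<epsilon> \<le> 1" using e1 e2 by (auto simp: \<epsilon>_def)
  obtain \<rho> :: "'a \<Rightarrow> real" where \<rho>: "test_function \<rho>" "\<And>y. 0 \<le> \<rho> y" "\<And>y. \<rho> (- y) = \<rho> y"
    "(LBINT y. \<rho> y) = 1" "\<And>y. \<epsilon> < norm y \<Longrightarrow> \<rho> y = 0"
    using mollifier_exists[OF \<epsilon>(1)] by blast
  note \<rho>c = tf_cont[OF \<rho>(1)] tf_csupp[OF \<rho>(1)]
  have \<rho>e: "norm y \<le> \<epsilon>" if "\<rho> y \<noteq> 0" for y using \<rho>(5)[of y] that by (meson not_le)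
  obtain K where K: "K \<ge> 0" "\<And>\<psi>. test_function \<psi> \<Longrightarrow>
     (let v = correlate \<rho> (\<lambda>x. (bump R x)\<^sup>2 * correlate \<rho> \<psi> x) in ip (Hw U v) (Hw U v) \<le> K * ip \<psi> \<psi>)"
    using Hw_mollified_bound[OF U \<rho>(1) R(1)] by blast
  define S where "S = sqrt (K * M)"
  have S: "S \<ge> 0" "S\<^sup>2 = K * M" using K M by (auto simp: S_def)
  define \<delta> where "\<delta> = q / (2 * C * S + 1)"
  have CS: "C * S \<ge> 0" using C S by simp
  have \<delta>: "\<delta> > 0" "C * (2 * (\<delta> * S)) \<le> q"
  proof -
    show "\<delta> > 0" using q CS by (simp add: \<delta>_def)
    have "C * (2 * (\<delta> * S)) = q * ((2 * C * S) / (2 * C * S + 1))" by (simp add: \<delta>_def)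
    also have "\<dots> \<le> q * 1" using q CS by (intro mult_left_mono) auto
    finally show "C * (2 * (\<delta> * S)) \<le> q" by simp
  qed
  have "\<bar>ip k \<psi>\<bar> \<le> e" if \<psi>: "test_function \<psi>" and \<psi>M: "ip \<psi> \<psi> \<le> M"
    and orth: "\<And>v. test_function v \<Longrightarrow> (ip \<psi> (Hw U v))\<^sup>2 \<le> \<delta>\<^sup>2 * ip (Hw U v) (Hw U v)" for \<psi>
  proof -
    note \<psi>c = tf_cont[OF \<psi>] tf_csupp[OF \<psi>]
    define p where "p = correlate \<rho> \<psi>"
    define v where "v = correlate \<rho> (\<lambda>x. (bump R x)\<^sup>2 * p x)"
    have p: "test_function p" unfolding p_def by (intro tf_correlate \<rho>c \<psi>)
    have v: "test_function v" unfolding v_def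
      by (intro tf_correlate \<rho>c tf_mult2 smooth_power2 bump_smooth p)
    have Hv: "ip (Hw U v) (Hw U v) \<le> K * M"
      using K(2)[OF \<psi>] mult_left_mono[OF \<psi>M K(1)] by (simp add: Let_def v_def p_def)
    have "(ip \<psi> (Hw U v))\<^sup>2 \<le> \<delta>\<^sup>2 * (K * M)"
      using orth[OF v] mult_left_mono[OF Hv, of "\<delta>\<^sup>2"] by simp
    also have "\<dots> = (\<delta> * S)\<^sup>2" by (simp add: power_mult_distrib S(2))
    finally have pairing: "ip \<psi> (Hw U v) \<le> \<delta> * S"
      by (rule power2_le_imp_le) (use \<delta>(1) S(1) in simp)
    have "(\<Sum>b\<in>Basis. (LBINT x. (bump R x * Dw U b p x)\<^sup>2))
      \<le> 2 * ip \<psi> (Hw U v) + 2 * w * ip \<psi> \<psi> + 4 * DIM('a) * (c0 / R)\<^sup>2 * ip \<psi> \<psi>"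
      unfolding v_def p_def
    proof (rule mollified_energy[OF U \<rho> R(1)])
      show "norm y \<le> 2 * R \<Longrightarrow> norm (x - y) \<le> \<epsilon> \<Longrightarrow> \<bar>Vw U x - Vw U y\<bar> \<le> w" for x y
        using e1(3)[of y x] \<epsilon> by simp
    qed (use w c0 R \<psi> in auto)
    also have "\<dots> \<le> 2 * (\<delta> * S) + 2 * w * M + 4 * DIM('a) * (c0 / R)\<^sup>2 * M"
      using pairing \<psi>M w by (intro add_mono mult_left_mono) auto
    finally have energy: "(\<Sum>b\<in>Basis. (LBINT x. (bump R x * Dw U b p x)\<^sup>2))
      \<le> 2 * (\<delta> * S) + 2 * w * M + 4 * DIM('a) * (c0 / R)\<^sup>2 * M" .
    have "(ip k p)\<^sup>2 \<le> C0 * (\<Sum>b\<in>Basis. (LBINT x. indicator (cball 0 r) x * (Dw U b p x)\<^sup>2))"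
      by (rule C0(2)[OF tf_smooth[OF p]])
    also have "\<dots> \<le> C0 * (\<Sum>b\<in>Basis. exp 1 * (LBINT x. (bump R x * Dw U b p x)\<^sup>2))"
    proof (intro mult_left_mono sum_mono C0(1))
      fix b :: 'a assume b: "b \<in> Basis"
      have D: "test_function (Dw U b p)" by (intro tf_Dw U p b)
      have BD: "test_function (\<lambda>x. bump R x * Dw U b p x)" by (intro tf_mult2 bump_smooth D)
      have "(LBINT x. indicator (cball 0 r) x * (Dw U b p x)\<^sup>2)
        \<le> (LBINT x. exp 1 * (bump R x * Dw U b p x)\<^sup>2)"
      proof (rule integral_mono)
        show "indicator (cball 0 r) x * (Dw U b p x)\<^sup>2 \<le> exp 1 * (bump R x * Dw U b p x)\<^sup>2" for x
        proof (cases "norm x \<le> r")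
          case True
          then have "exp (- 1/2) \<le> bump R x" using R by (intro bump_ge) auto
          then have "(exp (- 1/2))\<^sup>2 \<le> (bump R x)\<^sup>2" by (intro power_mono) auto
          then have "exp 1 * (exp (-1/2))\<^sup>2 \<le> exp 1 * (bump R x)\<^sup>2" by (intro mult_left_mono) auto
          moreover have "exp 1 * (exp (-1/2::real))\<^sup>2 = 1" by (simp add: power2_eq_square exp_add[symmetric])
          ultimately have "1 \<le> exp 1 * (bump R x)\<^sup>2" by linarith
          then have "1 * (Dw U b p x)\<^sup>2 \<le> exp 1 * (bump R x)\<^sup>2 * (Dw U b p x)\<^sup>2" by (intro mult_right_mono) auto
          then show ?thesis using True by (simp add: power_mult_distrib mult.assoc)
        qed (auto simp: indicator_def)
        show "integrable lborel (\<lambda>x. indicator (cball 0 r) x * (Dw U b p x)\<^sup>2)"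
          by (intro ball_integrable continuous_intros tf_cont D)
        show "integrable lborel (\<lambda>x. exp 1 * (bump R x * Dw U b p x)\<^sup>2)"
          by (intro integrable_mult_right square_integrable BD)
      qed
      then show "(LBINT x. indicator (cball 0 r) x * (Dw U b p x)\<^sup>2)
        \<le> exp 1 * (LBINT x. (bump R x * Dw U b p x)\<^sup>2)" by simp
    qed
    also have "\<dots> = C * (\<Sum>b\<in>Basis. (LBINT x. (bump R x * Dw U b p x)\<^sup>2))"
      by (simp add: C_def sum_distrib_left mult_ac)
    also have "\<dots> \<le> C * (2 * (\<delta> * S) + 2 * w * M + 4 * DIM('a) * (c0 / R)\<^sup>2 * M)"
      by (intro mult_left_mono energy C)
    also have "\<dots> = C * (2 * (\<delta> * S)) + C * (2 * w * M) + P / R\<^sup>2"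
      by (simp add: P_def algebra_simps power_divide)
    also have "\<dots> \<le> q + q + q"
      using \<delta>(2) w(2) R by (intro add_mono) (auto simp: field_simps)
    finally have "(ip k p)\<^sup>2 \<le> (e / 2)\<^sup>2" by (simp add: q_def power_divide)
    then have 1: "\<bar>ip k p\<bar> \<le> e / 2" using e abs_le_square_iff[of "ip k p" "e/2"] by simp
    let ?a = "correlate \<rho> k"
    have a: "test_function ?a" by (intro tf_correlate \<rho>c k)
    have ka: "test_function (\<lambda>x. k x - ?a x)" by (intro tf_diff k a)
    have diff: "\<bar>k x - ?a x\<bar> \<le> indicator (cball 0 (r + 1)) x * t" for x
    proof (cases "norm x \<le> r + 1")
      case True
      have "\<bar>k x - ?a x\<bar> \<le> t"
      proof (rule correlate_close[OF \<rho>(1,2,4) k])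
        fix y assume "\<rho> y \<noteq> 0"
        then show "\<bar>k x - k (x + y)\<bar> \<le> t" using e2(3)[OF True, of "x + y"] \<rho>e[of y] \<epsilon> by (simp add: abs_minus_commute)
      qed
      then show ?thesis using True by simp
    next
      case False
      then have "k x = 0" using r(2)[of x] by simp
      moreover have "?a x = 0"
        by (rule correlate_outside[of \<epsilon> \<rho> r k x]) (use \<rho>(5) r(2) False \<epsilon> in auto)
      ultimately show ?thesis using t by (simp add: indicator_def)
    qed
    have "ip (\<lambda>x. k x - ?a x) (\<lambda>x. k x - ?a x) \<le> (LBINT x. indicator (cball (0::'a) (r + 1)) x * t\<^sup>2)"
      unfolding ip_self
    proof (rule integral_mono)
      show "(k x - ?a x)\<^sup>2 \<le> indicator (cball 0 (r + 1)) x * t\<^sup>2" for x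
        using diff[of x] power_mono[OF diff[of x], of 2] by (auto simp: indicator_def)
      show "integrable lborel (\<lambda>x::'a. indicator (cball 0 (r + 1)) x * t\<^sup>2)"
        by (intro ball_integrable continuous_on_const)
    qed (intro square_integrable ka)
    also have "\<dots> = t\<^sup>2 * vol" by (simp add: vol_def)
    finally have d2: "ip (\<lambda>x. k x - ?a x) (\<lambda>x. k x - ?a x) \<le> t\<^sup>2 * vol" .
    have "(ip (\<lambda>x. k x - ?a x) \<psi>)\<^sup>2 \<le> ip (\<lambda>x. k x - ?a x) (\<lambda>x. k x - ?a x) * ip \<psi> \<psi>"
      by (rule ip_Cauchy_Schwarz[OF ka \<psi>])
    also have "\<dots> \<le> (t\<^sup>2 * vol) * M"
      by (intro mult_mono d2 \<psi>M ip_self_nonneg) (simp add: vol_def)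
    also have "\<dots> \<le> 3 * q" using t(2) q by linarith
    also have "\<dots> = (e/2)\<^sup>2" by (simp add: q_def power_divide)
    finally have 2: "\<bar>ip (\<lambda>x. k x - ?a x) \<psi>\<bar> \<le> e / 2"
      using e abs_le_square_iff[of "ip (\<lambda>x. k x - ?a x) \<psi>" "e/2"] by simp
    have "ip k p = ip ?a \<psi>" unfolding ip_def p_def
      by (rule correlate_selfadjoint[OF \<rho>c \<rho>(3) \<psi>c tf_cont[OF k] tf_csupp[OF k]])
    then have "ip k \<psi> = ip k p + ip (\<lambda>x. k x - ?a x) \<psi>"
      by (simp add: ip_diff_left[OF k a tf_smooth[OF \<psi>]])
    then show ?thesis using 1 2 by linarith
  qed
  then show ?thesis using that[OF \<delta>(1)] by blast
qed

text \<open>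
Dominated convergence along the cutoffs \<open>bump n\<close>, with dominating function \<open>\<theta>\<^sup>2 = exp (- U)\<close>.
\<close>

lemma cutoff_ground:
  assumes Z: "integrable lborel (\<lambda>x. exp (- U x))" and e: "e > 0"
  obtains b where "test_function b" "\<And>x. 0 \<le> b x" "\<And>x. b x \<le> ground U x"
    "(LBINT x. (ground U x - b x)\<^sup>2) \<le> e"
proof -
  let ?b = "\<lambda>n x. bump (real n) x * ground U x"
  have sq: "(ground U x - ?b n x)\<^sup>2 = exp (- U x) * (1 - bump (real n) x)\<^sup>2" for n x
    by (simp add: ground_square[symmetric] power_mult_distrib[symmetric] algebra_simps)
  have "(\<lambda>n. LBINT x. (ground U x - ?b n x)\<^sup>2) \<longlonglongrightarrow> (\<integral>x. 0 \<partial>(lborel :: 'a measure))"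
  proof (rule integral_dominated_convergence[where w="\<lambda>x. exp (- U x)"])
    show "AE x in lborel. (\<lambda>n. (ground U x - ?b n x)\<^sup>2) \<longlonglongrightarrow> 0"
    proof (rule AE_I2)
      fix x :: 'a
      have "(\<lambda>n. exp (- U x) * (1 - bump (real n) x)\<^sup>2) \<longlonglongrightarrow> exp (- U x) * (1 - 1)\<^sup>2"
        by (intro tendsto_intros bump_tendsto_1)
      then show "(\<lambda>n. (ground U x - ?b n x)\<^sup>2) \<longlonglongrightarrow> 0" by (simp add: sq)
    qed
    show "(\<lambda>x. (ground U x - ?b n x)\<^sup>2) \<in> borel_measurable lborel" for n
      using continuous_borel[OF smooth_continuous[OF smooth_power2[OF smooth_diff[OF smooth_ground[OF U]
            smooth_mult[OF bump_smooth[of "real n"] smooth_ground[OF U]]]]]] by simp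
    show "AE x in lborel. norm ((ground U x - ?b n x)\<^sup>2) \<le> exp (- U x)" for n
    proof (rule AE_I2)
      fix x :: 'a
      have "(1 - bump (real n) x)\<^sup>2 \<le> 1"
        using bump_bounds[of "real n" x] by (intro power_le_one) auto
      then show "norm ((ground U x - ?b n x)\<^sup>2) \<le> exp (- U x)" by (simp add: sq)
    qed
  qed (use Z in auto)
  then have "eventually (\<lambda>n. (LBINT x. (ground U x - ?b n x)\<^sup>2) < e) sequentially"
    using e by (simp add: order_tendstoD)
  then have "eventually (\<lambda>n. (LBINT x. (ground U x - ?b n x)\<^sup>2) < e \<and> n > 0) sequentially"
    by (intro eventually_conj eventually_gt_at_top)
  then obtain n where n: "(LBINT x. (ground U x - ?b n x)\<^sup>2) < e" "n > 0"
    by (auto dest: eventually_happens)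
  show ?thesis
  proof
    show "test_function (?b n)" using n by (intro tf_mult1 tf_bump smooth_ground U) auto
    show "0 \<le> ?b n x" "?b n x \<le> ground U x" for x
      using bump_bounds[of "real n" x] ground_pos[of U x] mult_right_mono[of "bump (real n) x" 1 "ground U x"]
      by auto
  qed (use n in auto)
qed

lemma Dirichlet_Cauchy_Schwarz:
  assumes "test_function f" "test_function g"
  shows "(ip f (Hw U g))\<^sup>2 \<le> energy U f * energy U g"
proof -
  let ?f = "\<lambda>b. ip (Dw U b f) (Dw U b f)" and ?g = "\<lambda>b. ip (Dw U b g) (Dw U b g)"
  have "\<bar>ip f (Hw U g)\<bar> \<le> (\<Sum>b\<in>Basis. \<bar>ip (Dw U b f) (Dw U b g)\<bar>)"
    unfolding ip_Hw1[OF U assms(1) tf_smooth[OF assms(2)]] by (rule sum_abs)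
  also have "\<dots> \<le> (\<Sum>b\<in>Basis. sqrt (?f b) * sqrt (?g b))"
  proof (rule sum_mono)
    fix b :: 'a assume b: "b \<in> Basis"
    show "\<bar>ip (Dw U b f) (Dw U b g)\<bar> \<le> sqrt (?f b) * sqrt (?g b)"
      using ip_Cauchy_Schwarz[OF tf_Dw[OF U assms(1) b] tf_Dw[OF U assms(2) b]]
      by (simp add: real_sqrt_mult[symmetric] real_le_rsqrt)
  qed
  finally have "(ip f (Hw U g))\<^sup>2 \<le> (\<Sum>b\<in>Basis. sqrt (?f b) * sqrt (?g b))\<^sup>2"
    unfolding abs_le_square_iff[symmetric] by (rule order_trans[OF _ abs_ge_self])
  also have "\<dots> \<le> (\<Sum>b\<in>Basis. (sqrt (?f b))\<^sup>2) * (\<Sum>b\<in>Basis. (sqrt (?g b))\<^sup>2)"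
    by (rule Cauchy_Schwarz_ineq_sum)
  finally show ?thesis by (simp add: ip_self_nonneg)
qed

text \<open>
Split \<open>f = H u + \<psi>\<close> by \<open>near_minimiser\<close>. The part in the range satisfies
\<open>\<parallel>H u\<parallel>\<^sup>2 \<approx> \<langle>f, H u\<rangle> \<le> \<surd>(energy f) \<surd>(energy u) \<le> \<surd>(energy f / \<kappa>) \<parallel>H u\<parallel>\<close>, which bounds it by
\<open>A = \<surd>(energy f / \<kappa>)\<close>. The residual pairs with \<open>f\<close> like the projection of \<open>f\<close> to the ground state,
by \<open>almost_orthogonal_to_range\<close>. As the ground state is not a test function, a cutoff \<open>b\<close> of it
is used to make \<open>k = \<beta> f - m b\<close> orthogonal to it.
\<close>

theorem poincare_from_second_order:
  assumes Z: "integrable lborel (\<lambda>x. exp (- U x))" and \<kappa>: "\<kappa> > 0"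
    and second: "\<And>u. test_function u \<Longrightarrow>
      \<kappa> * energy U u \<le> ip (Hw U u) (Hw U u)"
    and f: "test_function f"
  shows "\<kappa> * ((LBINT x. exp (- U x)) * ip f f - (ip f (ground U))\<^sup>2)
    \<le> (LBINT x. exp (- U x)) * energy U f"
proof -
  define z where "z = (LBINT x. exp (- U x))"
  define Q where "Q u = energy U u" for u
  define m where "m = ip f (ground U)"
  have z0: "z \<ge> 0" by (simp add: z_def)
  have Q0: "Q u \<ge> 0" for u by (simp add: Q_def sum_nonneg ip_self_nonneg)
  define M where "M = ip f f + 1"
  have M: "M > 0" using ip_self_nonneg[of f] by (simp add: M_def)
  note sg = smooth_ground[OF U]
  define A where "A = sqrt (Q f / \<kappa>)"
  have A: "A \<ge> 0" "A\<^sup>2 = Q f / \<kappa>" using Q0 \<kappa> by (auto simp: A_def)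
  have main: "z * ip f f \<le> z * A\<^sup>2 + m\<^sup>2 + e * (z * (3 * A + 2) + sqrt M * \<bar>m\<bar> + 1 + (sqrt z) * ip f f)"
    if e: "0 < e" "e \<le> 1" for e
  proof -
    obtain b where b: "test_function b" "\<And>x. 0 \<le> b x" "\<And>x. b x \<le> ground U x"
      "(LBINT x. (ground U x - b x)\<^sup>2) \<le> e\<^sup>2"
      using cutoff_ground[OF Z, of "e\<^sup>2"] e by auto
    define \<beta> where "\<beta> = ip b (ground U)"
    have gi: "integrable lborel (\<lambda>x. (ground U x)\<^sup>2)" using Z by (simp add: ground_square)
    have zg: "z = (LBINT x. (ground U x)\<^sup>2)" by (simp add: z_def ground_square)
    have bgi: "integrable lborel (\<lambda>x. b x * ground U x)" by (rule ip_integrable(1)[OF b(1) sg])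
    have gdi: "integrable lborel (\<lambda>x. (ground U x - b x) * ground U x)"
      using Bochner_Integration.integrable_diff[OF gi bgi] by (simp add: power2_eq_square left_diff_distrib)
    have ddi: "integrable lborel (\<lambda>x. (ground U x - b x)\<^sup>2)"
    proof -
      have "integrable lborel (\<lambda>x. (ground U x)\<^sup>2 - 2 * (b x * ground U x) + (b x)\<^sup>2)"
        using gi bgi square_integrable[OF b(1)] by auto
      then show ?thesis by (simp add: power2_diff algebra_simps)
    qed
    have \<beta>0: "\<beta> \<ge> 0" unfolding \<beta>_def ip_def
      using b(2) ground_pos[of U] by (intro integral_nonneg_AE AE_I2) (auto intro!: mult_nonneg_nonneg simp: less_imp_le)
    have zb: "z - \<beta> = (LBINT x. (ground U x - b x) * ground U x)"
      using gi bgi by (simp add: zg \<beta>_def ip_def left_diff_distrib power2_eq_square)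
    have \<beta>z: "\<beta> \<le> z"
    proof -
      have "0 \<le> z - \<beta>" unfolding zb using b(3) ground_pos[of U]
        by (intro integral_nonneg_AE AE_I2) (auto intro!: mult_nonneg_nonneg simp: less_imp_le)
      then show ?thesis by simp
    qed
    have z\<beta>: "z - \<beta> \<le> e * sqrt z"
    proof -
      have "(z - \<beta>)\<^sup>2 \<le> (LBINT x. (ground U x - b x)\<^sup>2) * z"
        unfolding zb unfolding zg by (rule integral_square_le[OF ddi gi gdi])
      also have "\<dots> \<le> e\<^sup>2 * z" using b(4) z0 by (rule mult_right_mono)
      also have "\<dots> = (e * sqrt z)\<^sup>2" using z0 by (simp add: power_mult_distrib)
      finally show ?thesis by (rule power2_le_imp_le) (use e z0 in simp)
    qed
    define k where "k x = \<beta> * f x - m * b x" for x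
    have k: "test_function k" unfolding k_def[abs_def] by (intro tf_diff tf_cmult f b)
    have "ip k (ground U) = \<beta> * m - m * \<beta>"
      unfolding k_def[abs_def] ip_diff_left[OF tf_cmult[OF f] tf_cmult[OF b(1)] sg] ip_cmult_left
      by (simp add: \<beta>_def m_def)
    then have k0: "ip k (ground U) = 0" by simp
    obtain d0 where d0: "d0 > 0" "\<And>\<psi>. test_function \<psi> \<Longrightarrow> ip \<psi> \<psi> \<le> M \<Longrightarrow>
      (\<And>v. test_function v \<Longrightarrow> (ip \<psi> (Hw U v))\<^sup>2 \<le> d0\<^sup>2 * ip (Hw U v) (Hw U v)) \<Longrightarrow> \<bar>ip k \<psi>\<bar> \<le> e"
      using almost_orthogonal_to_range[OF k k0 M e(1)] by blast
    define d where "d = min d0 e"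
    have d: "d > 0" "d \<le> d0" "d \<le> e" "d \<le> 1" using d0 e by (auto simp: d_def)
    obtain u where u: "test_function u"
      and uM: "ip (\<lambda>x. f x - Hw U u x) (\<lambda>x. f x - Hw U u x) \<le> ip f f + d\<^sup>2"
      and uo: "\<And>v. test_function v \<Longrightarrow>
       (ip (\<lambda>x. f x - Hw U u x) (Hw U v))\<^sup>2 \<le> d\<^sup>2 * ip (Hw U v) (Hw U v)"
      using near_minimiser[OF U f d(1)] by blast
    define \<psi> where "\<psi> x = f x - Hw U u x" for x
    have Hu: "test_function (Hw U u)" by (intro tf_Hw U u)
    have \<psi>: "test_function \<psi>" unfolding \<psi>_def[abs_def] by (intro tf_diff f Hu)
    have "d\<^sup>2 \<le> 1" using d by (simp add: power_le_one)
    then have \<psi>M: "ip \<psi> \<psi> \<le> M" using uM unfolding \<psi>_def[abs_def] M_def by linarith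
    have \<psi>o: "(ip \<psi> (Hw U v))\<^sup>2 \<le> d\<^sup>2 * ip (Hw U v) (Hw U v)" if "test_function v" for v
      using uo[OF that] unfolding \<psi>_def[abs_def] .
    have dd: "d\<^sup>2 \<le> d0\<^sup>2" using d by (intro power_mono) auto
    have "\<bar>ip k \<psi>\<bar> \<le> e"
      by (rule d0(2)[OF \<psi> \<psi>M]) (use \<psi>o mult_right_mono[OF dd ip_self_nonneg] in \<open>blast intro: order_trans\<close>)
    moreover have "ip k \<psi> = \<beta> * ip f \<psi> - m * ip b \<psi>"
      unfolding k_def[abs_def] ip_diff_left[OF tf_cmult[OF f] tf_cmult[OF b(1)] tf_smooth[OF \<psi>]] ip_cmult_left ..
    ultimately have 1: "\<beta> * ip f \<psi> \<le> m * ip b \<psi> + e" by linarith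
    have g\<psi>: "ip (ground U) \<psi> = m"
      unfolding \<psi>_def[abs_def] ip_diff_right[OF f Hu sg] ip_ground_Hw[OF U u]
      by (simp add: m_def ip_commute)
    have "m - ip b \<psi> = (LBINT x. (ground U x - b x) * \<psi> x)"
      unfolding g\<psi>[symmetric] ip_def left_diff_distrib
      using ip_integrable(2)[OF sg \<psi>] ip_integrable(1)[OF b(1) tf_smooth[OF \<psi>]] by simp
    also have "(\<dots>)\<^sup>2 \<le> e\<^sup>2 * M"
    proof -
      have i: "integrable lborel (\<lambda>x. (ground U x - b x) * \<psi> x)"
        by (intro ip_integrable(2) smooth_diff sg tf_smooth b \<psi>)
      have "(LBINT x. (ground U x - b x) * \<psi> x)\<^sup>2 \<le> (LBINT x. (ground U x - b x)\<^sup>2) * ip \<psi> \<psi>"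
        unfolding ip_self by (rule integral_square_le[OF ddi square_integrable[OF \<psi>] i])
      also have "\<dots> \<le> e\<^sup>2 * M" by (intro mult_mono b(4) \<psi>M ip_self_nonneg) auto
      finally show ?thesis .
    qed
    finally have "(m - ip b \<psi>)\<^sup>2 \<le> (e * sqrt M)\<^sup>2" using M by (simp add: power_mult_distrib)
    then have mb: "\<bar>m - ip b \<psi>\<bar> \<le> e * sqrt M"
      using abs_le_square_iff[of "m - ip b \<psi>" "e * sqrt M"] e M by simp
    have "m * ip b \<psi> = m\<^sup>2 - m * (m - ip b \<psi>)" by (simp add: power2_eq_square algebra_simps)
    also have "\<dots> \<le> m\<^sup>2 + \<bar>m\<bar> * (e * sqrt M)"
      using abs_ge_minus_self[of "m * (m - ip b \<psi>)"] mult_left_mono[OF mb, of "\<bar>m\<bar>"]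
      unfolding abs_mult by linarith
    finally have 2: "\<beta> * ip f \<psi> \<le> m\<^sup>2 + \<bar>m\<bar> * (e * sqrt M) + e" using 1 by linarith
    define h where "h = sqrt (ip (Hw U u) (Hw U u))"
    have h: "h \<ge> 0" "h\<^sup>2 = ip (Hw U u) (Hw U u)" by (auto simp: h_def ip_self_nonneg)
    have "(ip \<psi> (Hw U u))\<^sup>2 \<le> (d * h)\<^sup>2" using \<psi>o[OF u] by (simp add: power_mult_distrib h)
    then have ph: "\<bar>ip \<psi> (Hw U u)\<bar> \<le> d * h"
      using abs_le_square_iff[of "ip \<psi> (Hw U u)" "d * h"] d h by simp
    have "(ip f (Hw U u))\<^sup>2 \<le> Q f * Q u" unfolding Q_def by (rule Dirichlet_Cauchy_Schwarz[OF f u])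
    also have "\<dots> \<le> Q f * (h\<^sup>2 / \<kappa>)"
      using second[OF u] \<kappa> by (intro mult_left_mono Q0) (simp add: h Q_def field_simps)
    also have "\<dots> = (A * h)\<^sup>2" by (simp add: power_mult_distrib A)
    finally have fh: "ip f (Hw U u) \<le> A * h" by (rule power2_le_imp_le) (use A h in simp)
    have "h\<^sup>2 = ip f (Hw U u) - ip \<psi> (Hw U u)"
      unfolding h(2) \<psi>_def[abs_def] ip_diff_left[OF f Hu tf_smooth[OF Hu]] by simp
    also have "\<dots> \<le> (A + d) * h" using fh ph by (simp add: algebra_simps)
    finally have hA: "h \<le> A + d"
      using h(1) A(1) d by (cases "h = 0") (auto simp: power2_eq_square)
    have "ip f f = ip f \<psi> + ip f (Hw U u)"
      unfolding \<psi>_def[abs_def] ip_diff_right[OF f Hu tf_smooth[OF f]] by simp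
    also have "ip f (Hw U u) = h\<^sup>2 + ip \<psi> (Hw U u)"
      unfolding h(2) \<psi>_def[abs_def] ip_diff_left[OF f Hu tf_smooth[OF Hu]] by simp
    finally have "ip f f \<le> ip f \<psi> + (h\<^sup>2 + d * h)" using ph by linarith
    also have "h\<^sup>2 + d * h \<le> (A + d)\<^sup>2 + d * (A + d)"
      using hA h(1) d by (intro add_mono power_mono mult_left_mono) auto
    also have "\<dots> = A\<^sup>2 + d * (3 * A + 2 * d)" by (simp add: power2_eq_square algebra_simps)
    also have "\<dots> \<le> A\<^sup>2 + e * (3 * A + 2)"
      using d e A by (intro add_left_mono mult_mono) auto
    finally have ff: "ip f f \<le> ip f \<psi> + (A\<^sup>2 + e * (3 * A + 2))" by simp
    have "\<beta> * ip f f \<le> \<beta> * ip f \<psi> + \<beta> * (A\<^sup>2 + e * (3 * A + 2))"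
      using mult_left_mono[OF ff \<beta>0] by (simp add: distrib_left)
    also have "\<dots> \<le> (m\<^sup>2 + \<bar>m\<bar> * (e * sqrt M) + e) + z * (A\<^sup>2 + e * (3 * A + 2))"
      using 2 \<beta>z e A(1) by (intro add_mono mult_right_mono add_nonneg_nonneg mult_nonneg_nonneg) auto
    finally have 3: "\<beta> * ip f f \<le> (m\<^sup>2 + \<bar>m\<bar> * (e * sqrt M) + e) + z * (A\<^sup>2 + e * (3 * A + 2))" .
    have "z * ip f f = \<beta> * ip f f + (z - \<beta>) * ip f f" by (simp add: algebra_simps)
    also have "(z - \<beta>) * ip f f \<le> (e * sqrt z) * ip f f" by (intro mult_right_mono z\<beta> ip_self_nonneg)
    finally show ?thesis using 3 by (simp add: algebra_simps)
  qed
  have "z * ip f f \<le> z * A\<^sup>2 + m\<^sup>2"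
  proof (rule field_le_epsilon)
    fix \<epsilon> :: real assume \<epsilon>: "\<epsilon> > 0"
    define B where "B = z * (3 * A + 2) + sqrt M * \<bar>m\<bar> + 1 + (sqrt z) * ip f f"
    have B: "B \<ge> 1" using z0 A M ip_self_nonneg[of f] by (simp add: B_def)
    define e where "e = min 1 (\<epsilon> / B)"
    have e: "0 < e" "e \<le> 1" "e * B \<le> \<epsilon>"
      using \<epsilon> B by (auto simp: e_def min_def field_simps)
    show "z * ip f f \<le> z * A\<^sup>2 + m\<^sup>2 + \<epsilon>" using main[OF e(1,2)] e(3) unfolding B_def by linarith
  qed
  then have "\<kappa> * (z * ip f f - m\<^sup>2) \<le> \<kappa> * (z * A\<^sup>2)" using \<kappa> by (intro mult_left_mono) auto
  also have "\<dots> = z * Q f" using \<kappa> by (simp add: A)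
  finally show ?thesis by (simp add: z_def m_def Q_def)
qed

end

section \<open>The Poincare inequality in the ground state representation\<close>

lemma partition_function_pos:
  fixes V :: "'a::euclidean_space \<Rightarrow> real"
  assumes "integrable lborel (\<lambda>x. exp (- V x))"
  shows "(LBINT x. exp (- V x)) > 0"
proof -
  have "(LBINT x. exp (- V x)) \<noteq> 0"
  proof
    assume "(LBINT x. exp (- V x)) = 0"
    then have "AE x in (lborel :: 'a measure). False"
      using integral_nonneg_eq_0_iff_AE[OF assms] by simp
    then have "emeasure lborel (space (lborel :: 'a measure)) = 0"
      using ae_filter_eq_bot_iff[of "lborel :: 'a measure"] by (simp add: trivial_limit_def)
    then show False by simp
  qed
  moreover have "(LBINT x. exp (- V x)) \<ge> 0" by simp
  ultimately show ?thesis by linarith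
qed

lemma grad_sq_pd: "grad_sq f x = (\<Sum>b\<in>Basis. (pd b f x)\<^sup>2)"
  by (simp add: grad_sq_def pd_def)

lemma integral_gibbs:
  fixes V :: "'a::euclidean_space \<Rightarrow> real"
  assumes V: "continuous_on UNIV V" and g: "g \<in> borel_measurable borel"
  shows "(\<integral>x. g x \<partial>gibbs V) = (LBINT x. exp (- V x) * g x) / (LBINT x. exp (- V x))"
proof -
  let ?z = "LBINT x. exp (- V x)"
  have "(\<lambda>x. exp (- V x)) \<in> borel_measurable borel"
    using V by (intro continuous_borel continuous_intros)
  then have "(\<integral>x. g x \<partial>gibbs V) = (LBINT x. (exp (- V x) / ?z) *\<^sub>R g x)"
    unfolding gibbs_def using g by (intro integral_density) auto
  then show ?thesis by simp
qed

lemma variance_gibbs: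
  fixes V :: "'a::euclidean_space \<Rightarrow> real"
  assumes V: "smooth V" and Z: "integrable lborel (\<lambda>x. exp (- V x))" and f: "test_function f"
  defines "z \<equiv> LBINT x. exp (- V x)"
  shows "z\<^sup>2 * prob_space.variance (gibbs V) f =
    z * (LBINT x. exp (- V x) * (f x)\<^sup>2) - (LBINT x. exp (- V x) * f x)\<^sup>2"
proof -
  have z: "z > 0" unfolding z_def by (rule partition_function_pos[OF Z])
  have cV: "continuous_on UNIV V" by (rule smooth_continuous[OF V])
  have mf: "f \<in> borel_measurable borel" by (rule continuous_borel[OF tf_cont[OF f]])
  let ?a = "LBINT x. exp (- V x) * f x" and ?b = "LBINT x. exp (- V x) * (f x)\<^sup>2"
  have sw: "smooth (\<lambda>x. exp (- V x))" using V by auto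
  have i1: "integrable lborel (\<lambda>x. exp (- V x) * f x)" by (rule ip_integrable(2)[OF sw f])
  have i2: "integrable lborel (\<lambda>x. exp (- V x) * (f x)\<^sup>2)"
    unfolding power2_eq_square by (rule ip_integrable(2)[OF sw tf_mult1[OF f tf_smooth[OF f]]])
  have "prob_space.variance (gibbs V) f = (LBINT x. exp (- V x) * (f x - ?a / z)\<^sup>2) / z"
    using mf unfolding integral_gibbs[OF cV mf] z_def[symmetric]
    by (subst integral_gibbs[OF cV]) (auto simp: z_def)
  also have "(LBINT x. exp (- V x) * (f x - ?a / z)\<^sup>2)
     = (LBINT x. exp (- V x) * (f x)\<^sup>2 - 2 * (?a / z) * (exp (- V x) * f x) + (?a / z)\<^sup>2 * exp (- V x))"
    by (rule Bochner_Integration.integral_cong) (auto simp: power2_diff algebra_simps)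
  also have "\<dots> = ?b - 2 * (?a / z) * ?a + (?a / z)\<^sup>2 * z"
    using i1 i2 Z by (simp add: z_def)
  finally have "prob_space.variance (gibbs V) f = (?b - 2 * (?a / z) * ?a + (?a / z)\<^sup>2 * z) / z" .
  then show ?thesis using z by (simp add: field_simps power2_eq_square)
qed

text \<open>
Since the ground state is smooth and positive, \<open>f \<mapsto> f \<theta>\<close> is a bijection of the test functions. The
inequality is multiplied by \<open>z\<^sup>2\<close> to clear the normalisation of the Gibbs measure.
\<close>

lemma poincare_iff_ground_state:
  fixes V :: "'a::euclidean_space \<Rightarrow> real"
  assumes V: "smooth V" and Z: "integrable lborel (\<lambda>x. exp (- V x))"
  defines "z \<equiv> LBINT x. exp (- V x)"
  shows "poincare V \<kappa> \<longleftrightarrow> (\<forall>\<phi>. test_function \<phi> \<longrightarrow>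
    \<kappa> * (z * ip \<phi> \<phi> - (ip \<phi> (ground V))\<^sup>2) \<le> z * energy V \<phi>)"
proof -
  have z: "z > 0" unfolding z_def by (rule partition_function_pos[OF Z])
  have cV: "continuous_on UNIV V" by (rule smooth_continuous[OF V])
  have sE: "smooth (\<lambda>x. exp (V x / 2))" using V by (intro smooth_exp_compose smooth_divide)
  define P where "P \<phi> \<longleftrightarrow> \<kappa> * (z * ip \<phi> \<phi> - (ip \<phi> (ground V))\<^sup>2) \<le> z * energy V \<phi>" for \<phi>
  have eq: "\<kappa> * prob_space.variance (gibbs V) f \<le> (\<integral>x. grad_sq f x \<partial>gibbs V) \<longleftrightarrow> P (\<lambda>x. f x * ground V x)"
    if f: "test_function f" for f
  proof -
    have g2: "ground V x * ground V x = exp (- V x)" for x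
      using ground_square[of V x] by (simp add: power2_eq_square)
    have 1: "ip (\<lambda>x. f x * ground V x) (\<lambda>x. f x * ground V x) = (LBINT x. exp (- V x) * (f x)\<^sup>2)"
      unfolding ip_def by (rule Bochner_Integration.integral_cong) (auto simp: g2[symmetric] power2_eq_square mult_ac)
    have 2: "ip (\<lambda>x. f x * ground V x) (ground V) = (LBINT x. exp (- V x) * f x)"
      unfolding ip_def by (rule Bochner_Integration.integral_cong) (auto simp: g2[symmetric] mult_ac)
    have 3: "(\<Sum>b\<in>Basis. ip (Dw V b (\<lambda>x. f x * ground V x)) (Dw V b (\<lambda>x. f x * ground V x)))
      = (LBINT x. exp (- V x) * grad_sq f x)"
    proof -
      have "ip (Dw V b (\<lambda>x. f x * ground V x)) (Dw V b (\<lambda>x. f x * ground V x))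
         = (LBINT x. exp (- V x) * (pd b f x)\<^sup>2)" for b
        unfolding ip_def Dw_ground_mult[OF V tf_smooth[OF f]]
        by (rule Bochner_Integration.integral_cong) (auto simp: g2[symmetric] power2_eq_square mult_ac)
      moreover have "integrable lborel (\<lambda>x. exp (- V x) * (pd b f x)\<^sup>2)" if "b \<in> Basis" for b
        unfolding power2_eq_square
        by (intro ip_integrable(2)[OF smooth_exp_compose[OF smooth_minus[OF V]]]
            tf_mult1[OF tf_pd[OF f that] tf_smooth[OF tf_pd[OF f that]]])
      ultimately show ?thesis by (simp add: grad_sq_pd sum_distrib_left Bochner_Integration.integral_sum)
    qed
    have cg: "grad_sq f \<in> borel_measurable borel"
      unfolding grad_sq_pd[abs_def] by (intro continuous_borel continuous_intros tf_cont tf_pd f)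
    have "\<kappa> * prob_space.variance (gibbs V) f \<le> (\<integral>x. grad_sq f x \<partial>gibbs V) \<longleftrightarrow>
      z\<^sup>2 * (\<kappa> * prob_space.variance (gibbs V) f) \<le> z\<^sup>2 * (\<integral>x. grad_sq f x \<partial>gibbs V)"
      using z by (simp add: mult_le_cancel_left_pos)
    also have "z\<^sup>2 * (\<kappa> * prob_space.variance (gibbs V) f) = \<kappa> * (z\<^sup>2 * prob_space.variance (gibbs V) f)"
      by (simp add: mult_ac)
    also have "z\<^sup>2 * (\<integral>x. grad_sq f x \<partial>gibbs V) = z * (LBINT x. exp (- V x) * grad_sq f x)"
      using z unfolding integral_gibbs[OF cV cg] z_def[symmetric] by (simp add: power2_eq_square)
    finally show ?thesis unfolding P_def 1 2 3 variance_gibbs[OF V Z f, folded z_def] .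
  qed
  show ?thesis unfolding poincare_def P_def[symmetric]
  proof (intro iffI allI impI)
    fix \<phi> :: "'a \<Rightarrow> real" assume *: "\<forall>f. test_function f \<longrightarrow> \<kappa> * prob_space.variance (gibbs V) f \<le> (\<integral>x. grad_sq f x \<partial>gibbs V)"
      and \<phi>: "test_function \<phi>"
    have f: "test_function (\<lambda>x. \<phi> x * exp (V x / 2))" by (intro tf_mult1 sE \<phi>)
    have "(\<lambda>x. \<phi> x * exp (V x / 2) * ground V x) = \<phi>"
      by (auto simp: ground_def exp_minus)
    then show "P \<phi>" using eq[OF f] * f by simp
  next
    fix f :: "'a \<Rightarrow> real" assume *: "\<forall>\<phi>. test_function \<phi> \<longrightarrow> P \<phi>" and f: "test_function f"
    then show "\<kappa> * prob_space.variance (gibbs V) f \<le> (\<integral>x. grad_sq f x \<partial>gibbs V)"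
      using eq[OF f] tf_mult1[OF f smooth_ground[OF V]] by simp
  qed
qed

text \<open>
The easy converse of \<open>poincare_from_second_order\<close>; it is applied on lines. As \<open>H \<theta> = 0\<close>, the energy
\<open>\<langle>\<phi>, H \<phi>\<rangle>\<close> equals \<open>\<langle>\<phi> - c \<theta>, H \<phi>\<rangle>\<close>, where \<open>c \<theta>\<close> is the projection of \<open>\<phi>\<close> to the ground state.
\<close>

lemma second_order_from_poincare:
  fixes V :: "'a::euclidean_space \<Rightarrow> real"
  assumes V: "smooth V" and Z: "integrable lborel (\<lambda>x. exp (- V x))" and P: "poincare V \<kappa>"
    and \<phi>: "test_function \<phi>"
  shows "\<kappa> * energy V \<phi> \<le> ip (Hw V \<phi>) (Hw V \<phi>)"
proof -
  define z where "z = (LBINT x. exp (- V x))"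
  have z: "z > 0" unfolding z_def by (rule partition_function_pos[OF Z])
  define Q where "Q = energy V \<phi>"
  have Q0: "Q \<ge> 0" by (simp add: Q_def sum_nonneg ip_self_nonneg)
  define m where "m = ip \<phi> (ground V)"
  define N where "N = ip (Hw V \<phi>) (Hw V \<phi>)"
  have N0: "N \<ge> 0" by (simp add: N_def ip_self_nonneg)
  note sg = smooth_ground[OF V]
  have H: "test_function (Hw V \<phi>)" by (rule tf_Hw[OF V \<phi>])
  have PP: "\<kappa> * (z * ip \<phi> \<phi> - m\<^sup>2) \<le> z * Q"
    using P \<phi> unfolding poincare_iff_ground_state[OF V Z] z_def Q_def m_def by blast
  define c where "c = m / z"
  have sd: "smooth (\<lambda>x. \<phi> x - c * ground V x)" by (intro smooth_diff smooth_cmult sg tf_smooth \<phi>)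
  have i: "integrable lborel (\<lambda>x. (\<phi> x)\<^sup>2 - 2 * c * (\<phi> x * ground V x) + c\<^sup>2 * (ground V x)\<^sup>2)"
    by (intro Bochner_Integration.integrable_add Bochner_Integration.integrable_diff integrable_mult_right
        square_integrable[OF \<phi>] ip_integrable(1)[OF \<phi> sg]) (simp add: ground_square Z)
  have e: "(\<phi> x - c * ground V x)\<^sup>2 = (\<phi> x)\<^sup>2 - 2 * c * (\<phi> x * ground V x) + c\<^sup>2 * (ground V x)\<^sup>2" for x
    by (simp add: power2_diff power_mult_distrib algebra_simps)
  have "(LBINT x. (\<phi> x - c * ground V x)\<^sup>2) = ip \<phi> \<phi> - 2 * c * m + c\<^sup>2 * z"
    unfolding e using Z square_integrable[OF \<phi>] ip_integrable(1)[OF \<phi> sg]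
    by (simp add: ip_self z_def m_def ground_square) (simp add: ip_def)
  also have "\<dots> = (z * ip \<phi> \<phi> - m\<^sup>2) / z" using z by (simp add: c_def field_simps power2_eq_square)
  finally have D: "(LBINT x. (\<phi> x - c * ground V x)\<^sup>2) = (z * ip \<phi> \<phi> - m\<^sup>2) / z" .
  have "Q = ip \<phi> (Hw V \<phi>)" unfolding Q_def ip_Hw1[OF V \<phi> tf_smooth[OF \<phi>]] ..
  also have "\<dots> = (LBINT x. (\<phi> x - c * ground V x) * Hw V \<phi> x)"
    using ip_ground_Hw[OF V \<phi>] ip_integrable(2)[OF sg H] ip_integrable(1)[OF \<phi> tf_smooth[OF H]]
    by (simp add: left_diff_distrib mult.assoc ip_def)
  finally have "Q\<^sup>2 \<le> (LBINT x. (\<phi> x - c * ground V x)\<^sup>2) * N"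
    unfolding N_def ip_self using i[folded e]
    by (auto intro!: integral_square_le square_integrable H ip_integrable(2)[OF sd H])
  then have QN: "Q\<^sup>2 \<le> (z * ip \<phi> \<phi> - m\<^sup>2) / z * N" unfolding D .
  have "\<kappa> * Q \<le> N"
  proof (cases "\<kappa> > 0 \<and> Q > 0")
    case True
    then have "\<kappa> * Q\<^sup>2 \<le> \<kappa> * ((z * ip \<phi> \<phi> - m\<^sup>2) / z * N)" using QN by (intro mult_left_mono) auto
    also have "\<dots> = (\<kappa> * (z * ip \<phi> \<phi> - m\<^sup>2)) * (N / z)" by simp
    also have "\<dots> \<le> (z * Q) * (N / z)" using PP N0 z by (intro mult_right_mono) auto
    also have "\<dots> = N * Q" using z by simp
    finally have "(\<kappa> * Q) * Q \<le> N * Q" by (simp add: power2_eq_square mult_ac)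
    then show ?thesis using True by simp
  next
    case False
    then have "\<kappa> * Q \<le> 0" using Q0 by (auto simp: mult_le_0_iff not_less)
    then show ?thesis using N0 by simp
  qed
  then show ?thesis by (simp add: Q_def N_def)
qed

section \<open>Integration along lines\<close>

text \<open>
Each line parallel to \<open>b\<close> meets the slab \<open>0 \<le> x \<bullet> b \<le> 1\<close> in a segment of length one. So integrating
the line integrals over the slab counts every line once; this replaces a splitting of the space into
a coordinate and its complement.
\<close>
lemma nn_integral_lines:
  fixes F :: "'a::euclidean_space \<Rightarrow> ennreal"
  assumes F: "F \<in> borel_measurable borel" and b: "b \<in> Basis"
  shows "(\<integral>\<^sup>+x. F x \<partial>lborel) = (\<integral>\<^sup>+x. indicator {0..1} (x \<bullet> b) * (\<integral>\<^sup>+t. F (x + t *\<^sub>R b) \<partial>lborel) \<partial>lborel)"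
proof -
  let ?I = "indicator {0..1} :: real \<Rightarrow> ennreal"
  have Im: "?I \<in> borel_measurable borel" by simp
  have c1: "(\<lambda>p::'a \<times> real. fst p + snd p *\<^sub>R b) \<in> borel_measurable borel"
    by (intro borel_measurable_continuous_onI continuous_intros)
  have c2: "(\<lambda>p::'a \<times> real. fst p \<bullet> b) \<in> borel_measurable borel"
    by (intro borel_measurable_continuous_onI continuous_intros)
  have c3: "(\<lambda>p::'a \<times> real. fst p \<bullet> b - snd p) \<in> borel_measurable borel"
    by (intro borel_measurable_continuous_onI continuous_intros)
  have c4: "(\<lambda>p::'a \<times> real. fst p) \<in> borel_measurable borel"
    by (intro borel_measurable_continuous_onI continuous_intros)
  have m1: "(\<lambda>(x, t). ?I (x \<bullet> b) * F (x + t *\<^sub>R b)) \<in> borel_measurable (lborel \<Otimes>\<^sub>M lborel)"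
    using borel_measurable_times_ennreal[OF measurable_compose[OF c2 Im] measurable_compose[OF c1 F]]
    by (simp add: lborel_prod split_beta')
  have m2: "(\<lambda>(x, t). ?I (x \<bullet> b - t) * F x) \<in> borel_measurable (lborel \<Otimes>\<^sub>M lborel)"
    using borel_measurable_times_ennreal[OF measurable_compose[OF c3 Im] measurable_compose[OF c4 F]]
    by (simp add: lborel_prod split_beta')
  have F1: "(\<lambda>t. F (x + t *\<^sub>R b)) \<in> borel_measurable borel" for x
    by (rule measurable_compose[OF _ F]) (intro borel_measurable_continuous_onI continuous_intros)
  have "(\<integral>\<^sup>+x. ?I (x \<bullet> b) * (\<integral>\<^sup>+t. F (x + t *\<^sub>R b) \<partial>lborel) \<partial>lborel)
     = (\<integral>\<^sup>+x. (\<integral>\<^sup>+t. ?I (x \<bullet> b) * F (x + t *\<^sub>R b) \<partial>lborel) \<partial>lborel)"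
    using F1 by (simp add: nn_integral_cmult)
  also have "\<dots> = (\<integral>\<^sup>+t. (\<integral>\<^sup>+x. ?I (x \<bullet> b) * F (x + t *\<^sub>R b) \<partial>lborel) \<partial>lborel)"
    using lborel_pair.Fubini'[OF m1] by simp
  also have "\<dots> = (\<integral>\<^sup>+t. (\<integral>\<^sup>+x. ?I (x \<bullet> b - t) * F x \<partial>lborel) \<partial>lborel)"
  proof (rule nn_integral_cong)
    fix t :: real
    have "(\<lambda>x. ?I (x \<bullet> b - t) * F x) \<in> borel_measurable borel"
      by (intro borel_measurable_times_ennreal F measurable_compose[OF _ Im])
        (intro borel_measurable_continuous_onI continuous_intros)
    from nn_integral_translate[OF this, of "t *\<^sub>R b"]
    show "(\<integral>\<^sup>+x. ?I (x \<bullet> b) * F (x + t *\<^sub>R b) \<partial>lborel) = (\<integral>\<^sup>+x. ?I (x \<bullet> b - t) * F x \<partial>lborel)"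
      using b by (simp add: inner_add_left add.commute)
  qed
  also have "\<dots> = (\<integral>\<^sup>+x. (\<integral>\<^sup>+t. ?I (x \<bullet> b - t) * F x \<partial>lborel) \<partial>lborel)"
    using lborel_pair.Fubini'[OF m2] by simp
  also have "\<dots> = (\<integral>\<^sup>+x. F x \<partial>lborel)"
  proof (intro nn_integral_cong)
    fix x
    have "?I (x \<bullet> b - t) = indicator {x \<bullet> b - 1..x \<bullet> b} t" for t by (auto simp: indicator_def)
    then have "(\<integral>\<^sup>+t. ?I (x \<bullet> b - t) * F x \<partial>lborel) = (\<integral>\<^sup>+t. indicator {x \<bullet> b - 1..x \<bullet> b} t * F x \<partial>lborel)" by simp
    also have "\<dots> = F x" by (simp add: nn_integral_multc)
    finally show "(\<integral>\<^sup>+t. ?I (x \<bullet> b - t) * F x \<partial>lborel) = F x" .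
  qed
  finally show ?thesis ..
qed

lemma csupp_line:
  assumes "csupp f" "norm b = 1" shows "csupp (\<lambda>t. f (x + t *\<^sub>R b))"
proof -
  obtain r where r: "\<And>x. r < norm x \<Longrightarrow> f x = 0" using assms by (auto simp: csupp_def)
  have "norm t \<le> norm (x + t *\<^sub>R b) + norm x" for t
    using norm_triangle_ineq4[of "x + t *\<^sub>R b" x] assms(2) by simp
  then have "r + norm x < norm t \<Longrightarrow> f (x + t *\<^sub>R b) = 0" for t using r[of "x + t *\<^sub>R b"] by (smt (verit))
  then show ?thesis unfolding csupp_def by blast
qed

lemma tf_line: "test_function f \<Longrightarrow> b \<in> Basis \<Longrightarrow> test_function (\<lambda>t. f (x + t *\<^sub>R b))"
  by (simp add: test_function_iff smooth_line csupp_line)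

text \<open>
The weight \<open>E\<close> is not assumed measurable, so \<open>E x * F2 x\<close> cannot be integrated. It is dominated by
\<open>G = (A / B) F2\<close>, where \<open>A\<close> and \<open>B\<close> are the line integrals of \<open>F1\<close> and \<open>F2\<close>: their quotient is
measurable, constant along lines, and at least \<open>E\<close> where \<open>B\<close> is positive. Where \<open>B\<close> vanishes, so
does \<open>F2\<close>, by continuity.
\<close>

lemma integral_compare_on_lines:
  fixes F1 F2 E :: "'a::euclidean_space \<Rightarrow> real"
  assumes b: "b \<in> Basis"
    and F1: "test_function F1" "\<And>x. F1 x \<ge> 0" and F2: "test_function F2" "\<And>x. F2 x \<ge> 0"
    and le: "\<And>x. E x * (LBINT t. F2 (x + t *\<^sub>R b)) \<le> (LBINT t. F1 (x + t *\<^sub>R b))"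
  obtains G where "integrable lborel G" "(LBINT x. G x) \<le> (LBINT x. F1 x)"
    "\<And>x. E x * F2 x \<le> G x"
proof -
  define A where "A x = (LBINT t. F1 (x + t *\<^sub>R b))" for x
  define B where "B x = (LBINT t. F2 (x + t *\<^sub>R b))" for x
  have A0: "A x \<ge> 0" and B0: "B x \<ge> 0" for x using F1 F2 by (auto simp: A_def B_def)
  have meas: "(\<lambda>x. LBINT t. F (x + t *\<^sub>R b)) \<in> borel_measurable borel" if "test_function F" for F
  proof -
    have "(\<lambda>p::'a \<times> real. F (fst p + snd p *\<^sub>R b)) \<in> borel_measurable borel"
      by (intro continuous_borel continuous_on_compose2[OF tf_cont[OF that, of UNIV]] continuous_intros) auto
    then have "(\<lambda>(x, t). F (x + t *\<^sub>R b)) \<in> borel_measurable (borel \<Otimes>\<^sub>M lborel)"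
      by (simp add: borel_prod[symmetric] split_beta' cong: measurable_cong_sets sets_pair_measure_cong)
    then show ?thesis by (intro lborel.borel_measurable_lebesgue_integral)
  qed
  have mA: "A \<in> borel_measurable borel" and mB: "B \<in> borel_measurable borel"
    unfolding A_def[abs_def] B_def[abs_def] by (intro meas F1 F2)+
  have inv: "A (x + s *\<^sub>R b) = A x" "B (x + s *\<^sub>R b) = B x" for x s
  proof -
    have "(LBINT t. F (x + s *\<^sub>R b + t *\<^sub>R b)) = (LBINT t. F (x + t *\<^sub>R b))" if "test_function F" for F
      using integral_translate(1)[OF continuous_borel[OF tf_cont[OF tf_line[OF that b, of x]]], of s]
      by (simp add: scaleR_add_left add.assoc)
    then show "A (x + s *\<^sub>R b) = A x" "B (x + s *\<^sub>R b) = B x" using F1 F2 by (auto simp: A_def B_def)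
  qed
  have iF: "integrable lborel (\<lambda>t. F (x + t *\<^sub>R b))" if "test_function F" for F x
    by (rule tf_integrable[OF tf_line[OF that b]])
  define G where "G x = A x / B x * F2 x" for x
  have G0: "G x \<ge> 0" for x using A0 B0 F2 by (simp add: G_def)
  have mG: "G \<in> borel_measurable borel"
    unfolding G_def[abs_def] using mA mB continuous_borel[OF tf_cont[OF F2(1)]] by measurable
  have zero: "F2 x = 0" if "B x = 0" for x
  proof (rule ccontr)
    assume "F2 x \<noteq> 0"
    then have p: "F2 x > 0" using F2(2)[of x] by simp
    have "isCont (\<lambda>t. F2 (x + t *\<^sub>R b)) 0"
      by (rule smooth_isCont[OF smooth_line[OF tf_smooth[OF F2(1)] b]])
    then obtain d where d: "d > 0" "\<And>t. dist t 0 < d \<Longrightarrow> dist (F2 (x + t *\<^sub>R b)) (F2 x) < F2 x / 2"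
      using p unfolding continuous_at_eps_delta by (metis half_gt_zero_iff scaleR_zero_left add_0_right)
    have "0 < d * (F2 x / 2)" using d p by simp
    also have "\<dots> = (LBINT t. indicator {-d/2..d/2} t * (F2 x / 2))" using d by simp
    also have "\<dots> \<le> B x" unfolding B_def
    proof (rule integral_mono[OF _ iF[OF F2(1)]])
      show "integrable lborel (\<lambda>t. indicator {-d/2..d/2} t * (F2 x / 2))"
        by (intro integrable_mult_left integrable_real_indicator) (auto simp: emeasure_lborel_Icc_eq)
      fix t
      show "indicator {-d/2..d/2} t * (F2 x / 2) \<le> F2 (x + t *\<^sub>R b)"
      proof (cases "t \<in> {-d/2..d/2}")
        case True
        then have "dist t 0 < d" using d(1) by (auto simp: dist_real_def)
        then have "\<bar>F2 (x + t *\<^sub>R b) - F2 x\<bar> < F2 x / 2" using d(2)[of t] by (simp add: dist_real_def)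
        then have "F2 x / 2 \<le> F2 (x + t *\<^sub>R b)" by linarith
        then show ?thesis using True by simp
      qed (use F2 in auto)
    qed
    finally show False using that by simp
  qed
  have EG: "E x * F2 x \<le> G x" for x
  proof (cases "B x = 0")
    case False
    then have "B x > 0" using B0[of x] by simp
    then have "E x \<le> A x / B x" using le[of x] by (simp add: A_def B_def field_simps)
    then show ?thesis unfolding G_def using F2(2) by (intro mult_right_mono) auto
  qed (simp add: G_def zero)
  have "(\<integral>\<^sup>+x. ennreal (G x) \<partial>lborel)
    = (\<integral>\<^sup>+x. indicator {0..1} (x \<bullet> b) * (\<integral>\<^sup>+t. ennreal (G (x + t *\<^sub>R b)) \<partial>lborel) \<partial>lborel)"
    using mG by (intro nn_integral_lines b) simp
  also have "\<dots> \<le> (\<integral>\<^sup>+x. indicator {0..1} (x \<bullet> b) * (\<integral>\<^sup>+t. ennreal (F1 (x + t *\<^sub>R b)) \<partial>lborel) \<partial>lborel)"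
  proof (rule nn_integral_mono, rule mult_left_mono)
    fix x
    have "(\<integral>\<^sup>+t. ennreal (G (x + t *\<^sub>R b)) \<partial>lborel) = (\<integral>\<^sup>+t. ennreal (A x / B x * F2 (x + t *\<^sub>R b)) \<partial>lborel)"
      by (simp add: G_def inv)
    also have "\<dots> = ennreal (A x / B x * B x)"
      unfolding B_def[of x] using A0 B0[of x] F2 iF[OF F2(1), of x]
      by (subst nn_integral_eq_integral) (auto simp: B_def)
    also have "\<dots> \<le> ennreal (A x)" using A0[of x] by (cases "B x = 0") (auto intro: ennreal_leI)
    also have "\<dots> = (\<integral>\<^sup>+t. ennreal (F1 (x + t *\<^sub>R b)) \<partial>lborel)"
      unfolding A_def using F1 by (subst nn_integral_eq_integral[OF iF[OF F1(1)]]) auto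
    finally show "(\<integral>\<^sup>+t. ennreal (G (x + t *\<^sub>R b)) \<partial>lborel) \<le> (\<integral>\<^sup>+t. ennreal (F1 (x + t *\<^sub>R b)) \<partial>lborel)" .
  qed simp
  also have "\<dots> = (\<integral>\<^sup>+x. ennreal (F1 x) \<partial>lborel)"
    using continuous_borel[OF tf_cont[OF F1(1)]] by (intro nn_integral_lines[symmetric] b) simp
  also have "\<dots> = ennreal (LBINT x. F1 x)"
    using F1 by (intro nn_integral_eq_integral tf_integrable) auto
  finally have nn: "(\<integral>\<^sup>+x. ennreal (G x) \<partial>lborel) \<le> ennreal (LBINT x. F1 x)" .
  have Gi: "integrable lborel G"
    using mG G0 nn by (intro integrableI_nonneg) (auto simp: top_unique less_top intro: le_less_trans)
  moreover have "(LBINT x. G x) \<le> (LBINT x. F1 x)"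
    using nn F1 G0 by (simp add: nn_integral_eq_integral[OF Gi] ennreal_le_iff)
  ultimately show ?thesis using that EG by blast
qed

section \<open>The Bochner identity\<close>
context
  fixes U :: "'a::euclidean_space \<Rightarrow> real"
  assumes U: "smooth U"
begin

lemma pd_Dw:
  assumes f: "smooth f" and b: "b \<in> Basis" "c \<in> Basis"
  shows "pd b (Dw U c f) x = pd b (pd c f) x + (pd c U x / 2 * pd b f x + pd b (pd c U) x / 2 * f x)"
    and "pd b (Ds U c f) x = - pd b (pd c f) x + (pd c U x / 2 * pd b f x + pd b (pd c U) x / 2 * f x)"
proof -
  have s: "smooth (\<lambda>x. pd c U x / 2)" "smooth (pd c f)" "smooth (pd c U)"
    by (intro smooth_divide smooth_pd U f b)+
  note p = pd_smooth_mult[OF s(1) f] pd_smooth_divide[OF s(3)]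
  show "pd b (Dw U c f) x = pd b (pd c f) x + (pd c U x / 2 * pd b f x + pd b (pd c U) x / 2 * f x)"
    unfolding Dw_def[abs_def] pd_smooth_add[OF s(2) smooth_mult[OF s(1) f]] p ..
  show "pd b (Ds U c f) x = - pd b (pd c f) x + (pd c U x / 2 * pd b f x + pd b (pd c U) x / 2 * f x)"
    unfolding Ds_def[abs_def] pd_smooth_add[OF smooth_minus[OF s(2)] smooth_mult[OF s(1) f]]
      pd_smooth_minus[OF s(2)] p ..
qed

lemma Dw_commute:
  assumes "smooth f" "b \<in> Basis" "c \<in> Basis"
  shows "Dw U b (Dw U c f) = Dw U c (Dw U b f)"
proof
  fix x show "Dw U b (Dw U c f) x = Dw U c (Dw U b f) x"
    unfolding Dw_def[of U b "Dw U c f"] Dw_def[of U c "Dw U b f"] pd_Dw[OF assms] pd_Dw[OF assms(1,3,2)]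
      pd_commute[OF assms] pd_commute[OF U assms(2,3)]
    by (simp add: Dw_def algebra_simps)
qed

lemma Dw_Ds_commutator:
  assumes "smooth f" "b \<in> Basis" "c \<in> Basis"
  shows "Dw U b (Ds U c f) x = Ds U c (Dw U b f) x + pd b (pd c U) x * f x"
  unfolding Dw_def[of U b "Ds U c f"] Ds_def[of U c "Dw U b f"] pd_Dw[OF assms] pd_Dw[OF assms(1,3,2)]
      pd_commute[OF assms] pd_commute[OF U assms(2,3)]
  by (simp add: Dw_def Ds_def algebra_simps)

text \<open>
Integrate by parts twice. Commuting \<open>D\<^sub>b\<close> past \<open>D\<^sub>c\<^sup>*\<close> produces the mixed derivative of \<open>U\<close>; what is
left is a square because \<open>D\<^sub>b\<close> and \<open>D\<^sub>c\<close> commute.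
\<close>

lemma Bochner_off_diagonal:
  assumes f: "test_function f" and b: "b \<in> Basis" "c \<in> Basis"
  shows "ip (Ds U b (Dw U b f)) (Ds U c (Dw U c f)) =
    ip (Dw U b (Dw U c f)) (Dw U b (Dw U c f)) + (LBINT x. pd b (pd c U) x * Dw U b f x * Dw U c f x)"
proof -
  let ?u = "Dw U b f" and ?w = "Dw U c f"
  have u: "test_function ?u" and w: "test_function ?w" using f b by (auto intro: tf_Dw[OF U])
  have Uw: "test_function (\<lambda>x. pd b (pd c U) x * ?w x)" by (intro tf_mult2 smooth_pd U b w)
  have dw: "test_function (Ds U c (Dw U b ?w))" by (intro tf_Ds tf_Dw U w b)
  have "ip (Ds U b ?u) (Ds U c ?w) = ip (Dw U b (Ds U c ?w)) ?u"
    using Dw_adjoint1[OF U tf_Ds[OF U w b(2)] tf_smooth[OF u] b(1)] by (simp add: ip_commute)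
  also have "\<dots> = ip (\<lambda>x. Ds U c (Dw U b ?w) x + pd b (pd c U) x * ?w x) ?u"
    by (simp add: Dw_Ds_commutator[OF tf_smooth[OF w] b, abs_def])
  also have "\<dots> = ip (Ds U c (Dw U b ?w)) ?u + ip (\<lambda>x. pd b (pd c U) x * ?w x) ?u"
    by (rule ip_add_left[OF dw Uw tf_smooth[OF u]])
  also have "ip (Ds U c (Dw U b ?w)) ?u = ip (Dw U c ?u) (Dw U b ?w)"
    using Dw_adjoint1[OF U u tf_smooth[OF tf_Dw[OF U w b(1)]] b(2)] by (simp add: ip_commute)
  also have "Dw U c ?u = Dw U b ?w" by (rule Dw_commute[OF tf_smooth[OF f] b, symmetric])
  finally show ?thesis by (simp add: ip_def mult_ac)
qed

text \<open>
The line through \<open>x\<close> is parametrised from its point with vanishing \<open>b\<close>-coordinate, so that the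
hypotheses mention one potential for each line. Only the off-diagonal products
\<open>\<langle>D\<^sub>b\<^sup>* D\<^sub>b f, D\<^sub>c\<^sup>* D\<^sub>c f\<rangle>\<close> are expanded by Bochner; the diagonal ones are compared on lines.
\<close>

lemma second_order_from_lines:
  assumes Z: "\<And>b x. b \<in> Basis \<Longrightarrow> integrable lborel (\<lambda>t. exp (- U (x - (x \<bullet> b) *\<^sub>R b + t *\<^sub>R b)))"
    and P: "\<And>b x. b \<in> Basis \<Longrightarrow> poincare (\<lambda>t. U (x - (x \<bullet> b) *\<^sub>R b + t *\<^sub>R b)) (E b x)"
    and matrix: "\<And>x v. \<kappa> * (\<Sum>b\<in>Basis. (v b)\<^sup>2) \<le>
      (\<Sum>b\<in>Basis. E b x * (v b)\<^sup>2) + (\<Sum>b\<in>Basis. \<Sum>c\<in>Basis - {b}. pd b (pd c U) x * v b * v c)"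
    and f: "test_function f"
  shows "\<kappa> * energy U f \<le> ip (Hw U f) (Hw U f)"
proof -
  let ?u = "\<lambda>b. Dw U b f" and ?A = "\<lambda>b. Ds U b (Dw U b f)"
  have u: "test_function (?u b)" if "b \<in> Basis" for b using that f by (intro tf_Dw U)
  have A: "test_function (?A b)" if "b \<in> Basis" for b using that f by (intro tf_Ds tf_Dw U)
  have "\<exists>G. integrable lborel G \<and> (LBINT x. G x) \<le> ip (?A b) (?A b) \<and> (\<forall>x. E b x * (?u b x)\<^sup>2 \<le> G x)"
    if b: "b \<in> Basis" for b
  proof -
    have t1: "test_function (\<lambda>x. (?A b x)\<^sup>2)" unfolding power2_eq_square by (intro tf_mult1 A b tf_smooth)
    have t2: "test_function (\<lambda>x. (?u b x)\<^sup>2)" unfolding power2_eq_square by (intro tf_mult1 u b tf_smooth)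
    have le: "E b x * (LBINT t. (?u b (x + t *\<^sub>R b))\<^sup>2) \<le> (LBINT t. (?A b (x + t *\<^sub>R b))\<^sup>2)" for x
    proof -
      define a where "a = x - (x \<bullet> b) *\<^sub>R b"
      define V where "V = (\<lambda>t. U (a + t *\<^sub>R b))"
      define g where "g = (\<lambda>t. f (a + t *\<^sub>R b))"
      have V: "smooth V" unfolding V_def by (rule smooth_line[OF U b])
      have g: "test_function g" unfolding g_def by (rule tf_line[OF f b])
      have D: "Dw V 1 g = (\<lambda>t. ?u b (a + t *\<^sub>R b))"
        by (rule ext) (simp add: Dw_def V_def g_def pd_line[OF U b] pd_line[OF tf_smooth[OF f] b])
      have DD: "Ds V 1 (Dw V 1 g) = (\<lambda>t. ?A b (a + t *\<^sub>R b))"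
        unfolding D by (rule ext) (simp add: Ds_def V_def pd_line[OF U b] pd_line[OF tf_smooth[OF u[OF b]] b])
      have "E b x * energy V g \<le> ip (Hw V g) (Hw V g)"
        using second_order_from_poincare[OF V _ _ g] Z[OF b, of x] P[OF b, of x]
        by (simp add: V_def a_def)
      then have 1: "E b x * (LBINT t. (?u b (a + t *\<^sub>R b))\<^sup>2) \<le> (LBINT t. (?A b (a + t *\<^sub>R b))\<^sup>2)"
        by (simp add: Hw_def[abs_def] D[abs_def] DD[abs_def] DD[unfolded D] ip_self)
      have sh: "(LBINT t. F (x + t *\<^sub>R b)) = (LBINT t. F (a + t *\<^sub>R b))" if "test_function F" for F
        using integral_translate(1)[OF continuous_borel[OF tf_cont[OF tf_line[OF that b, of a]]], of "x \<bullet> b"]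
        by (simp add: a_def scaleR_add_left)
      show ?thesis using 1 unfolding sh[OF t1] sh[OF t2] .
    qed
    obtain G where "integrable lborel G" "(LBINT x. G x) \<le> (LBINT x. (?A b x)\<^sup>2)"
      "\<And>x. E b x * (?u b x)\<^sup>2 \<le> G x"
      by (rule integral_compare_on_lines[of b "\<lambda>x. (?A b x)\<^sup>2" "\<lambda>x. (?u b x)\<^sup>2" "E b"])
        (use b t1 t2 le in auto)
    then show ?thesis unfolding ip_self by blast
  qed
  then obtain G where G: "\<And>b. b \<in> Basis \<Longrightarrow> integrable lborel (G b)"
    "\<And>b. b \<in> Basis \<Longrightarrow> (LBINT x. G b x) \<le> ip (?A b) (?A b)"
    "\<And>b x. b \<in> Basis \<Longrightarrow> E b x * (?u b x)\<^sup>2 \<le> G b x" by metis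
  have off_i: "integrable lborel (\<lambda>x. pd b (pd c U) x * ?u b x * ?u c x)" if "b \<in> Basis" "c \<in> Basis" for b c
    using that by (intro ip_integrable(1) tf_mult2 u tf_smooth smooth_pd U)
  have iG: "integrable lborel (\<lambda>x. \<Sum>b\<in>Basis. G b x)"
    by (rule Bochner_Integration.integrable_sum[OF G(1)])
  have iO: "integrable lborel (\<lambda>x. \<Sum>b\<in>Basis. \<Sum>c\<in>Basis - {b}. pd b (pd c U) x * ?u b x * ?u c x)"
    by (intro Bochner_Integration.integrable_sum off_i) auto
  have ui: "integrable lborel (\<lambda>x. (?u b x)\<^sup>2)" if "b \<in> Basis" for b
    using that by (intro square_integrable u)
  have "\<kappa> * (\<Sum>b\<in>Basis. ip (?u b) (?u b)) = (LBINT x. \<kappa> * (\<Sum>b\<in>Basis. (?u b x)\<^sup>2))"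
    using ui by (simp add: ip_self Bochner_Integration.integral_sum)
  also have "\<dots> \<le> (LBINT x. (\<Sum>b\<in>Basis. G b x) + (\<Sum>b\<in>Basis. \<Sum>c\<in>Basis - {b}. pd b (pd c U) x * ?u b x * ?u c x))"
  proof (rule integral_mono)
    fix x
    have "(\<Sum>b\<in>Basis. E b x * (?u b x)\<^sup>2) \<le> (\<Sum>b\<in>Basis. G b x)" using G(3) by (intro sum_mono) auto
    then show "\<kappa> * (\<Sum>b\<in>Basis. (?u b x)\<^sup>2) \<le> (\<Sum>b\<in>Basis. G b x) + (\<Sum>b\<in>Basis. \<Sum>c\<in>Basis - {b}. pd b (pd c U) x * ?u b x * ?u c x)"
      using matrix[of "\<lambda>b. ?u b x" x] by linarith
  qed (use G(1) ui off_i in \<open>auto intro!: Bochner_Integration.integrable_add Bochner_Integration.integrable_sum\<close>)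
  also have "\<dots> = (LBINT x. (\<Sum>b\<in>Basis. G b x)) +
      (LBINT x. (\<Sum>b\<in>Basis. \<Sum>c\<in>Basis - {b}. pd b (pd c U) x * ?u b x * ?u c x))"
    by (rule Bochner_Integration.integral_add[OF iG iO])
  also have "(LBINT x. (\<Sum>b\<in>Basis. G b x)) = (\<Sum>b\<in>Basis. (LBINT x. G b x))"
    by (rule Bochner_Integration.integral_sum[OF G(1)])
  also have "(LBINT x. (\<Sum>b\<in>Basis. \<Sum>c\<in>Basis - {b}. pd b (pd c U) x * ?u b x * ?u c x))
      = (\<Sum>b\<in>Basis. \<Sum>c\<in>Basis - {b}. (LBINT x. pd b (pd c U) x * ?u b x * ?u c x))"
    using off_i by (subst Bochner_Integration.integral_sum)
      (auto intro!: sum.cong Bochner_Integration.integral_sum Bochner_Integration.integrable_sum)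
  also have "(\<Sum>b\<in>Basis. (LBINT x. G b x))
      + (\<Sum>b\<in>Basis. \<Sum>c\<in>Basis - {b}. (LBINT x. pd b (pd c U) x * ?u b x * ?u c x))
    \<le> (\<Sum>b\<in>Basis. ip (?A b) (?A b)) + (\<Sum>b\<in>Basis. \<Sum>c\<in>Basis - {b}. ip (?A b) (?A c))"
  proof (intro add_mono sum_mono G(2))
    fix b c :: 'a assume "b \<in> Basis" "c \<in> Basis - {b}"
    then show "(LBINT x. pd b (pd c U) x * ?u b x * ?u c x) \<le> ip (?A b) (?A c)"
      using Bochner_off_diagonal[OF f, of b c] ip_self_nonneg[of "Dw U b (Dw U c f)"] by simp
  qed
  also have "\<dots> = (\<Sum>b\<in>Basis. \<Sum>c\<in>Basis. ip (?A b) (?A c))"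
    unfolding sum.distrib[symmetric] by (intro sum.cong refl sum.remove[symmetric]) auto
  also have "\<dots> = ip (Hw U f) (Hw U f)"
    unfolding ip_def Hw_def sum_product
    by (subst Bochner_Integration.integral_sum, (intro Bochner_Integration.integrable_sum ip_integrable(1) A tf_smooth, assumption+),
        intro sum.cong refl Bochner_Integration.integral_sum[symmetric] ip_integrable(1) A tf_smooth)
  finally show ?thesis .
qed

end

section \<open>Cheeger bound for weighted graphs with killing\<close>

text \<open>
The coarea argument as an induction on the size of the support \<open>A\<close> of \<open>w\<close>: subtracting the minimum
of \<open>w\<close> over \<open>A\<close> shrinks the support, and both sides change by exactly the two sides of the
isoperimetric inequality for \<open>A\<close>, multiplied by that minimum.
\<close>

lemma coarea_inequality:
  fixes w :: "'n::finite \<Rightarrow> real"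
  assumes h: "\<And>A. A \<noteq> {} \<Longrightarrow> h * real (card A) \<le> (\<Sum>i\<in>A. d i) + (\<Sum>i\<in>A. \<Sum>j\<in>-A. a i j)"
    and w: "\<And>i. 0 \<le> w i"
  shows "h * (\<Sum>i\<in>UNIV. w i) \<le> (\<Sum>i\<in>UNIV. d i * w i) + (\<Sum>i\<in>UNIV. \<Sum>j\<in>UNIV. a i j * max 0 (w i - w j))"
  using w
proof (induction "card {i. w i > 0}" arbitrary: w rule: less_induct)
  case less
  define A where "A = {i. w i > 0}"
  show ?case
  proof (cases "A = {}")
    case True
    then have "w i = 0" for i using less.prems[of i] by (auto simp: A_def order_less_le)
    then show ?thesis by simp
  next
    case False
    define m where "m = Min (w ` A)"
    have m: "m \<in> w ` A" "\<And>i. i \<in> A \<Longrightarrow> m \<le> w i" using False by (auto simp: m_def)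
    have mpos: "m > 0" using m(1) by (auto simp: A_def)
    define w' where "w' i = w i - m * indicator A i" for i
    have out: "i \<notin> A \<Longrightarrow> w i = 0" for i using less.prems[of i] by (auto simp: A_def order_less_le)
    have w'0: "0 \<le> w' i" for i using m(2)[of i] less.prems[of i] by (auto simp: w'_def indicator_def)
    have sub: "{i. w' i > 0} \<subset> {i. w i > 0}"
    proof
      show "{i. w' i > 0} \<subseteq> {i. w i > 0}" using mpos by (auto simp: w'_def indicator_def split: if_splits)
      obtain k where "k \<in> A" "w k = m" using m(1) by auto
      then have "w k > 0" "w' k = 0" by (auto simp: w'_def A_def)
      then show "{i. w' i > 0} \<noteq> {i. w i > 0}" by (metis less_irrefl mem_Collect_eq)
    qed
    have IH: "h * (\<Sum>i\<in>UNIV. w' i) \<le> (\<Sum>i\<in>UNIV. d i * w' i) + (\<Sum>i\<in>UNIV. \<Sum>j\<in>UNIV. a i j * max 0 (w' i - w' j))"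
      by (rule less.hyps[OF psubset_card_mono[OF finite sub] w'0])
    have ind: "(\<Sum>i\<in>UNIV. f i * indicator B i) = (\<Sum>i\<in>B. f i)" for f :: "'n \<Rightarrow> real" and B
      by (simp add: sum.inter_restrict[symmetric] indicator_def if_distrib[of "\<lambda>x. _ * x"] sum.If_cases cong: if_cong)
    have w: "w i = w' i + m * indicator A i" for i by (simp add: w'_def)
    have 1: "(\<Sum>i\<in>UNIV. w i) = (\<Sum>i\<in>UNIV. w' i) + m * card A"
      using ind[of "\<lambda>_. 1" A] by (simp add: w sum.distrib sum_distrib_left[symmetric])
    have 2: "(\<Sum>i\<in>UNIV. d i * w i) = (\<Sum>i\<in>UNIV. d i * w' i) + m * (\<Sum>i\<in>A. d i)"
      unfolding ind[of d A, symmetric] w distrib_left sum.distrib sum_distrib_left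
      by (simp only: mult.left_commute)
    have mx: "max 0 (w i - w j) = max 0 (w' i - w' j) + m * (indicator A i * indicator (-A) j)" for i j
      using out[of i] out[of j] m(2)[of i] m(2)[of j] mpos
      by (auto simp: w'_def indicator_def max_def)
    have "(\<Sum>i\<in>UNIV. \<Sum>j\<in>UNIV. a i j * (indicator A i * indicator (-A) j)) = (\<Sum>i\<in>A. \<Sum>j\<in>-A. a i j)"
    proof -
      have "(\<Sum>i\<in>UNIV. \<Sum>j\<in>UNIV. a i j * (indicator A i * indicator (-A) j))
        = (\<Sum>i\<in>UNIV. (\<Sum>j\<in>UNIV. a i j * indicator (-A) j) * indicator A i)"
        unfolding sum_distrib_right by (intro sum.cong refl) (simp only: mult_ac)
      then show ?thesis by (simp only: ind)
    qed
    moreover have "(\<Sum>i\<in>UNIV. \<Sum>j\<in>UNIV. a i j * (m * (indicator A i * indicator (-A) j)))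
        = m * (\<Sum>i\<in>UNIV. \<Sum>j\<in>UNIV. a i j * (indicator A i * indicator (-A) j))"
      unfolding sum_distrib_left by (intro sum.cong refl) (rule mult.left_commute)
    ultimately have 3: "(\<Sum>i\<in>UNIV. \<Sum>j\<in>UNIV. a i j * max 0 (w i - w j))
      = (\<Sum>i\<in>UNIV. \<Sum>j\<in>UNIV. a i j * max 0 (w' i - w' j)) + m * (\<Sum>i\<in>A. \<Sum>j\<in>-A. a i j)"
      unfolding mx distrib_left sum.distrib by (simp only:)
    have "m * (h * card A) \<le> m * ((\<Sum>i\<in>A. d i) + (\<Sum>i\<in>A. \<Sum>j\<in>-A. a i j))"
      using h[OF False] mpos by (intro mult_left_mono) auto
    then show ?thesis using IH unfolding 1 2 3 by (simp add: algebra_simps)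
  qed
qed

lemma square_le_of_AM_GM:
  fixes c D N :: real
  assumes "0 \<le> c" "0 \<le> D" "0 \<le> N" and le: "\<And>t. t > 0 \<Longrightarrow> 2 * c \<le> t * D + N / t"
  shows "c\<^sup>2 \<le> D * N"
proof (cases "c = 0")
  case False
  then have c: "c > 0" using assms by simp
  have "D > 0"
  proof (rule ccontr)
    assume "\<not> D > 0"
    then have "D = 0" using assms by simp
    moreover have "N / ((N + 1) / c) \<le> c" using c assms(3) by (simp add: field_simps)
    moreover have "(N + 1) / c > 0" using c assms(3) by simp
    ultimately show False using le[of "(N + 1) / c"] c by simp
  qed
  \<comment> \<open>the parameter that makes the first term equal to \<open>c\<close>\<close>
  then have "2 * c \<le> c + N * D / c" using le[of "c / D"] c by simp
  then have "c \<le> N * D / c" by simp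
  then show ?thesis using c by (simp add: field_simps power2_eq_square)
qed (use assms in auto)

abbreviation killed_form :: "('n \<Rightarrow> real) \<Rightarrow> ('n \<Rightarrow> 'n \<Rightarrow> real) \<Rightarrow> ('n::finite \<Rightarrow> real) \<Rightarrow> real" where
  "killed_form d a v \<equiv> (\<Sum>i\<in>UNIV. d i * (v i)\<^sup>2) + 1/2 * (\<Sum>i\<in>UNIV. \<Sum>j\<in>UNIV. a i j * (v i - v j)\<^sup>2)"

abbreviation signless_form :: "('n \<Rightarrow> real) \<Rightarrow> ('n \<Rightarrow> 'n \<Rightarrow> real) \<Rightarrow> ('n::finite \<Rightarrow> real) \<Rightarrow> real" where
  "signless_form d a v \<equiv> (\<Sum>i\<in>UNIV. d i * (v i)\<^sup>2) + 1/2 * (\<Sum>i\<in>UNIV. \<Sum>j\<in>UNIV. a i j * (v i + v j)\<^sup>2)"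

text \<open>
The coarea inequality for \<open>v\<^sup>2\<close>, followed by \<open>\<bar>v i\<^sup>2 - v j\<^sup>2\<bar> = \<bar>v i - v j\<bar> \<bar>v i + v j\<bar>\<close> and Cauchy-Schwarz. The
two weight hypotheses are \<open>\<delta>\<^sup>2 \<le> d d'\<close> and \<open>\<alpha>\<^sup>2 \<le> a a'\<close> in the form of the arithmetic-geometric mean
inequality with a free parameter \<open>t\<close>, which is optimised only after summation.
\<close>

lemma cheeger_Cauchy_Schwarz:
  fixes v :: "'n::finite \<Rightarrow> real"
  assumes h: "\<And>A. A \<noteq> {} \<Longrightarrow> h * real (card A) \<le> (\<Sum>i\<in>A. \<delta> i) + (\<Sum>i\<in>A. \<Sum>j\<in>-A. \<alpha> i j)"
    and h0: "h \<ge> 0"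
    and sym: "\<And>i j. \<alpha> i j = \<alpha> j i"
    and nonneg: "\<And>i. 0 \<le> d i" "\<And>i. 0 \<le> d' i" "\<And>i j. 0 \<le> a i j" "\<And>i j. 0 \<le> a' i j"
    and \<delta>: "\<And>i t. t > 0 \<Longrightarrow> 2 * \<delta> i \<le> t * d i + d' i / t"
    and \<alpha>: "\<And>i j s r t. s \<ge> 0 \<Longrightarrow> r \<ge> 0 \<Longrightarrow> t > 0 \<Longrightarrow>
      2 * \<alpha> i j * (s * r) \<le> t * (a i j * s\<^sup>2) + (a' i j * r\<^sup>2) / t"
  shows "(h * (\<Sum>i\<in>UNIV. (v i)\<^sup>2))\<^sup>2 \<le>
    (killed_form d a v) *
    (signless_form d' a' v)"
proof (rule square_le_of_AM_GM)
  let ?S = "\<Sum>i\<in>UNIV. (v i)\<^sup>2"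
  show "0 \<le> h * ?S" using h0 by (simp add: sum_nonneg)
  show "0 \<le> killed_form d a v"
    "0 \<le> signless_form d' a' v"
    using nonneg by (auto intro!: add_nonneg_nonneg sum_nonneg mult_nonneg_nonneg)
  fix t :: real assume t: "t > 0"
  let ?m = "\<lambda>i j. \<alpha> i j * max 0 ((v i)\<^sup>2 - (v j)\<^sup>2)"
  have "(\<Sum>i\<in>UNIV. \<Sum>j\<in>UNIV. ?m i j) = (\<Sum>i\<in>UNIV. \<Sum>j\<in>UNIV. ?m j i)" by (rule sum.swap)
  then have "2 * (\<Sum>i\<in>UNIV. \<Sum>j\<in>UNIV. ?m i j) = (\<Sum>i\<in>UNIV. \<Sum>j\<in>UNIV. ?m i j + ?m j i)"
    by (simp add: sum.distrib)
  also have "\<dots> = (\<Sum>i\<in>UNIV. \<Sum>j\<in>UNIV. \<alpha> i j * (\<bar>v i - v j\<bar> * \<bar>v i + v j\<bar>))"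
  proof (intro sum.cong refl)
    fix i j
    have "\<bar>v i - v j\<bar> * \<bar>v i + v j\<bar> = \<bar>(v i)\<^sup>2 - (v j)\<^sup>2\<bar>"
      by (simp add: abs_mult[symmetric] power2_eq_square algebra_simps)
    then show "?m i j + ?m j i = \<alpha> i j * (\<bar>v i - v j\<bar> * \<bar>v i + v j\<bar>)"
      using sym[of i j] by (simp add: max_def abs_if)
  qed
  finally have "2 * (h * ?S) \<le> (\<Sum>i\<in>UNIV. 2 * \<delta> i * (v i)\<^sup>2) + (\<Sum>i\<in>UNIV. \<Sum>j\<in>UNIV. \<alpha> i j * (\<bar>v i - v j\<bar> * \<bar>v i + v j\<bar>))"
    using coarea_inequality[OF h, of "\<lambda>i. (v i)\<^sup>2"] by (simp add: sum_distrib_left[symmetric] mult.assoc)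
  also have "\<dots> \<le> (\<Sum>i\<in>UNIV. t * (d i * (v i)\<^sup>2) + (d' i * (v i)\<^sup>2) / t)
     + (\<Sum>i\<in>UNIV. \<Sum>j\<in>UNIV. 1/2 * (t * (a i j * (v i - v j)\<^sup>2) + (a' i j * (v i + v j)\<^sup>2) / t))"
  proof (intro add_mono sum_mono)
    fix i j
    show "2 * \<delta> i * (v i)\<^sup>2 \<le> t * (d i * (v i)\<^sup>2) + (d' i * (v i)\<^sup>2) / t"
      using mult_right_mono[OF \<delta>[OF t, of i], of "(v i)\<^sup>2"] by (simp add: algebra_simps)
    show "\<alpha> i j * (\<bar>v i - v j\<bar> * \<bar>v i + v j\<bar>) \<le> 1/2 * (t * (a i j * (v i - v j)\<^sup>2) + (a' i j * (v i + v j)\<^sup>2) / t)"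
      using \<alpha>[OF _ _ t, of "\<bar>v i - v j\<bar>" "\<bar>v i + v j\<bar>" i j] by simp
  qed
  also have "\<dots> = t * (killed_form d a v) +
    (signless_form d' a' v) / t"
    unfolding sum.distrib distrib_left sum_distrib_left[symmetric] sum_divide_distrib[symmetric]
    by (simp add: sum_divide_distrib[symmetric] add_divide_distrib)
  finally show "2 * (h * ?S) \<le> t * (killed_form d a v) +
    (signless_form d' a' v) / t" .
qed

lemma sum_symmetric_rows:
  fixes b :: "'n::finite \<Rightarrow> 'n \<Rightarrow> real"
  assumes "\<And>i j. b i j = b j i"
  shows "(\<Sum>i\<in>UNIV. \<Sum>j\<in>UNIV. b i j * (x i + x j)) = 2 * (\<Sum>i\<in>UNIV. (\<Sum>j\<in>UNIV. b i j) * x i)"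
proof -
  have "(\<Sum>i\<in>UNIV. \<Sum>j\<in>UNIV. b i j * x j) = (\<Sum>i\<in>UNIV. \<Sum>j\<in>UNIV. b j i * x i)" by (rule sum.swap)
  also have "\<dots> = (\<Sum>i\<in>UNIV. \<Sum>j\<in>UNIV. b i j * x i)"
    by (intro sum.cong refl arg_cong2[where f="(*)"]) (rule assms)
  finally show ?thesis unfolding distrib_left sum.distrib sum_distrib_right by simp
qed

text \<open>
Let \<open>S = \<Sum> v\<^sup>2\<close>, let \<open>D\<close> be the form on the right, and let \<open>D1\<close> and \<open>N\<close> be the killed and the signless
form with the normalised weights \<open>d / q\<close> and \<open>a / max q q\<close>. Since normalised rows sum to at most \<open>1\<close>,
\<open>N + D1 \<le> 2 S\<close>. Cauchy-Schwarz with weights of exponent \<open>1\<close> gives \<open>(h1 S)\<^sup>2 \<le> D1 N\<close>, and this forces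
\<open>N \<le> (1 + \<surd>(1 - h1\<^sup>2)) S\<close>; with exponent \<open>1/2\<close> it gives \<open>(h2 S)\<^sup>2 \<le> D N\<close>.
\<close>

lemma cheeger_with_killing:
  fixes d q v :: "'n::finite \<Rightarrow> real" and a :: "'n \<Rightarrow> 'n \<Rightarrow> real"
  assumes a: "\<And>i j. 0 \<le> a i j" "\<And>i j. a i j = a j i" and d: "\<And>i. 0 \<le> d i"
    and q: "\<And>i. q i = d i + (\<Sum>j\<in>UNIV. a i j)"
    and h0: "0 \<le> h1" "0 \<le> h2"
    and h1: "\<And>A. A \<noteq> {} \<Longrightarrow> h1 * real (card A) \<le>
      (\<Sum>i\<in>A. d i / q i) + (\<Sum>i\<in>A. \<Sum>j\<in>-A. a i j / max (q i) (q j))"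
    and h2: "\<And>A. A \<noteq> {} \<Longrightarrow> h2 * real (card A) \<le>
      (\<Sum>i\<in>A. d i / sqrt (q i)) + (\<Sum>i\<in>A. \<Sum>j\<in>-A. a i j / sqrt (max (q i) (q j)))"
  shows "h2\<^sup>2 / (1 + sqrt (1 - h1\<^sup>2)) * (\<Sum>i\<in>UNIV. (v i)\<^sup>2) \<le>
    killed_form d a v"
proof -
  define S where "S = (\<Sum>i\<in>UNIV. (v i)\<^sup>2)"
  define D where "D = killed_form d a v"
  let ?d = "\<lambda>i. d i / q i" and ?a = "\<lambda>i j. a i j / max (q i) (q j)"
  define D1 where "D1 = killed_form ?d ?a v"
  define N where "N = signless_form ?d ?a v"
  have aq: "a i j \<le> q i" for i j
    using member_le_sum[of j UNIV "a i"] a d[of i] by (simp add: q)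
  have q0: "0 \<le> q i" for i using aq[of i i] a(1)[of i i] by linarith
  have nn: "0 \<le> ?d i" "0 \<le> ?a i j" for i j using a d q0 by (auto simp: max_def)
  have S0: "S \<ge> 0" by (simp add: S_def sum_nonneg)
  have D0: "D \<ge> 0" using a d by (auto simp: D_def intro!: add_nonneg_nonneg sum_nonneg mult_nonneg_nonneg)
  have am: "2 * (x / sqrt Q) * (s * r) \<le> t * (x * s\<^sup>2) + (x / Q * r\<^sup>2) / t"
    if "0 \<le> x" "0 \<le> Q" "0 < t" for x Q s r t :: real
  proof (cases "Q = 0")
    case False
    then have Q: "Q > 0" using that by simp
    have "0 \<le> x * (sqrt t * s - r / (sqrt t * sqrt Q))\<^sup>2" using that by simp
    also have "\<dots> = t * (x * s\<^sup>2) + (x / Q * r\<^sup>2) / t - 2 * (x / sqrt Q) * (s * r)"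
      using Q that by (simp add: power2_diff power_mult_distrib power_divide algebra_simps)
    finally show ?thesis by simp
  qed (use that in simp)
  have am1: "2 * x * (s * r) \<le> t * (x * s\<^sup>2) + (x * r\<^sup>2) / t" if "0 \<le> x" "0 < t" for x s r t :: real
    using am[of x 1 t s r] that by simp
  have 1: "(h1 * S)\<^sup>2 \<le> D1 * N"
    unfolding S_def D1_def N_def
  proof (rule cheeger_Cauchy_Schwarz[OF h1 h0(1)])
    show "2 * ?d i \<le> t * ?d i + ?d i / t" if "t > 0" for i t using am1[of "?d i" t 1 1] that nn by simp
    show "2 * ?a i j * (s * r) \<le> t * (?a i j * s\<^sup>2) + ?a i j * r\<^sup>2 / t" if "t > 0" for i j s r t
      by (rule am1[OF nn(2) that])
  qed (use nn a in \<open>auto simp: max.commute\<close>)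
  have 2: "(h2 * S)\<^sup>2 \<le> D * N"
    unfolding S_def D_def N_def
  proof (rule cheeger_Cauchy_Schwarz[OF h2 h0(2)])
    show "2 * (d i / sqrt (q i)) \<le> t * d i + ?d i / t" if "t > 0" for i t
      using am[OF d[of i] q0[of i] that, of 1 1] by simp
    show "2 * (a i j / sqrt (max (q i) (q j))) * (s * r) \<le> t * (a i j * s\<^sup>2) + ?a i j * r\<^sup>2 / t" if "t > 0" for i j s r t
      using am[of "a i j" "max (q i) (q j)" t s r] a(1) q0[of i] that by simp
  qed (use nn a d in \<open>auto simp: max.commute\<close>)
  have "N + D1 \<le> 2 * S"
  proof -
    have sq: "b * (v i + v j)\<^sup>2 + b * (v i - v j)\<^sup>2 = 2 * (b * ((v i)\<^sup>2 + (v j)\<^sup>2))" for b i j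
      by (simp add: power2_sum power2_diff algebra_simps)
    have lin: "A + 1/2 * X + (A + 1/2 * Y) = 2 * (A + Z)" if "X + Y = 2 * (2 * Z)" for A X Y Z :: real
      using that by (simp add: field_simps)
    have sa: "?a i j = ?a j i" for i j by (simp only: a(2)[of i j] max.commute)
    have "(\<Sum>i\<in>UNIV. \<Sum>j\<in>UNIV. ?a i j * (v i + v j)\<^sup>2) + (\<Sum>i\<in>UNIV. \<Sum>j\<in>UNIV. ?a i j * (v i - v j)\<^sup>2)
      = 2 * (\<Sum>i\<in>UNIV. \<Sum>j\<in>UNIV. ?a i j * ((v i)\<^sup>2 + (v j)\<^sup>2))"
      unfolding sum.distrib[symmetric] sq sum_distrib_left ..
    also have "\<dots> = 2 * (2 * (\<Sum>i\<in>UNIV. (\<Sum>j\<in>UNIV. ?a i j) * (v i)\<^sup>2))"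
      by (rule arg_cong[OF sum_symmetric_rows[of ?a "\<lambda>i. (v i)\<^sup>2", OF sa]])
    finally have "N + D1 = 2 * ((\<Sum>i\<in>UNIV. ?d i * (v i)\<^sup>2) + (\<Sum>i\<in>UNIV. (\<Sum>j\<in>UNIV. ?a i j) * (v i)\<^sup>2))"
      unfolding N_def D1_def by (rule lin)
    also have "\<dots> = 2 * (\<Sum>i\<in>UNIV. (?d i + (\<Sum>j\<in>UNIV. ?a i j)) * (v i)\<^sup>2)"
      unfolding distrib_right sum.distrib ..
    also have "\<dots> \<le> 2 * (\<Sum>i\<in>UNIV. 1 * (v i)\<^sup>2)"
    proof (intro mult_left_mono sum_mono mult_right_mono)
      fix i
      show "?d i + (\<Sum>j\<in>UNIV. ?a i j) \<le> 1"
      proof (cases "q i = 0")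
        case True
        then have "a i j = 0" for j using aq[of i j] a(1)[of i j] by simp
        then show ?thesis using True by simp
      next
        case False
        then have qi: "q i > 0" using q0[of i] by simp
        have "?a i j \<le> a i j / q i" for j using qi a by (intro divide_left_mono) auto
        then have "?d i + (\<Sum>j\<in>UNIV. ?a i j) \<le> d i / q i + (\<Sum>j\<in>UNIV. a i j / q i)"
          by (intro add_left_mono sum_mono)
        also have "\<dots> = 1" using qi by (simp add: sum_divide_distrib[symmetric] add_divide_distrib[symmetric] q[symmetric])
        finally show ?thesis .
      qed
    qed auto
    finally show ?thesis by (simp add: S_def)
  qed
  then have N: "N \<le> 2 * S - D1" by simp
  show ?thesis
  proof (cases "S = 0")
    case True
    then show ?thesis using D0 by (simp add: S_def D_def)
  next
    case False
    then have S: "S > 0" using S0 by simp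
    have D10: "D1 \<ge> 0" unfolding D1_def
      by (intro add_nonneg_nonneg sum_nonneg mult_nonneg_nonneg nn zero_le_power2) simp
    define x where "x = D1 / S"
    have x: "D1 = x * S" using S by (simp add: x_def)
    have "h1\<^sup>2 * S\<^sup>2 \<le> (x * S) * (2 * S - x * S)"
      using 1 mult_left_mono[OF N D10] by (simp add: power_mult_distrib x)
    also have "\<dots> = (x * (2 - x)) * S\<^sup>2" by (simp add: power2_eq_square algebra_simps)
    finally have "h1\<^sup>2 \<le> x * (2 - x)" using S by simp
    then have "(1 - x)\<^sup>2 \<le> 1 - h1\<^sup>2" by (simp add: power2_eq_square algebra_simps)
    then have x1: "1 - x \<le> sqrt (1 - h1\<^sup>2)" and "0 \<le> 1 - h1\<^sup>2"
      by (rule real_le_rsqrt, rule order_trans[OF zero_le_power2])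
    then have r0: "0 \<le> sqrt (1 - h1\<^sup>2)" by simp
    have "2 * S - D1 \<le> (1 + sqrt (1 - h1\<^sup>2)) * S"
      using mult_right_mono[OF x1, of S] S by (simp add: x algebra_simps)
    then have "D * N \<le> D * ((1 + sqrt (1 - h1\<^sup>2)) * S)" using N D0 by (intro mult_left_mono) auto
    then have "(h2\<^sup>2 * S) * S \<le> (D * (1 + sqrt (1 - h1\<^sup>2))) * S"
      using 2 by (simp add: power_mult_distrib power2_eq_square[of S] mult_ac)
    then have "h2\<^sup>2 * S \<le> D * (1 + sqrt (1 - h1\<^sup>2))" using S by simp
    then have "h2\<^sup>2 / (1 + sqrt (1 - h1\<^sup>2)) * S \<le> D"
      unfolding times_divide_eq_left using add_pos_nonneg[OF zero_less_one r0]
      by (simp only: pos_divide_le_eq)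
    then show ?thesis by (simp add: S_def D_def)
  qed
qed

lemma s_min_le: "s_min U \<eta> x \<le> s_i U \<eta> i x"
  by (simp add: s_min_def)

lemma h_gam_le:
  fixes U :: "real ^ 'n::finite \<Rightarrow> real"
  assumes "A \<noteq> {}"
  shows "h_gam U \<eta> \<gamma> x * real (card A) \<le> (\<Sum>i\<in>A. d_i U \<eta> i x / q_i U \<eta> i x powr \<gamma>) +
       (\<Sum>i\<in>A. \<Sum>j\<in>- A. \<bar>pderiv2 i j U x\<bar> / max (q_i U \<eta> i x) (q_i U \<eta> j x) powr \<gamma>)"
proof -
  let ?B = "\<lambda>A. (\<Sum>i\<in>A. d_i U \<eta> i x / q_i U \<eta> i x powr \<gamma>) +
       (\<Sum>i\<in>A. \<Sum>j\<in>- A. \<bar>pderiv2 i j U x\<bar> / max (q_i U \<eta> i x) (q_i U \<eta> j x) powr \<gamma>)"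
  have "h_gam U \<eta> \<gamma> x \<le> 1 / real (card A) * ?B A"
    unfolding h_gam_def by (rule Min_le) (use assms in auto)
  moreover have "card A > 0" using assms by (simp add: card_gt_0_iff)
  ultimately show ?thesis by (simp add: field_simps)
qed

lemma h_gam_nonneg:
  fixes U :: "real ^ 'n::finite \<Rightarrow> real"
  shows "0 \<le> h_gam U \<eta> \<gamma> x"
proof -
  let ?F = "\<lambda>A. 1 / real (card A) * ((\<Sum>i\<in>A. d_i U \<eta> i x / q_i U \<eta> i x powr \<gamma>) +
       (\<Sum>i\<in>A. \<Sum>j\<in>- A. \<bar>pderiv2 i j U x\<bar> / max (q_i U \<eta> i x) (q_i U \<eta> j x) powr \<gamma>))"
  have "?F ` {A. A \<noteq> {}} \<noteq> {}"
    using UNIV_not_empty[where 'a = 'n] by (simp only: image_is_empty) blast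
  then have "h_gam U \<eta> \<gamma> x \<in> ?F ` {A. A \<noteq> {}}"
    unfolding h_gam_def by (intro Min_in) simp
  then obtain A where "h_gam U \<eta> \<gamma> x = ?F A" by blast
  also have "\<dots> \<ge> 0"
    by (intro mult_nonneg_nonneg add_nonneg_nonneg sum_nonneg divide_nonneg_nonneg)
      (simp_all add: d_i_def s_min_le)
  finally show ?thesis .
qed

text \<open>
Replacing \<open>v\<close> by \<open>\<bar>v\<bar>\<close> and the off-diagonal entries by their negative absolute values only lowers the
quadratic form. What results is \<open>s_min \<Sum> v\<^sup>2\<close> plus the killed form with rates \<open>d_i\<close> and
\<open>\<bar>\<partial>\<^sub>i\<^sub>j U\<bar>\<close>, whose total rates are the \<open>q_i\<close>.
\<close>

lemma matrix_lower_bound: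
  fixes U :: "real ^ 'n::finite \<Rightarrow> real" and v :: "'n \<Rightarrow> real"
  assumes sym: "\<And>i j. pderiv2 i j U x = pderiv2 j i U x"
  shows "(s_min U \<eta> x + (h_gam U \<eta> (1/2) x)\<^sup>2 / (1 + sqrt (1 - (h_gam U \<eta> 1 x)\<^sup>2))) * (\<Sum>i\<in>UNIV. (v i)\<^sup>2)
    \<le> (\<Sum>i\<in>UNIV. \<eta> i (drop_coord i x) * (v i)\<^sup>2) + (\<Sum>i\<in>UNIV. \<Sum>j\<in>UNIV - {i}. pderiv2 i j U x * v i * v j)"
proof -
  define a where "a i j = (if i = j then 0 else \<bar>pderiv2 i j U x\<bar>)" for i j
  let ?d = "\<lambda>i. d_i U \<eta> i x" and ?q = "\<lambda>i. q_i U \<eta> i x" and ?e = "\<lambda>i. \<eta> i (drop_coord i x)"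
  have row: "(\<Sum>j\<in>UNIV. a i j * f j) = (\<Sum>j\<in>UNIV - {i}. \<bar>pderiv2 i j U x\<bar> * f j)" for i and f :: "'n \<Rightarrow> real"
    by (subst sum.remove[of _ i]) (auto simp: a_def intro!: sum.cong)
  have q: "?q i = ?d i + (\<Sum>j\<in>UNIV. a i j)" for i
    using row[of i "\<lambda>_. 1"] by (simp add: q_i_def d_i_def s_i_def Compl_eq_Diff_UNIV)
  have d0: "0 \<le> ?d i" for i by (simp add: d_i_def s_min_le)
  have a0: "0 \<le> a i j" for i j by (simp add: a_def)
  have asym: "a i j = a j i" for i j using sym by (simp add: a_def)
  have q0: "0 \<le> ?q i" for i using d0 a0 by (simp add: q sum_nonneg)
  have off: "(\<Sum>i\<in>A. \<Sum>j\<in>-A. a i j / f i j) = (\<Sum>i\<in>A. \<Sum>j\<in>-A. \<bar>pderiv2 i j U x\<bar> / f i j)"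
    for A and f :: "'n \<Rightarrow> 'n \<Rightarrow> real"
    by (intro sum.cong refl) (auto simp: a_def)
  define w where "w i = \<bar>v i\<bar>" for i
  have w2: "(w i)\<^sup>2 = (v i)\<^sup>2" for i by (simp add: w_def)
  have "(h_gam U \<eta> (1/2) x)\<^sup>2 / (1 + sqrt (1 - (h_gam U \<eta> 1 x)\<^sup>2)) * (\<Sum>i\<in>UNIV. (w i)\<^sup>2) \<le>
    (\<Sum>i\<in>UNIV. ?d i * (w i)\<^sup>2) + 1/2 * (\<Sum>i\<in>UNIV. \<Sum>j\<in>UNIV. a i j * (w i - w j)\<^sup>2)"
  proof (rule cheeger_with_killing[OF a0 asym d0 q h_gam_nonneg h_gam_nonneg])
    fix A :: "'n set" assume A: "A \<noteq> {}"
    have m0: "0 \<le> max (?q i) (?q j)" for i j using q0[of i] by simp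
    show "h_gam U \<eta> 1 x * real (card A) \<le> (\<Sum>i\<in>A. ?d i / ?q i) + (\<Sum>i\<in>A. \<Sum>j\<in>-A. a i j / max (?q i) (?q j))"
      using h_gam_le[OF A, of U \<eta> 1 x] q0 m0 by (simp add: off)
    show "h_gam U \<eta> (1/2) x * real (card A) \<le> (\<Sum>i\<in>A. ?d i / sqrt (?q i)) + (\<Sum>i\<in>A. \<Sum>j\<in>-A. a i j / sqrt (max (?q i) (?q j)))"
      using h_gam_le[OF A, of U \<eta> "1/2" x] q0 m0 by (simp add: off powr_half_sqrt)
  qed
  moreover have "(\<Sum>i\<in>UNIV. ?d i * (w i)\<^sup>2) + 1/2 * (\<Sum>i\<in>UNIV. \<Sum>j\<in>UNIV. a i j * (w i - w j)\<^sup>2) + s_min U \<eta> x * (\<Sum>i\<in>UNIV. (w i)\<^sup>2)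
     = (\<Sum>i\<in>UNIV. ?e i * (w i)\<^sup>2) - (\<Sum>i\<in>UNIV. \<Sum>j\<in>UNIV. a i j * (w i * w j))"
  proof -
    have "a i j * (w i - w j)\<^sup>2 = a i j * ((w i)\<^sup>2 + (w j)\<^sup>2) - 2 * (a i j * (w i * w j))" for i j
      by (simp add: power2_diff algebra_simps)
    then have "1/2 * (\<Sum>i\<in>UNIV. \<Sum>j\<in>UNIV. a i j * (w i - w j)\<^sup>2)
      = (\<Sum>i\<in>UNIV. (\<Sum>j\<in>UNIV. a i j) * (w i)\<^sup>2) - (\<Sum>i\<in>UNIV. \<Sum>j\<in>UNIV. a i j * (w i * w j))"
      using sum_symmetric_rows[of a "\<lambda>i. (w i)\<^sup>2", OF asym]
      by (simp add: sum_subtractf sum_distrib_left[symmetric])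
    moreover have "(\<Sum>i\<in>UNIV. ?d i * (w i)\<^sup>2) + (\<Sum>i\<in>UNIV. (\<Sum>j\<in>UNIV. a i j) * (w i)\<^sup>2) + s_min U \<eta> x * (\<Sum>i\<in>UNIV. (w i)\<^sup>2)
       = (\<Sum>i\<in>UNIV. ?e i * (w i)\<^sup>2)"
    proof -
      have "?e i = ?d i + (\<Sum>j\<in>UNIV. a i j) + s_min U \<eta> x" for i using q[of i] by (simp add: q_i_def)
      then show ?thesis by (simp add: distrib_right sum.distrib sum_distrib_left)
    qed
    ultimately show ?thesis by linarith
  qed
  moreover have "(\<Sum>i\<in>UNIV. - (\<Sum>j\<in>UNIV. a i j * (w i * w j))) \<le> (\<Sum>i\<in>UNIV. \<Sum>j\<in>UNIV - {i}. pderiv2 i j U x * v i * v j)"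
  proof (rule sum_mono)
    fix i
    have "(\<Sum>j\<in>UNIV. a i j * (w i * w j)) = (\<Sum>j\<in>UNIV - {i}. \<bar>pderiv2 i j U x * v i * v j\<bar>)"
      unfolding row by (simp add: w_def abs_mult mult.assoc)
    moreover have "- (\<Sum>j\<in>UNIV - {i}. \<bar>pderiv2 i j U x * v i * v j\<bar>) \<le> (\<Sum>j\<in>UNIV - {i}. pderiv2 i j U x * v i * v j)"
      unfolding sum_negf[symmetric] by (rule sum_mono) (simp add: abs_ge_minus_self minus_le_iff)
    ultimately show "- (\<Sum>j\<in>UNIV. a i j * (w i * w j)) \<le> (\<Sum>j\<in>UNIV - {i}. pderiv2 i j U x * v i * v j)" by simp
  qed
  ultimately show ?thesis unfolding w2 sum_negf distrib_right by linarith
qed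

section \<open>The lower bound for the spectral gap\<close>

lemma variance_nonneg: "0 \<le> prob_space.variance M (f :: 'a \<Rightarrow> real)"
  by simp

lemma poincare_nonpos:
  fixes V :: "'a::euclidean_space \<Rightarrow> real"
  assumes "\<kappa> \<le> 0" shows "poincare V \<kappa>"
  unfolding poincare_def
proof (intro allI impI)
  fix f :: "'a \<Rightarrow> real"
  have "\<kappa> * prob_space.variance (gibbs V) f \<le> 0"
    using assms by (intro mult_nonpos_nonneg variance_nonneg)
  also have "0 \<le> (\<integral>x. grad_sq f x \<partial>gibbs V)"
    by (intro integral_nonneg_AE AE_I2) (auto simp: grad_sq_def intro: sum_nonneg)
  finally show "\<kappa> * prob_space.variance (gibbs V) f \<le> (\<integral>x. grad_sq f x \<partial>gibbs V)" .
qed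

text \<open>
The admissible constants form a closed down-set, hence contain their supremum if it is finite.
\<close>

lemma poincare_if_le_spectral_gap:
  fixes V :: "'a::euclidean_space \<Rightarrow> real"
  assumes "ereal \<kappa> \<le> spectral_gap V" shows "poincare V \<kappa>"
  unfolding poincare_def
proof (intro allI impI)
  fix f :: "'a \<Rightarrow> real" assume f: "test_function f"
  define v where "v = prob_space.variance (gibbs V) f"
  let ?g = "\<integral>x. grad_sq f x \<partial>gibbs V"
  have v0: "0 \<le> v" unfolding v_def by (rule variance_nonneg)
  have "\<kappa> * v \<le> ?g"
  proof (rule field_le_epsilon)
    fix e :: real assume e: "e > 0"
    define k where "k = \<kappa> - e / (v + 1)"
    have "k < \<kappa>" using e v0 by (simp add: k_def)
    then have "ereal k < ereal \<kappa>" by simp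
    then have "ereal k < spectral_gap V" using assms by (rule less_le_trans)
    then obtain k' where k': "poincare V k'" "k < k'"
      unfolding spectral_gap_def by (auto simp: less_SUP_iff)
    have "\<kappa> * v = k * v + e * (v / (v + 1))" by (simp add: k_def algebra_simps)
    also have "\<dots> \<le> k' * v + e * 1"
      using k' e v0 by (intro add_mono mult_right_mono mult_left_mono) auto
    also have "k' * v \<le> ?g" using k'(1) f by (simp add: poincare_def v_def)
    finally show "\<kappa> * v \<le> ?g + e" by simp
  qed
  then show "\<kappa> * prob_space.variance (gibbs V) f \<le> ?g" by (simp add: v_def)
qed

lemma Basis_real_vec: "(Basis :: (real ^ 'n) set) = range (\<lambda>i. axis i 1)"
  by (auto simp: Basis_vec_def)

lemma sum_Basis_real_vec: "(\<Sum>b\<in>(Basis :: (real ^ 'n::finite) set). f b) = (\<Sum>i\<in>UNIV. f (axis i 1))"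
  unfolding Basis_real_vec by (subst sum.reindex) (auto simp: inj_on_def axis_eq_axis)

lemma pderiv2_pd: "pderiv2 i j U = pd (axis i 1) (pd (axis j 1) U)"
  by (simp add: pderiv2_def pderiv1_def[abs_def] pd_def[abs_def])

lemma cond_potential_line:
  "cond_potential U i (drop_coord i x) = (\<lambda>t. U (x - (x \<bullet> axis i 1) *\<^sub>R axis i 1 + t *\<^sub>R axis i 1))"
proof
  fix t
  have ia: "x \<bullet> axis i 1 = x $ i" by (simp add: inner_axis)
  have "insert_coord i t (drop_coord i x) = x - (x \<bullet> axis i 1) *\<^sub>R axis i 1 + t *\<^sub>R axis i 1"
    unfolding ia by (auto simp: vec_eq_iff insert_coord_def drop_coord_def axis_def)
  then show "cond_potential U i (drop_coord i x) t = U (x - (x \<bullet> axis i 1) *\<^sub>R axis i 1 + t *\<^sub>R axis i 1)"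
    by (simp add: cond_potential_def)
qed

text \<open>
For \<open>\<kappa> \<le> 0\<close> there is nothing to prove; for \<open>\<kappa> > 0\<close> this is the chain \<open>matrix_lower_bound\<close>,
\<open>second_order_from_lines\<close>, \<open>poincare_from_second_order\<close>.
\<close>

lemma poincare_if_pointwise:
  fixes U :: "real ^ 'n::finite \<Rightarrow> real"
  assumes U: "smooth U" and Z: "integrable lborel (\<lambda>x. exp (- U x))"
    and Zi: "\<And>i y. y \<in> extensional (- {i}) \<Longrightarrow>
           integrable lborel (\<lambda>t. exp (- cond_potential U i y t))"
    and gap: "\<And>i y. y \<in> extensional (- {i}) \<Longrightarrow>
           ereal (\<eta> i y) \<le> spectral_gap (cond_potential U i y)"
    and \<kappa>: "\<And>x. \<kappa> \<le> s_min U \<eta> x + (h_gam U \<eta> (1/2) x)\<^sup>2 / (1 + sqrt (1 - (h_gam U \<eta> 1 x)\<^sup>2))"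
  shows "poincare U \<kappa>"
proof (cases "\<kappa> \<le> 0")
  case True
  then show ?thesis by (rule poincare_nonpos)
next
  case False
  have ext: "drop_coord i x \<in> extensional (- {i})" for i and x :: "real ^ 'n"
    by (simp add: drop_coord_def)
  \<comment> \<open>directions are basis vectors in the general lemmas and indices here; \<open>THE\<close> inverts \<open>axis\<close>\<close>
  define E where "E b x = \<eta> (THE i. b = axis i 1) (drop_coord (THE i. b = axis i 1) x)" for b x :: "real ^ 'n"
  have E: "E (axis i 1) x = \<eta> i (drop_coord i x)" for i and x :: "real ^ 'n"
    by (simp add: E_def axis_eq_axis)
  have second: "\<kappa> * energy U f \<le> ip (Hw U f) (Hw U f)"
    if f: "test_function f" for f
  proof (rule second_order_from_lines[OF U _ _ _ f])
    fix b x :: "real ^ 'n" assume "b \<in> Basis"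
    then obtain i where b: "b = axis i 1" by (auto simp: Basis_real_vec)
    show "integrable lborel (\<lambda>t. exp (- U (x - (x \<bullet> b) *\<^sub>R b + t *\<^sub>R b)))"
      using Zi[OF ext, of i x] unfolding b cond_potential_line .
    show "poincare (\<lambda>t. U (x - (x \<bullet> b) *\<^sub>R b + t *\<^sub>R b)) (E b x)"
      using poincare_if_le_spectral_gap[OF gap[OF ext, of i x]] unfolding b cond_potential_line E .
  next
    fix x :: "real ^ 'n" and v :: "real ^ 'n \<Rightarrow> real"
    let ?v = "\<lambda>i. v (axis i 1)"
    have S0: "0 \<le> (\<Sum>i\<in>UNIV. (?v i)\<^sup>2)" by (simp add: sum_nonneg)
    have sym: "pderiv2 i j U x = pderiv2 j i U x" for i j
      unfolding pderiv2_pd by (subst pd_commute[OF U]) (auto simp: Basis_real_vec)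
    have off: "(\<Sum>c\<in>Basis - {axis i 1}. pd (axis i 1) (pd c U) x * ?v i * v c)
      = (\<Sum>j\<in>UNIV - {i}. pderiv2 i j U x * ?v i * ?v j)" for i
    proof -
      have "(Basis - {axis i 1} :: (real ^ 'n) set) = (\<lambda>j. axis j 1) ` (UNIV - {i})"
        by (auto simp: Basis_real_vec axis_eq_axis)
      then show ?thesis
        by (simp add: sum.reindex inj_on_def axis_eq_axis pderiv2_pd)
    qed
    have "\<kappa> * (\<Sum>i\<in>UNIV. (?v i)\<^sup>2) \<le>
      (s_min U \<eta> x + (h_gam U \<eta> (1/2) x)\<^sup>2 / (1 + sqrt (1 - (h_gam U \<eta> 1 x)\<^sup>2))) * (\<Sum>i\<in>UNIV. (?v i)\<^sup>2)"
      by (intro mult_right_mono \<kappa> S0)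
    also have "\<dots> \<le> (\<Sum>i\<in>UNIV. \<eta> i (drop_coord i x) * (?v i)\<^sup>2)
        + (\<Sum>i\<in>UNIV. \<Sum>j\<in>UNIV - {i}. pderiv2 i j U x * ?v i * ?v j)"
      by (rule matrix_lower_bound[OF sym])
    finally show "\<kappa> * (\<Sum>b\<in>Basis. (v b)\<^sup>2) \<le>
      (\<Sum>b\<in>Basis. E b x * (v b)\<^sup>2) + (\<Sum>b\<in>Basis. \<Sum>c\<in>Basis - {b}. pd b (pd c U) x * v b * v c)"
      unfolding sum_Basis_real_vec[of "\<lambda>b. (v b)\<^sup>2"] sum_Basis_real_vec[of "\<lambda>b. E b x * (v b)\<^sup>2"]
        sum_Basis_real_vec[of "\<lambda>b. \<Sum>c\<in>Basis - {b}. pd b (pd c U) x * v b * v c"] off E .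
  qed
  show ?thesis unfolding poincare_iff_ground_state[OF U Z]
    using poincare_from_second_order[OF U Z _ second] False by auto
qed

theorem theorem1p2:
  fixes U :: "real ^ 'n::finite \<Rightarrow> real"
    and \<eta> :: "'n \<Rightarrow> ('n \<Rightarrow> real) \<Rightarrow> real"
  assumes "smooth U"
    and "integrable lborel (\<lambda>x. exp (- U x))"
    and "\<And>i y. y \<in> extensional (- {i}) \<Longrightarrow>
           integrable lborel (\<lambda>t. exp (- cond_potential U i y t))"
    and "\<And>i y. y \<in> extensional (- {i}) \<Longrightarrow>
           ereal (\<eta> i y) \<le> spectral_gap (cond_potential U i y)"
  shows "spectral_gap U \<ge>
    (INF x. ereal (s_min U \<eta> x + (h_gam U \<eta> (1/2) x)\<^sup>2 / (1 + sqrt (1 - (h_gam U \<eta> 1 x)\<^sup>2))))"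
proof -
  let ?b = "\<lambda>x. s_min U \<eta> x + (h_gam U \<eta> (1/2) x)\<^sup>2 / (1 + sqrt (1 - (h_gam U \<eta> 1 x)\<^sup>2))"
  have low: "(INF x. ereal (?b x)) \<le> ereal (?b x)" for x
    by (rule INF_lower) simp
  show ?thesis
  proof (cases "INF x. ereal (?b x)")
    case (real \<kappa>)
    then have k: "\<kappa> \<le> ?b x" for x using low[of x] by (simp only: ereal_less_eq)
    have "poincare U \<kappa>" by (rule poincare_if_pointwise[OF assms(1,2) _ _ k]) (fact assms)+
    then show ?thesis unfolding real spectral_gap_def by (intro SUP_upper) simp
  next
    case PInf
    then show ?thesis using low[of 0] by (simp only: ereal_infty_less_eq) simp
  next
    case MInf
    then show ?thesis by simp
  qed
qed

end
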